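(* Let $P(z), q(z) \in \mathbb{C}[z]$ be complex polynomials with $P$ non-constant, and let $a, b$ be distinct complex numbers such that $P(a)=P(b)$ and $$\int_a^b P^i(z)\, q(z)\, dz = 0 \qquad \text{for all integers } i \geq 0.$$ Suppose that $P(z)$ is indecomposable. Let $Q(z)=\int q(z)\,dz$ be a polynomial antiderivative of $q$, i.e. $Q'(z)=q(z)$. Then there exists a polynomial $\tilde Q(z)\in\mathbb{C}[z]$ such that $Q(z)=\tilde Q(P(z))$.
   Context: A polynomial $P(z)\in\mathbb{C}[z]$ is called indecomposable if it cannot be represented as a composition $P(z)=P_1(P_2(z))$ with non-linear polynomials $P_1(z), P_2(z)\in\mathbb{C}[z]$ (that is, with $\deg P_1\geq 2$ and $\deg P_2\geq 2$). Here $P^i(z)$ denotes the $i$-th power $(P(z))^i$, and the integral is taken along any path in $\mathbb{C}$ from $a$ to $b$. *)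

theory Defs
  imports
    "HOL-Complex_Analysis.Contour_Integration"
    "HOL-Computational_Algebra.Polynomial"
begin

definition indecomposable_poly :: "complex poly \<Rightarrow> bool" where
  "indecomposable_poly P \<longleftrightarrow>
     \<not> (\<exists>P1 P2 :: complex poly. degree P1 \<ge> 2 \<and> degree P2 \<ge> 2 \<and> P = P1 \<circ>\<^sub>p P2)"

end

theory Submission
  imports Defs "HOL-Complex_Analysis.Complex_Analysis" "HOL-Number_Theory.Cong"
    "HOL-Computational_Algebra.Fundamental_Theorem_Algebra"
begin

text \<open>After a translation P(a) = P(b) = 0. Integrating by parts turns the moment conditions into the
  vanishing, for large t, of the integral of Q P' / (P - t) from a to b. By partial fractions this is
  a sum over the roots x of P - t of a polynomial in x plus Q(x) log ((x - b) / (x - a)). Continuing it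
  analytically to t near 0 and then several times around 0 changes the logarithms by integer
  multiples k(x) of the period, which are negative for x near a and positive for x near b. Hence the
  branches Q(x) satisfy a linear relation with nonconstant integer coefficients.

  The relations among the branches are invariant under the monodromy group of P, which contains an
  n-cycle (the loop around infinity) and is primitive because P is indecomposable. An argument of Schur
  for circulant matrices commuting with such a group shows that an invariant space with a
  nonconstant rational vector contains all differences of unit vectors. So Q takes the same value on
  all branches, that is, Q is constant on the fibres of P, and therefore a polynomial in P.\<close>

subsection \<open>Integer polynomials modulo x^n - 1\<close>

text \<open>That the numbers k(x) are integers is essential: Schur's argument compares circulants
  modulo primes. Averaging products of values of k over the group gives an integral invariant
  matrix, and all arithmetic is done with this one circulant. A constant k would be of no use, since
  the constant vectors form an invariant space of their own; the opposite signs at a and at b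
  exclude it.

  Two facts shape the analysis. The Cauchy transform is known only for large t, whereas the windings
  occur near 0, and critical values lie in between. Writing t = exp \<zeta> turns a punctured disc
  at 0 into a half-plane, and a strip over a sector free of critical values joins it to infinity; on
  this simply connected domain all branches and logarithms exist at once. Moreover, the relation is
  wanted at a large t, where the fibre is cyclically ordered by a circle around infinity, so after
  it has been found near 0 it is continued back through the strip. Monodromy is handled as the set
  of permutations obtained by lifting closed paths.\<close>

text \<open>The coefficient of x^h in f modulo x^n - 1, so that polynomials stand for elements of the group
  ring of Z/n and thereby for circulant matrices with entry cyc_coeff n f (i - j) at (i, j).\<close>

definition cyc_coeff :: "nat \<Rightarrow> int poly \<Rightarrow> int \<Rightarrow> int" where
  "cyc_coeff n f = fold_coeffs (\<lambda>a u h. (if int n dvd h then a else 0) + u (h - 1)) f (\<lambda>_. 0)"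

lemma cyc_coeff_0 [simp]: "cyc_coeff n 0 h = 0"
  by (simp add: cyc_coeff_def)

lemma cyc_coeff_pCons [simp]:
  "cyc_coeff n (pCons a f) h = (if int n dvd h then a else 0) + cyc_coeff n f (h - 1)"
  by (cases "a = 0 \<and> f = 0") (auto simp: cyc_coeff_def)

lemma cyc_coeff_add [simp]: "cyc_coeff n (f + g) h = cyc_coeff n f h + cyc_coeff n g h"
proof (induction f arbitrary: g h)
  case (pCons a f)
  then show ?case by (cases g) auto
qed simp

lemma cyc_coeff_smult [simp]: "cyc_coeff n (smult c f) h = c * cyc_coeff n f h"
  by (induction f arbitrary: h) (auto simp: algebra_simps)

lemma cyc_coeff_diff [simp]: "cyc_coeff n (f - g) h = cyc_coeff n f h - cyc_coeff n g h"
  using cyc_coeff_add[of n "f - g" g h] by simp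

lemma cyc_coeff_sum: "cyc_coeff n (sum f A) h = (\<Sum>x\<in>A. cyc_coeff n (f x) h)"
  by (induction A rule: infinite_finite_induct) auto

lemma cyc_coeff_cong: "[h = h'] (mod int n) \<Longrightarrow> cyc_coeff n f h = cyc_coeff n f h'"
proof (induction f arbitrary: h h')
  case (pCons a f)
  have "[h - 1 = h' - 1] (mod int n)" using pCons.prems by (intro cong_diff) auto
  moreover have "int n dvd h \<longleftrightarrow> int n dvd h'" using pCons.prems by (metis cong_0_iff cong_sym cong_trans)
  ultimately show ?case using pCons.IH[of "h-1" "h'-1"] by simp
qed simp

lemma cyc_coeff_monom_mult [simp]: "cyc_coeff n (monom c k * f) h = c * cyc_coeff n f (h - int k)"
proof (induction k arbitrary: h)
  case (Suc k)
  have "monom c (Suc k) * f = pCons 0 (monom c k * f)" by (simp add: monom_Suc)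
  then show ?case using Suc by (simp add: algebra_simps)
qed (simp add: monom_0)

lemma cyc_coeff_1: "cyc_coeff n 1 h = (if int n dvd h then 1 else 0)"
  by (simp add: one_pCons)

lemma cyc_coeff_monom: "cyc_coeff n (monom c k) h = (if [h = int k] (mod int n) then c else 0)"
  using cyc_coeff_monom_mult[of n c k 1 h] by (simp add: cyc_coeff_1 cong_iff_dvd_diff)

text \<open>Cyclic convolution: this is what makes products of polynomials into products of
  circulant matrices.\<close>

lemma cyc_coeff_mult:
  assumes "n > 0"
  shows "cyc_coeff n (f * g) h = (\<Sum>l\<in>{0..<int n}. cyc_coeff n f (h - l) * cyc_coeff n g l)"
proof (induction f arbitrary: h)
  case (pCons a f)
  have "(\<Sum>l\<in>{0..<int n}. (if int n dvd h - l then a else 0) * cyc_coeff n g l)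
      = (\<Sum>l\<in>{0..<int n}. if l = h mod int n then a * cyc_coeff n g h else 0)"
  proof (rule sum.cong[OF refl])
    fix l assume l: "l \<in> {0..<int n}"
    have eq: "int n dvd h - l \<longleftrightarrow> l = h mod int n"
      using l mod_eq_dvd_iff[of h "int n" l] mod_pos_pos_trivial[of l "int n"] by (metis atLeastLessThan_iff)
    moreover have "cyc_coeff n g (h mod int n) = cyc_coeff n g h"
      by (rule cyc_coeff_cong) simp
    ultimately show "(if int n dvd h - l then a else 0) * cyc_coeff n g l = (if l = h mod int n then a * cyc_coeff n g h else 0)"
      by auto
  qed
  also have "\<dots> = a * cyc_coeff n g h" using assms by simp
  finally show ?case using pCons.IH[of "h - 1"]
    by (simp add: distrib_right sum.distrib algebra_simps)
qed simp

section \<open>Congruences modulo a prime\<close>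

lemma prime_dvd_power_add_diff:
  fixes u v :: "'a :: comm_ring_1"
  assumes "prime p"
  shows "of_nat p dvd (u + v) ^ p - u ^ p - v ^ p"
proof -
  have p: "p > 0" using assms by (rule prime_gt_0_nat)
  have "(u + v) ^ p = (\<Sum>k\<le>p. of_nat (p choose k) * u ^ k * v ^ (p - k))"
    by (rule binomial_ring)
  also have "{..p} = insert 0 (insert p {0<..<p})" using p by auto
  also have "(\<Sum>k\<in>\<dots>. of_nat (p choose k) * u ^ k * v ^ (p - k)) = 
     v ^ p + (u ^ p + (\<Sum>k\<in>{0<..<p}. of_nat (p choose k) * u ^ k * v ^ (p - k)))"
    using p by simp
  finally have "(u + v) ^ p - u ^ p - v ^ p = (\<Sum>k\<in>{0<..<p}. of_nat (p choose k) * u ^ k * v ^ (p - k))"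
    by simp
  moreover have "of_nat p dvd (\<Sum>k\<in>{0<..<p}. of_nat (p choose k) * u ^ k * v ^ (p - k))"
  proof (rule dvd_sum)
    fix k assume k: "k \<in> {0<..<p}"
    have "p dvd (p choose k)" using k assms by (intro dvd_choose_prime) auto
    then have "(of_nat p :: 'a) dvd of_nat (p choose k)" by (metis dvdE dvd_triv_left of_nat_mult)
    then show "(of_nat p :: 'a) dvd of_nat (p choose k) * u ^ k * v ^ (p - k)" by (simp add: dvd_mult2)
  qed
  ultimately show ?thesis by simp
qed

lemma prime_dvd_int_power_diff:
  assumes "prime p"
  shows "int p dvd a ^ p - (a::int)"
proof (induction a rule: int_induct[of _ 0])
  case base
  then show ?case using assms prime_gt_0_nat[of p] by (simp add: power_0_left)
next
  case (step1 i)
  have "int p dvd ((i + 1) ^ p - i ^ p - 1 ^ p) + (i ^ p - i)"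
    using prime_dvd_power_add_diff[OF assms, of i 1] step1 by (intro dvd_add) auto
  then show ?case by (simp add: algebra_simps)
next
  case (step2 i)
  have eq: "(i - 1) ^ p - (i - 1) = (i ^ p - i) - (((i - 1) + 1) ^ p - (i - 1) ^ p - 1 ^ p)" by simp
  have "int p dvd (i ^ p - i) - (((i - 1) + 1) ^ p - (i - 1) ^ p - 1 ^ p)"
    using prime_dvd_power_add_diff[OF assms, of "i - 1" 1] step2.IH by (metis dvd_diff of_nat_id of_nat_eq_iff of_int_of_nat_eq)
  then show ?case unfolding eq .
qed

text \<open>The Frobenius map of F_p[x] is additive and multiplicative and fixes the constants by
  Fermat's little theorem, so it is determined by its value x^p at x.\<close>

lemma prime_dvd_poly_power_diff:
  fixes f :: "int poly"
  assumes "prime p"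
  shows "of_nat p dvd f ^ p - f \<circ>\<^sub>p monom 1 p"
proof (induction f)
  case 0
  then show ?case using assms prime_gt_0_nat[of p] by (simp add: power_0_left)
next
  case (pCons a f)
  have p0: "p > 0" using assms prime_gt_0_nat by auto
  let ?x = "monom 1 1 :: int poly"
  have eq: "pCons a f = [:a:] + ?x * f" by (simp add: monom_altdef)
  have comp: "pCons a f \<circ>\<^sub>p monom 1 p = [:a:] + ?x ^ p * (f \<circ>\<^sub>p monom 1 p)"
    by (simp add: pcompose_pCons monom_power)
  have d1: "of_nat p dvd ([:a:] + ?x * f) ^ p - [:a:] ^ p - (?x * f) ^ p"
    by (rule prime_dvd_power_add_diff[OF assms])
  have d2: "of_nat p dvd [:a:] ^ p - [:a:]"
  proof -
    obtain c where "a ^ p - a = int p * c" using prime_dvd_int_power_diff[OF assms, of a] by (auto elim: dvdE)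
    then have "[:a:] ^ p - [:a:] = of_nat p * [:c:]"
      by (simp add: poly_const_pow of_nat_poly)
    then show ?thesis by (rule dvdI)
  qed
  have d3: "of_nat p dvd ?x ^ p * (f ^ p - f \<circ>\<^sub>p monom 1 p)"
    using pCons.IH by (rule dvd_mult)
  have "pCons a f ^ p - pCons a f \<circ>\<^sub>p monom 1 p =
    (([:a:] + ?x * f) ^ p - [:a:] ^ p - (?x * f) ^ p) + ([:a:] ^ p - [:a:]) + ?x ^ p * (f ^ p - f \<circ>\<^sub>p monom 1 p)"
    unfolding comp unfolding eq by (simp add: algebra_simps power_mult_distrib)
  then show ?case using d1 d2 d3 by (metis dvd_add)
qed

lemma cyc_coeff_power_cong:
  assumes "prime p"
  shows "[cyc_coeff n (f ^ p) h = cyc_coeff n (f \<circ>\<^sub>p monom 1 p) h] (mod int p)"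
proof -
  obtain g where "f ^ p - f \<circ>\<^sub>p monom 1 p = of_nat p * g"
    using prime_dvd_poly_power_diff[OF assms, of f] by (auto elim: dvdE)
  then have "f ^ p - f \<circ>\<^sub>p monom 1 p = smult (int p) g" by (simp add: of_nat_poly)
  then have "cyc_coeff n (f ^ p) h - cyc_coeff n (f \<circ>\<^sub>p monom 1 p) h = int p * cyc_coeff n g h"
    by (metis cyc_coeff_diff cyc_coeff_smult)
  then show ?thesis by (simp add: cong_iff_dvd_diff)
qed

text \<open>Multiplication by \<open>p\<close> permutes the residues modulo \<open>n\<close>, so the
  substitution merges no two residue classes of exponents.\<close>

lemma cyc_coeff_pcompose_coprime:
  assumes "coprime p n"
  shows "cyc_coeff n (f \<circ>\<^sub>p monom 1 p) (int p * h) = cyc_coeff n f h"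
proof (induction f arbitrary: h)
  case (pCons a f)
  have "int n dvd int p * h \<longleftrightarrow> int n dvd h" using assms
    by (metis coprime_commute coprime_dvd_mult_right_iff coprime_int_iff)
  moreover have "int p * h - int p = int p * (h - 1)" by (simp add: algebra_simps)
  ultimately show ?case using pCons.IH[of "h - 1"] by (simp add: pcompose_pCons)
qed simp

text \<open>Explicit witness: to \<open>a\<close> is added \<open>b\<close> times the product of
  those primes of \<open>K\<close> that divide neither \<open>a\<close> nor \<open>b\<close>. Every
  prime of \<open>K\<close> then divides exactly one of the two summands. Combined with
  factorisation into primes, this takes the place of Dirichlet's theorem on primes in residue
  classes.\<close>

lemma exists_coprime_in_residue_class:
  fixes a b K :: int
  assumes "coprime a b" "K \<noteq> 0"
  shows "\<exists>a'. [a' = a] (mod b) \<and> coprime a' K"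
proof -
  define S where "S = {q \<in> prime_factors K. \<not> q dvd a \<and> \<not> q dvd b}"
  have fin: "finite S" by (simp add: S_def)
  define a' where "a' = a + b * \<Prod>S"
  have "coprime a' K"
  proof (rule ccontr)
    assume "\<not> coprime a' K"
    then have "gcd a' K \<noteq> 1" by (simp add: coprime_iff_gcd_eq_1)
    moreover have "gcd a' K \<noteq> 0" using assms by simp
    ultimately obtain q where q: "prime q" "q dvd gcd a' K"
      by (metis is_unit_gcd prime_divisor_exists is_unit_gcd_iff)
    then have qK: "q \<in> prime_factors K" and qa': "q dvd a'" using assms by (auto simp: prime_factors_dvd)
    show False
    proof (cases "q dvd b")
      case True
      then have "q dvd a" using qa' by (simp add: a'_def dvd_add_left_iff)
      then show False using True assms q by (meson coprime_def not_prime_unit)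
    next
      case nb: False
      show False
      proof (cases "q dvd a")
        case True
        then have "q dvd b * \<Prod>S" using qa' by (simp add: a'_def dvd_add_right_iff)
        then have "q dvd \<Prod>S" using nb q by (simp add: prime_dvd_mult_iff)
        then obtain r where r: "r \<in> S" "q dvd r" using q fin by (auto simp: prime_dvd_prod_iff)
        then have "q = r" using q by (auto simp: S_def dest: primes_dvd_imp_eq)
        then show False using r True by (simp add: S_def)
      next
        case False
        then have "q \<in> S" using nb qK by (simp add: S_def)
        then have "q dvd b * \<Prod>S" using fin by (simp add: dvd_prod_eqI dvd_mult)
        then show False using False qa' by (simp add: a'_def dvd_add_left_iff)
      qed
    qed
  qed
  moreover have "[a' = a] (mod b)" by (simp add: a'_def cong_iff_dvd_diff)
  ultimately show ?thesis by blast
qed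

section \<open>Integral linear dependence and symmetric circulants\<close>

lemma integer_vectors_dependent:
  fixes v :: "'a \<Rightarrow> nat \<Rightarrow> int"
  assumes "finite I" "card I > n"
  shows "\<exists>c. (\<exists>r\<in>I. c r \<noteq> 0) \<and> (\<forall>i<n. (\<Sum>r\<in>I. c r * v r i) = 0)"
  using assms
proof (induction n arbitrary: I v)
  case 0
  then have "I \<noteq> {}" by auto
  then show ?case by (intro exI[of _ "\<lambda>_. 1"]) auto
next
  case (Suc n)
  show ?case
  proof (cases "\<exists>s\<in>I. v s n \<noteq> 0")
    case False
    have "\<exists>c. (\<exists>r\<in>I. c r \<noteq> 0) \<and> (\<forall>i<n. (\<Sum>r\<in>I. c r * v r i) = 0)"
      using Suc.IH[of I v] Suc.prems by simp
    then show ?thesis using False by (auto simp: less_Suc_eq)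
  next
    case True
    then obtain s where s: "s \<in> I" "v s n \<noteq> 0" by auto
    define J where "J = I - {s}"
    have J: "finite J" "card J > n" "s \<notin> J" "I = insert s J" using Suc.prems s by (auto simp: J_def)
    obtain c where c: "\<exists>r\<in>J. c r \<noteq> 0" "\<forall>i<n. (\<Sum>r\<in>J. c r * (v s n * v r i - v r n * v s i)) = 0"
      using Suc.IH[OF J(1,2), of "\<lambda>r i. v s n * v r i - v r n * v s i"] by auto
    \<comment> \<open>Fraction-free elimination: each vector of \<open>J\<close> is combined with
      \<open>v s\<close> so that coordinate \<open>n\<close> vanishes, and the coefficient at
      \<open>s\<close> collects what these combinations subtract.\<close>
    define d where "d r = (if r = s then - (\<Sum>r\<in>J. c r * v r n) else c r * v s n)" for r
    have sumd: "(\<Sum>r\<in>I. d r * v r i) = (\<Sum>r\<in>J. c r * (v s n * v r i - v r n * v s i))" for i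
    proof -
      have "(\<Sum>r\<in>J. d r * v r i) = (\<Sum>r\<in>J. c r * v s n * v r i)"
        using J(3) by (intro sum.cong) (auto simp: d_def)
      then show ?thesis using J(1,3,4)
        by (simp add: d_def sum_distrib_left sum_distrib_right sum_subtractf algebra_simps)
    qed
    have "\<exists>r\<in>I. d r \<noteq> 0" using c(1) s J by (auto simp: d_def intro!: bexI)
    moreover have "(\<Sum>r\<in>I. d r * v r i) = 0" if "i < Suc n" for i
      unfolding sumd using that c(2) by (auto simp: less_Suc_eq algebra_simps)
    ultimately show ?thesis by blast
  qed
qed

text \<open>Only injectivity on residues is asked of \<open>\<phi>\<close>. Besides a reflection or
  a translation it can thus be the action of a group element on indices, for which there is no
  formula.\<close>

lemma sum_periodic_reindex:
  fixes w :: "int \<Rightarrow> 'b :: comm_monoid_add"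
  assumes "n > 0"
    and per: "\<And>h h'. [h = h'] (mod int n) \<Longrightarrow> w h = w h'"
    and inj: "\<And>l l'. [\<phi> l = \<phi> l'] (mod int n) \<Longrightarrow> [l = l'] (mod int n)"
  shows "(\<Sum>l\<in>{0..<int n}. w (\<phi> l)) = (\<Sum>l\<in>{0..<int n}. w l)"
proof -
  let ?S = "{0..<int n}" and ?\<psi> = "\<lambda>l. \<phi> l mod int n"
  have "inj_on ?\<psi> ?S"
  proof (rule inj_onI)
    fix l l' assume "l \<in> ?S" "l' \<in> ?S" "?\<psi> l = ?\<psi> l'"
    then have "[\<phi> l = \<phi> l'] (mod int n)" by (simp only: cong_def)
    then have "[l = l'] (mod int n)" by (rule inj)
    then show "l = l'" using \<open>l \<in> ?S\<close> \<open>l' \<in> ?S\<close> by (simp add: cong_def)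
  qed
  moreover have "?\<psi> ` ?S \<subseteq> ?S" using assms(1) by auto
  ultimately have "bij_betw ?\<psi> ?S ?S" by (simp add: bij_betw_def endo_inj_surj)
  then have "(\<Sum>l\<in>?S. w (?\<psi> l)) = (\<Sum>l\<in>?S. w l)" by (rule sum.reindex_bij_betw)
  moreover have "w (?\<psi> l) = w (\<phi> l)" for l by (rule per) simp
  ultimately show ?thesis by simp
qed

lemma cyc_coeff_mult_cong:
  assumes "n > 0" "cyc_coeff n f = cyc_coeff n f'"
  shows "cyc_coeff n (f * g) = cyc_coeff n (f' * g)"
proof
  fix h
  show "cyc_coeff n (f * g) h = cyc_coeff n (f' * g) h"
    unfolding cyc_coeff_mult[OF assms(1)] assms(2) ..
qed

text \<open>Symmetry of the circulant matrix with entries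
  \<open>cyc_coeff n f (i - j)\<close>.\<close>

definition cyc_sym :: "nat \<Rightarrow> int poly \<Rightarrow> bool" where
  "cyc_sym n f \<longleftrightarrow> (\<forall>h. cyc_coeff n f (- h) = cyc_coeff n f h)"

lemma cyc_sym_mult:
  assumes "n > 0" "cyc_sym n f" "cyc_sym n g"
  shows "cyc_sym n (f * g)"
  unfolding cyc_sym_def
proof
  fix h
  have "cyc_coeff n (f * g) (- h) = (\<Sum>l\<in>{0..<int n}. cyc_coeff n f (- h - l) * cyc_coeff n g l)"
    using assms by (simp add: cyc_coeff_mult)
  also have "\<dots> = (\<Sum>l\<in>{0..<int n}. cyc_coeff n f (h - (- l)) * cyc_coeff n g (- l))"
  proof (rule sum.cong[OF refl])
    fix l
    have "cyc_coeff n f (- h - l) = cyc_coeff n f (- (- h - l))" using assms unfolding cyc_sym_def by metis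
    then show "cyc_coeff n f (- h - l) * cyc_coeff n g l = cyc_coeff n f (h - (- l)) * cyc_coeff n g (- l)"
      using assms unfolding cyc_sym_def by (simp add: add.commute)
  qed
  also have "\<dots> = (\<Sum>l\<in>{0..<int n}. cyc_coeff n f (h - l) * cyc_coeff n g l)"
    by (rule sum_periodic_reindex[OF assms(1), of "\<lambda>l. cyc_coeff n f (h - l) * cyc_coeff n g l"])
       (auto intro!: arg_cong2[of _ _ _ _ "(*)"] cyc_coeff_cong cong_diff simp: cong_minus_minus_iff)
  finally show "cyc_coeff n (f * g) (- h) = cyc_coeff n (f * g) h"
    using assms by (simp add: cyc_coeff_mult)
qed

lemma cyc_sym_1: "cyc_sym n 1"
  by (simp add: cyc_sym_def cyc_coeff_1)

lemma cyc_sym_power: "n > 0 \<Longrightarrow> cyc_sym n f \<Longrightarrow> cyc_sym n (f ^ k)"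
  by (induction k) (auto simp: cyc_sym_1 cyc_sym_mult)

lemma cyc_sym_sum_smult: "(\<And>x. x \<in> A \<Longrightarrow> cyc_sym n (f x)) \<Longrightarrow> cyc_sym n (\<Sum>x\<in>A. smult (c x) (f x))"
  by (auto simp: cyc_sym_def cyc_coeff_sum intro!: sum.cong)

text \<open>For symmetric \<open>u\<close> the coefficient of the square at 0 is the sum of the
  squares of all coefficients. This is the form in which diagonalisability enters: there are no
  symmetric nilpotents.\<close>

lemma cyc_sym_square_eq_0:
  assumes "n > 0" "cyc_sym n u" "cyc_coeff n (u * u) = (\<lambda>_. 0)"
  shows "cyc_coeff n u = (\<lambda>_. 0)"
proof
  fix h
  have "(\<Sum>l\<in>{0..<int n}. cyc_coeff n u l * cyc_coeff n u l) = cyc_coeff n (u * u) 0"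
    using assms(1,2) by (simp add: cyc_coeff_mult cyc_sym_def)
  then have "\<forall>l\<in>{0..<int n}. cyc_coeff n u l * cyc_coeff n u l = 0"
    using assms(3) by (subst (asm) (1) fun_eq_iff) (simp add: sum_nonneg_eq_0_iff)
  then have "cyc_coeff n u (h mod int n) = 0" using assms(1) by simp
  moreover have "cyc_coeff n u h = cyc_coeff n u (h mod int n)" by (rule cyc_coeff_cong) simp
  ultimately show "cyc_coeff n u h = 0" by simp
qed

text \<open>Symmetric circulant matrices are diagonalisable; an integral linear dependence between the
  powers of such a matrix therefore yields a multiple of the idempotent onto its image.\<close>

lemma exists_scaled_idempotent:
  assumes n: "n > 0" and sym: "cyc_sym n f"
  obtains N c where "N \<noteq> 0"
    "cyc_coeff n (f * (f * (\<Sum>r\<le>n. smult (c r) (f ^ r)))) = cyc_coeff n (smult N f)"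
proof -
  \<comment> \<open>These are n + 1 vectors in dimension n. The powers start at 1, so that the least
    exponent \<open>r0\<close> of the dependence is positive.\<close>
  obtain c where c: "\<exists>r\<in>{1..n+1}. c r \<noteq> 0"
    "\<forall>i<n. (\<Sum>r\<in>{1..n+1}. c r * cyc_coeff n (f ^ r) (int i)) = 0"
    using integer_vectors_dependent[of "{1..n+1}" n "\<lambda>r i. cyc_coeff n (f ^ r) (int i)"] by auto
  define r0 where "r0 = (LEAST r. r \<in> {1..n+1} \<and> c r \<noteq> 0)"
  have "\<exists>r. r \<in> {1..n+1} \<and> c r \<noteq> 0" using c(1) by blast
  then have "r0 \<in> {1..n+1} \<and> c r0 \<noteq> 0" unfolding r0_def by (rule LeastI_ex)
  then have r0: "r0 \<in> {1..n+1}" "c r0 \<noteq> 0" by simp_all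
  have less: "c r = 0" if "r \<in> {1..n+1}" "r < r0" for r
    using not_less_Least[OF that(2)[unfolded r0_def]] that(1) by simp
  define y where "y = (\<Sum>r\<in>{r0..n+1}. smult (c r) (f ^ (r - r0)))"
  have "(\<Sum>r\<in>{1..n+1}. smult (c r) (f ^ r)) = (\<Sum>r\<in>{r0..n+1}. smult (c r) (f ^ r))"
    using r0 less by (intro sum.mono_neutral_right) auto
  also have "\<dots> = f ^ r0 * y"
    unfolding y_def sum_distrib_left by (intro sum.cong) (auto simp: power_add[symmetric])
  finally have eq: "f ^ r0 * y = (\<Sum>r\<in>{1..n+1}. smult (c r) (f ^ r))" by simp
  have z0: "cyc_coeff n (f ^ r0 * y) = (\<lambda>_. 0)"
  proof
    fix h
    have "cyc_coeff n (f ^ r0 * y) h = cyc_coeff n (f ^ r0 * y) (h mod int n)"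
      by (rule cyc_coeff_cong) simp
    also have "h mod int n = int (nat (h mod int n))" "nat (h mod int n) < n"
      using n by (auto simp: nat_less_iff)
    then have "cyc_coeff n (f ^ r0 * y) (h mod int n) = 0"
      using c(2) unfolding eq cyc_coeff_sum cyc_coeff_smult by metis
    finally show "cyc_coeff n (f ^ r0 * y) h = 0" .
  qed
  have symy: "cyc_sym n y" unfolding y_def
    by (intro cyc_sym_sum_smult cyc_sym_power n sym)
  \<comment> \<open>For positive k the square of f^k y contains the factor f^(k+1) y, so by
    \<open>cyc_sym_square_eq_0\<close> vanishing descends from exponent k + 1 to k.\<close>
  have red: "cyc_coeff n (f ^ k * y) = (\<lambda>_. 0) \<Longrightarrow> k \<ge> 1 \<Longrightarrow> cyc_coeff n (f * y) = (\<lambda>_. 0)" for k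
  proof (induction k)
    case (Suc k)
    show ?case
    proof (cases "k = 0")
      case True then show ?thesis using Suc.prems by simp
    next
      case False
      let ?u = "f ^ k * y"
      have "?u * ?u = (f ^ Suc k * y) * (f ^ (k - 1) * y)"
      proof -
        have "f ^ k * f ^ k = f ^ Suc k * f ^ (k - 1)" using False by (simp add: power_add[symmetric] del: power_Suc)
        moreover have "?u * ?u = (f ^ k * f ^ k) * (y * y)" by (simp only: mult_ac)
        ultimately show ?thesis by (simp only: mult_ac)
      qed
      moreover have "cyc_coeff n ((f ^ Suc k * y) * (f ^ (k - 1) * y)) = cyc_coeff n (0 * (f ^ (k - 1) * y))"
        using Suc.prems by (intro cyc_coeff_mult_cong n) (auto simp: fun_eq_iff)
      ultimately have "cyc_coeff n (?u * ?u) = cyc_coeff n 0" by (simp only: mult_zero_left)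
      then have "cyc_coeff n (?u * ?u) = (\<lambda>_. 0)" by (metis cyc_coeff_0 ext)
      then have "cyc_coeff n ?u = (\<lambda>_. 0)"
        by (rule cyc_sym_square_eq_0[OF n cyc_sym_mult[OF n cyc_sym_power[OF n sym] symy]])
      then show ?thesis using Suc.IH False by simp
    qed
  qed simp
  have fy: "cyc_coeff n (f * y) = (\<lambda>_. 0)" using red[OF z0] r0 by simp
  \<comment> \<open>The element \<open>y\<close> has constant term \<open>c r0\<close>. The negated
    remaining coefficients are shifted by r0 + 1 because one factor f is split off; together with f
    y = 0 this yields the multiple c r0 of f.\<close>
  define d where "d r = (if r + r0 + 1 \<le> n + 1 then - c (r + r0 + 1) else 0)" for r
  have "f * (\<Sum>r\<le>n. smult (d r) (f ^ r)) = (\<Sum>r\<le>n. smult (d r) (f ^ Suc r))"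
    by (simp add: sum_distrib_left)
  also have "\<dots> = (\<Sum>r\<in>{r. r + r0 + 1 \<le> n + 1}. smult (- c (r + r0 + 1)) (f ^ Suc r))"
    by (rule sum.mono_neutral_cong_right) (auto simp: d_def)
  also have "\<dots> = (\<Sum>r\<in>{r0+1..n+1}. smult (- c r) (f ^ (r - r0)))"
    by (rule sum.reindex_bij_witness[of _ "\<lambda>r. r - r0 - 1" "\<lambda>r. r + r0 + 1"]) auto
  also have "\<dots> = - (\<Sum>r\<in>{r0+1..n+1}. smult (c r) (f ^ (r - r0)))" by (simp add: sum_negf)
  also have "\<dots> = [:c r0:] - y"
  proof -
    have eq: "{r0..n+1} = insert r0 {r0+1..n+1}" using r0(1) by force
    have "y = smult (c r0) (f ^ (r0 - r0)) + (\<Sum>r\<in>{r0+1..n+1}. smult (c r) (f ^ (r - r0)))"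
      unfolding y_def eq by (rule sum.insert) auto
    also have "smult (c r0) (f ^ (r0 - r0)) = [:c r0:]" by (simp only: diff_self_eq_0 power_0 smult_one)
    finally show ?thesis by (metis add_diff_cancel_left' minus_diff_eq)
  qed
  finally have E: "f * (\<Sum>r\<le>n. smult (d r) (f ^ r)) = [:c r0:] - y" .
  have "cyc_coeff n (f * (f * (\<Sum>r\<le>n. smult (d r) (f ^ r)))) = cyc_coeff n (smult (c r0) f)"
    using fy unfolding E by (simp add: fun_eq_iff right_diff_distrib)
  then show ?thesis using that r0 by blast
qed

text \<open>The p-th power of \<open>E\<close> is N^(p-1) E, hence \<open>E\<close> modulo p by
  Fermat's theorem. By the Frobenius congruence it is also E(x^p), whose coefficient at p h is that
  of \<open>E\<close> at h.\<close>

lemma scaled_idempotent_prime_mult: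
  assumes n: "n > 0" and idem: "cyc_coeff n (E * E) = cyc_coeff n (smult N E)"
    and p: "prime p" "\<not> p dvd n" "\<not> int p dvd N"
  shows "[cyc_coeff n E (int p * h) = cyc_coeff n E h] (mod int p)"
proof -
  have pw: "cyc_coeff n (E ^ Suc k) h = N ^ k * cyc_coeff n E h" for k h
  proof (induction k arbitrary: h)
    case (Suc k)
    have "cyc_coeff n (E ^ Suc (Suc k)) = cyc_coeff n ((E * E) * E ^ k)" by (simp add: mult_ac)
    also have "\<dots> = cyc_coeff n (smult N E * E ^ k)" by (intro cyc_coeff_mult_cong n idem)
    also have "smult N E * E ^ k = smult N (E ^ Suc k)" by simp
    finally show ?case using Suc by simp
  qed simp
  have p0: "p = Suc (p - 1)" using p prime_gt_0_nat by fastforce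
  have cop: "coprime p n" using p by (simp add: prime_imp_coprime)
  have "[N ^ p = N] (mod int p)" using prime_dvd_int_power_diff[OF p(1)] by (simp add: cong_iff_dvd_diff)
  then have "[N * N ^ (p - 1) = N * 1] (mod int p)" using p0 by (metis mult.right_neutral power_Suc)
  moreover have "coprime N (int p)" using p
    by (metis coprime_commute prime_imp_coprime prime_nat_int_transfer)
  ultimately have N1: "[N ^ (p - 1) = 1] (mod int p)" using cong_mult_lcancel by blast
  have "cyc_coeff n (E ^ p) (int p * h) = N ^ (p - 1) * cyc_coeff n E (int p * h)"
    using pw[of "p - 1"] p0 by simp
  then have "[N ^ (p - 1) * cyc_coeff n E (int p * h) = cyc_coeff n E h] (mod int p)"
    using cyc_coeff_power_cong[OF p(1), of n E "int p * h"] cyc_coeff_pcompose_coprime[OF cop] by simp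
  moreover have "[N ^ (p - 1) * cyc_coeff n E (int p * h) = 1 * cyc_coeff n E (int p * h)] (mod int p)"
    using N1 by (intro cong_mult) auto
  ultimately show ?thesis by (metis cong_sym cong_trans mult_1)
qed

text \<open>The congruence modulo large primes becomes an equality, and every unit modulo n is
  represented by a product of large primes.\<close>

lemma scaled_idempotent_unit_mult:
  assumes n: "n > 0" and N: "N \<noteq> 0" and idem: "cyc_coeff n (E * E) = cyc_coeff n (smult N E)"
    and m: "coprime m (int n)"
  shows "cyc_coeff n E (m * h) = cyc_coeff n E h"
proof -
  \<comment> \<open>Two coefficients differ by at most 2 B, so a congruence between them modulo a
    prime above 2 B is an equality.\<close>
  define B where "B = (\<Sum>l\<in>{0..<int n}. \<bar>cyc_coeff n E l\<bar>)"
  have bound: "\<bar>cyc_coeff n E h\<bar> \<le> B" for h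
  proof -
    have "cyc_coeff n E h = cyc_coeff n E (h mod int n)" by (rule cyc_coeff_cong) simp
    moreover have "\<bar>cyc_coeff n E (h mod int n)\<bar> \<le> B" unfolding B_def
      using n by (intro member_le_sum) auto
    ultimately show ?thesis by simp
  qed
  have B0: "B \<ge> 0" using bound[of 0] by linarith
  \<comment> \<open>A prime not dividing \<open>K\<close> divides neither \<open>n\<close> nor
    \<open>N\<close>, and it exceeds 2 B because of the factorial.\<close>
  define K where "K = int n * N * fact (nat (2 * B))"
  have big: "cyc_coeff n E (int p * h) = cyc_coeff n E h" if p: "prime p" "\<not> int p dvd K" for p h
  proof -
    have "int p dvd fact (nat (2 * B)) \<Longrightarrow> int p dvd K" "int p dvd int n \<Longrightarrow> int p dvd K" "int p dvd N \<Longrightarrow> int p dvd K"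
      unfolding K_def by (metis dvd_mult dvd_mult2)+
    then have "\<not> int p dvd fact (nat (2 * B))" "\<not> p dvd n" "\<not> int p dvd N"
      using p by auto
    then have "\<not> p dvd fact (nat (2 * B))" by (metis of_nat_dvd_iff of_nat_fact)
    then have "p > nat (2 * B)" using p prime_dvd_fact_iff[of p] by simp
    then have "2 * B < int p" using B0 by linarith
    moreover have "\<bar>cyc_coeff n E (int p * h) - cyc_coeff n E h\<bar> \<le> 2 * B"
      using bound[of h] bound[of "int p * h"] by linarith
    moreover have "int p dvd cyc_coeff n E (int p * h) - cyc_coeff n E h"
      using scaled_idempotent_prime_mult[OF n idem p(1) \<open>\<not> p dvd n\<close> \<open>\<not> int p dvd N\<close>]
      by (simp add: cong_iff_dvd_diff)
    ultimately have "cyc_coeff n E (int p * h) - cyc_coeff n E h = 0"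
      using dvd_imp_le_int[of "cyc_coeff n E (int p * h) - cyc_coeff n E h" "int p"] by linarith
    then show ?thesis by simp
  qed
  have prods: "coprime (int k) K \<Longrightarrow> cyc_coeff n E (int k * h) = cyc_coeff n E h" if "k > 0" for k h
    using that
  proof (induction k arbitrary: h rule: prime_divisors_induct)
    case (factor p k)
    have "p > 0" using factor.hyps prime_gt_0_nat by auto
    have c: "coprime (int p) K" "coprime (int k) K" using factor.prems by (auto)
    have "\<not> int p dvd K"
    proof
      assume "int p dvd K"
      then have "int p dvd 1" using coprime_common_divisor[OF c(1), of "int p"] by simp
      then show False using factor.hyps not_prime_unit[of p] by simp
    qed
    then have "cyc_coeff n E (int p * (int k * h)) = cyc_coeff n E (int k * h)" by (rule big[OF factor.hyps])
    also have "\<dots> = cyc_coeff n E h" using factor.prems c by (intro factor.IH) auto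
    finally show ?case by (simp only: of_nat_mult mult.assoc)
  qed auto
  have K0: "K \<noteq> 0" using n N by (simp add: K_def)
  obtain a where a: "[a = m] (mod int n)" "coprime a K"
    using exists_coprime_in_residue_class[OF m K0] by blast
  \<comment> \<open>A positive representative, to be factored into primes. It has the same residue
    as \<open>a\<close> modulo \<open>K\<close> and therefore modulo \<open>n\<close>, which divides
    \<open>K\<close>.\<close>
  define a' where "a' = a mod \<bar>K\<bar> + \<bar>K\<bar>"
  have "a mod \<bar>K\<bar> \<ge> 0" using K0 by simp
  then have "a' > 0" unfolding a'_def using K0 by linarith
  have "[a' = a] (mod \<bar>K\<bar>)" by (simp add: a'_def cong_def)
  then have "[a' = a] (mod K)" by (simp add: cong_iff_dvd_diff)
  then have "coprime a' K" using a(2) cong_imp_coprime[OF cong_sym, of a' a K] by simp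
  have "[a' = m] (mod int n)"
  proof -
    have "int n dvd K" by (simp add: K_def)
    then have "[a' = a] (mod int n)" by (rule cong_dvd_modulus[OF \<open>[a' = a] (mod K)\<close>])
    then show ?thesis by (rule cong_trans[OF _ a(1)])
  qed
  then have "[m * h = a' * h] (mod int n)" by (rule cong_mult[OF cong_sym cong_refl])
  then have "cyc_coeff n E (m * h) = cyc_coeff n E (a' * h)" by (rule cyc_coeff_cong)
  also have "\<dots> = cyc_coeff n E h"
    using prods[of "nat a'" h] \<open>a' > 0\<close> \<open>coprime a' K\<close> by simp
  finally show ?thesis .
qed

subsection \<open>Primitive permutation groups containing a full cycle\<close>

text \<open>The points are indexed by residues modulo \<open>n\<close>, on which the full cycle acts
  as i + 1. Elements of \<open>G\<close> are extensional, so two elements that agree on the points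
  are equal and sums over \<open>G\<close> can be reindexed by translation. Finiteness and closure
  under composition make \<open>G\<close> a permutation group.\<close>

locale primitive_cyclic_group =
  fixes n :: nat and x :: "int \<Rightarrow> 'a" and G :: "('a \<Rightarrow> 'a) set"
  assumes n2: "n \<ge> 2"
    and x_eq: "x i = x j \<longleftrightarrow> [i = j] (mod int n)"
    and finite_G: "finite G"
    and bij: "g \<in> G \<Longrightarrow> bij_betw g (range x) (range x)"
    and ext: "g \<in> G \<Longrightarrow> g \<in> extensional (range x)"
    and comp: "g \<in> G \<Longrightarrow> h \<in> G \<Longrightarrow> restrict (g \<circ> h) (range x) \<in> G"
    and shift: "\<exists>s\<in>G. \<forall>i. s (x i) = x (i + 1)"
    and primitive: "equiv (range x) R \<Longrightarrow> (\<And>g p q. g \<in> G \<Longrightarrow> (p, q) \<in> R \<Longrightarrow> (g p, g q) \<in> R)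
        \<Longrightarrow> R = Id_on (range x) \<or> R = range x \<times> range x"
begin

lemma n0: "n > 0" using n2 by simp

text \<open>For numerical \<open>u\<close> this says that the matrix with entries u (i - j) is
  constant on the orbits of \<open>G\<close> on pairs, that is, it commutes with the permutation
  matrices of \<open>G\<close>. The images are named by arbitrary indices i' and j' because a point
  determines its index only modulo \<open>n\<close>.\<close>

definition invariant :: "(int \<Rightarrow> 'b) \<Rightarrow> bool" where
  "invariant u \<longleftrightarrow> (\<forall>g\<in>G. \<forall>i j i' j'. g (x i) = x i' \<longrightarrow> g (x j) = x j' \<longrightarrow> u (i - j) = u (i' - j'))"

lemma invariantD: "invariant u \<Longrightarrow> g \<in> G \<Longrightarrow> g (x i) = x i' \<Longrightarrow> g (x j) = x j' \<Longrightarrow> u (i - j) = u (i' - j')"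
  unfolding invariant_def by blast

lemma invariant_comp: "invariant u \<Longrightarrow> invariant (\<lambda>h. v (u h))"
  unfolding invariant_def by (intro ballI allI impI arg_cong[of _ _ v]) blast

lemma invariant_comp2: "invariant u \<Longrightarrow> invariant w \<Longrightarrow> invariant (\<lambda>h. v (u h) (w h))"
  unfolding invariant_def by (intro ballI allI impI arg_cong2[of _ _ _ _ v]) blast+

lemma action_index:
  assumes "g \<in> G"
  shows "\<exists>\<phi>. \<forall>l. g (x l) = x (\<phi> l)"
proof -
  have "\<forall>l. \<exists>l'. g (x l) = x l'" using bij[OF assms] by (auto simp: bij_betw_def)
  then show ?thesis by metis
qed

lemma action_inj:
  assumes "g \<in> G" "g (x l) = x k" "g (x l') = x k'"
  shows "[k = k'] (mod int n) \<longleftrightarrow> [l = l'] (mod int n)"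
proof -
  have "x k = x k' \<longleftrightarrow> x l = x l'"
    using bij[OF assms(1)] assms(2,3) unfolding bij_betw_def inj_on_def by (metis rangeI)
  then show ?thesis by (simp only: x_eq)
qed

lemma invariant_dvd: "invariant (\<lambda>h. int n dvd h)"
  unfolding invariant_def
proof (intro ballI allI impI)
  fix g i j i' j' assume "g \<in> G" "g (x i) = x i'" "g (x j) = x j'"
  then show "int n dvd i - j \<longleftrightarrow> int n dvd i' - j'"
    using action_inj by (simp only: cong_iff_dvd_diff[symmetric])
qed

text \<open>Matrices that commute with a group are closed under products. In coordinates, the
  summation index of the product is renamed by the action of the group element.\<close>

lemma invariant_cyc_coeff_mult:
  assumes "invariant (cyc_coeff n f)" "invariant (cyc_coeff n g)"
  shows "invariant (cyc_coeff n (f * g))"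
  unfolding invariant_def
proof (intro ballI allI impI)
  fix s i j i' j' assume s: "s \<in> G" "s (x i) = x i'" "s (x j) = x j'"
  obtain \<phi> where "\<forall>l. s (x l) = x (\<phi> l)" using action_index[OF s(1)] by blast
  then have \<phi>: "s (x l) = x (\<phi> l)" for l by blast
  have conv: "cyc_coeff n (f * g) (i - j) = (\<Sum>l\<in>{0..<int n}. cyc_coeff n f (i - l) * cyc_coeff n g (l - j))" for i j
  proof -
    have "(\<Sum>l\<in>{0..<int n}. cyc_coeff n f (i - (l + j)) * cyc_coeff n g ((l + j) - j)) =
        (\<Sum>l\<in>{0..<int n}. cyc_coeff n f (i - l) * cyc_coeff n g (l - j))"
      by (rule sum_periodic_reindex[OF n0, of "\<lambda>l. cyc_coeff n f (i - l) * cyc_coeff n g (l - j)"])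
         (auto intro!: arg_cong2[of _ _ _ _ "(*)"] cyc_coeff_cong cong_diff simp: cong_add_rcancel)
    then show ?thesis by (simp add: cyc_coeff_mult[OF n0] algebra_simps)
  qed
  have "cyc_coeff n (f * g) (i - j) = (\<Sum>l\<in>{0..<int n}. cyc_coeff n f (i - l) * cyc_coeff n g (l - j))"
    by (rule conv)
  also have "\<dots> = (\<Sum>l\<in>{0..<int n}. cyc_coeff n f (i' - \<phi> l) * cyc_coeff n g (\<phi> l - j'))"
    using invariantD[OF assms(1) s(1,2) \<phi>] invariantD[OF assms(2) s(1) \<phi> s(3)] by simp
  also have "\<dots> = (\<Sum>l\<in>{0..<int n}. cyc_coeff n f (i' - l) * cyc_coeff n g (l - j'))"
    by (rule sum_periodic_reindex[OF n0, of "\<lambda>l. cyc_coeff n f (i' - l) * cyc_coeff n g (l - j')"])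
       (use action_inj[OF s(1) \<phi> \<phi>] in \<open>auto intro!: arg_cong2[of _ _ _ _ "(*)"] cyc_coeff_cong cong_diff\<close>)
  also have "\<dots> = cyc_coeff n (f * g) (i' - j')" by (rule conv[symmetric])
  finally show "cyc_coeff n (f * g) (i - j) = cyc_coeff n (f * g) (i' - j')" .
qed

lemma invariant_cyc_coeff_power:
  assumes "invariant (cyc_coeff n f)"
  shows "invariant (cyc_coeff n (f ^ k))"
proof (induction k)
  case 0
  show ?case using invariant_comp[OF invariant_dvd, of "\<lambda>b. if b then 1 else 0"] by (simp add: cyc_coeff_1[abs_def])
next
  case (Suc k)
  then show ?case using invariant_cyc_coeff_mult[OF assms] by simp
qed

lemma invariant_sum:
  fixes u :: "'c \<Rightarrow> int \<Rightarrow> 'b :: comm_monoid_add"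
  shows "(\<And>r. r \<in> I \<Longrightarrow> invariant (u r)) \<Longrightarrow> invariant (\<lambda>h. \<Sum>r\<in>I. u r h)"
  unfolding invariant_def by (intro ballI allI impI sum.cong) blast+

text \<open>The orbital graph of an invariant set of differences that all lie in a proper subgroup is
  disconnected, so primitivity leaves only the trivial difference.\<close>

lemma invariant_subset_subgroup:
  assumes inv: "invariant (\<lambda>h. h \<in> U)" and d: "\<And>h. h \<in> U \<Longrightarrow> d dvd h" and "d dvd int n" "\<not> d dvd 1"
    and "h \<in> U"
  shows "int n dvd h"
proof -
  define R0 where "R0 = {(x i, x j) | i j. i - j \<in> U \<or> j - i \<in> U}"
  \<comment> \<open>The reflexive closure lives on the whole type, hence the restriction to the
    points.\<close>
  define R where "R = R0\<^sup>* \<inter> (range x \<times> range x)"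
  \<comment> \<open>Along a chain of edges the index difference stays divisible by \<open>d\<close>;
    passing to a congruent index is harmless because \<open>d\<close> divides
    \<open>n\<close>.\<close>
  have sub: "(p, q) \<in> R0\<^sup>* \<Longrightarrow> p = x i \<Longrightarrow> \<exists>j. q = x j \<and> d dvd i - j" for p q i
  proof (induction rule: rtrancl_induct)
    case base
    then show ?case by (intro exI[of _ i]) simp
  next
    case (step q r)
    then obtain j where j: "q = x j" "d dvd i - j" by auto
    obtain k l where kl: "q = x k" "r = x l" "k - l \<in> U \<or> l - k \<in> U"
      using step.hyps(2) unfolding R0_def by blast
    have "d dvd k - l" using kl(3) d by (metis dvd_minus_iff minus_diff_eq)
    moreover have "int n dvd j - k" using j kl x_eq by (metis cong_iff_dvd_diff)
    then have "d dvd j - k" using \<open>d dvd int n\<close> by (rule dvd_trans[rotated])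
    ultimately have "d dvd (i - j) + (j - k) + (k - l)" using j(2) by (intro dvd_add)
    then show ?case using kl(2) by (intro exI[of _ l]) simp
  qed
  have symR0: "sym R0" unfolding R0_def sym_def by blast
  have "equiv (range x) R"
    unfolding equiv_def R_def
    using sym_rtrancl[OF symR0]
    by (auto simp: refl_on_def sym_def trans_def intro: rtrancl_trans)
  moreover have "(g p, g q) \<in> R" if g: "g \<in> G" and pq: "(p, q) \<in> R" for g p q
  proof -
    have R0g: "(g p, g q) \<in> R0" if pq0: "(p, q) \<in> R0" for p q
    proof -
      obtain i j where ij: "p = x i" "q = x j" "i - j \<in> U \<or> j - i \<in> U" using pq0 unfolding R0_def by blast
      obtain \<phi> where "\<forall>l. g (x l) = x (\<phi> l)" using action_index[OF g] by blast
      then have \<phi>: "g (x l) = x (\<phi> l)" for l by blast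
      have "\<phi> i - \<phi> j \<in> U \<or> \<phi> j - \<phi> i \<in> U"
        using ij(3) invariantD[OF inv g \<phi> \<phi>] by metis
      then show ?thesis unfolding R0_def ij \<phi> by blast
    qed
    have "(p, q) \<in> R0\<^sup>*" using pq by (simp add: R_def)
    then have "(g p, g q) \<in> R0\<^sup>*"
      by (induction rule: rtrancl_induct) (auto intro: rtrancl_into_rtrancl R0g)
    moreover have "g p \<in> range x" "g q \<in> range x" using pq bij[OF g] by (auto simp: R_def bij_betw_def)
    ultimately show ?thesis by (simp add: R_def)
  qed
  ultimately have "R = Id_on (range x) \<or> R = range x \<times> range x" by (rule primitive)
  moreover have "(x 1, x 0) \<notin> R"
  proof
    assume "(x 1, x 0) \<in> R"
    then obtain j where "x 0 = x j" "d dvd 1 - j" using sub[of "x 1" "x 0" 1] by (auto simp: R_def)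
    then have "int n dvd 0 - j" using x_eq by (metis cong_iff_dvd_diff)
    then have "d dvd 0 - j" using \<open>d dvd int n\<close> by (rule dvd_trans[rotated])
    with \<open>d dvd 1 - j\<close> have "d dvd (1 - j) - (0 - j)" by (rule dvd_diff)
    then show False using \<open>\<not> d dvd 1\<close> by simp
  qed
  ultimately have Id: "R = Id_on (range x)" by auto
  have "(x h, x 0) \<in> R0" unfolding R0_def using \<open>h \<in> U\<close> by force
  then have "(x h, x 0) \<in> R" by (auto simp: R_def)
  then have "x h = x 0" unfolding Id by auto
  then show ?thesis by (simp add: x_eq cong_0_iff)
qed

end

lemma cyc_coeff_sum_monom:
  assumes "n > 0" and per: "\<And>h h'. [h = h'] (mod int n) \<Longrightarrow> w h = w h'"
  shows "cyc_coeff n (\<Sum>l\<in>{0..<int n}. monom (w l) (nat l)) h = w h"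
proof -
  have "cyc_coeff n (\<Sum>l\<in>{0..<int n}. monom (w l) (nat l)) h
      = (\<Sum>l\<in>{0..<int n}. if l = h mod int n then w l else 0)"
    unfolding cyc_coeff_sum cyc_coeff_monom
    by (intro sum.cong refl) (auto simp: cong_def)
  also have "\<dots> = w (h mod int n)" using assms(1) by simp
  also have "\<dots> = w h" by (rule per) simp
  finally show ?thesis .
qed

context primitive_cyclic_group
begin

lemma invariant_periodic:
  assumes "invariant u" "[h = h'] (mod int n)"
  shows "u h = u h'"
proof -
  obtain s where s: "s \<in> G" "\<And>i. s (x i) = x (i + 1)" using shift by blast
  have "x (h + 1) = x (h' + 1)" using assms(2) by (simp add: x_eq cong_add_rcancel)
  then have "s (x h) = x (h' + 1)" "s (x 0) = x 1" using s(2)[of h] s(2)[of 0] by simp_all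
  then have "u (h - 0) = u (h' + 1 - 1)" by (rule invariantD[OF assms(1) s(1)])
  then show ?thesis by simp
qed

text \<open>Counted modulo p, the representations of h as a sum of p elements of T reduce, by rotating the
  summands, to those with equal summands. The set of h for which this count is not 0 is invariant and
  consists of multiples of p.\<close>

lemma level_set_translation:
  assumes p: "prime p" "n = p * q" and inv: "invariant (\<lambda>h. h \<in> T)"
    and t: "t \<in> T" "\<not> int q dvd t"
  shows "t + int q * l \<in> T"
proof -
  have p0: "p > 0" and q0: "q > 0" using p n0 by (auto intro: prime_gt_0_nat)
  have Tper: "h \<in> T \<longleftrightarrow> h' \<in> T" if "[h = h'] (mod int n)" for h h'
    using invariant_periodic[OF inv that] .
  have lift: "[t + int q * a = t + int q * b] (mod int n)" if "[a = b] (mod int p)" for a b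
  proof -
    have "int q * int p dvd int q * (a - b)"
      using that unfolding cong_iff_dvd_diff by (rule mult_dvd_mono[OF dvd_refl])
    then show ?thesis unfolding p(2) cong_iff_dvd_diff by (simp add: algebra_simps)
  qed
  \<comment> \<open>With \<open>f\<close> the indicator of \<open>T\<close> in the group ring, the
    coefficients of f^p count the representations as sums of p elements of \<open>T\<close>.\<close>
  define w :: "int \<Rightarrow> int" where "w h = of_bool (h \<in> T)" for h
  define f where "f = (\<Sum>l\<in>{0..<int n}. monom (w l) (nat l))"
  have cf: "cyc_coeff n f = w"
  proof
    show "cyc_coeff n f h = w h" for h unfolding f_def
      by (rule cyc_coeff_sum_monom[OF n0]) (use Tper in \<open>simp add: w_def\<close>)
  qed
  \<comment> \<open>These index the representations of \<open>h\<close> with p equal summands, the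
    only ones that matter modulo p.\<close>
  define S where "S h = {s\<in>{0..<int n}. s \<in> T \<and> [h = int p * s] (mod int n)}" for h
  have finS: "finite (S h)" for h by (rule finite_subset[of _ "{0..<int n}"]) (auto simp: S_def)
  have comp_monom: "monom a k \<circ>\<^sub>p monom 1 p = monom a (p * k)" for a :: int and k
    by (induction k) (auto simp: monom_0 monom_Suc pcompose_pCons mult_monom algebra_simps)
  have cS: "cyc_coeff n (f \<circ>\<^sub>p monom 1 p) h = int (card (S h))" for h
  proof -
    have "cyc_coeff n (f \<circ>\<^sub>p monom 1 p) h
        = (\<Sum>l\<in>{0..<int n}. if [h = int p * l] (mod int n) then w l else 0)"
      unfolding f_def pcompose_sum comp_monom cyc_coeff_sum cyc_coeff_monom
      by (intro sum.cong refl) simp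
    also have "\<dots> = (\<Sum>l\<in>{0..<int n}. if l \<in> S h then 1 else 0)"
      by (intro sum.cong refl) (auto simp: w_def S_def)
    also have "\<dots> = int (card (S h))"
      by (subst sum.inter_restrict[symmetric]) (auto simp: S_def intro!: arg_cong[of _ _ card])
    finally show ?thesis .
  qed
  have invf: "invariant (cyc_coeff n f)" unfolding cf w_def[abs_def] by (rule invariant_comp[OF inv])
  define U where "U = {h. \<not> int p dvd cyc_coeff n (f ^ p) h}"
  have U: "h \<in> U \<longleftrightarrow> \<not> int p dvd int (card (S h))" for h
    using cyc_coeff_power_cong[OF p(1), of n f h] unfolding U_def cS
    by (simp add: cong_dvd_iff)
  have invU: "invariant (\<lambda>h. h \<in> U)" unfolding U_def
    using invariant_comp[OF invariant_cyc_coeff_power[OF invf], of "\<lambda>c. \<not> int p dvd c" p] by simp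
  have pU: "int p dvd h" if "h \<in> U" for h
  proof -
    have "S h \<noteq> {}" using that U by auto
    then obtain s where "[h = int p * s] (mod int n)" by (auto simp: S_def)
    then have "int n dvd h - int p * s" by (simp add: cong_iff_dvd_diff)
    then have "int p dvd h - int p * s" using p(2) by (metis dvd_mult_left of_nat_mult)
    then show ?thesis by (metis diff_add_cancel dvd_add dvd_triv_left)
  qed
  have pn: "int p dvd int n" "\<not> int p dvd 1" using p prime_gt_1_nat[of p] by auto
  have Un: "int n dvd h" if "h \<in> U" for h
    using invariant_subset_subgroup[OF invU _ pn that] pU by blast
  \<comment> \<open>Elements of \<open>U\<close> are 0 modulo \<open>n\<close>, but p t is not,
    since q does not divide \<open>t\<close>. So the number of solutions is divisible by p, and it
    is positive because \<open>t\<close> itself is one.\<close>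
  have "\<not> int n dvd int p * t" using t(2) p(2) p0 by simp
  then have "int p * t \<notin> U" using Un by blast
  then have "p dvd card (S (int p * t))" using U by simp
  moreover have "t mod int n \<in> S (int p * t)"
    using t(1) n0 Tper[of "t mod int n" t] by (auto simp: S_def cong_def mod_mult_right_eq)
  then have "card (S (int p * t)) > 0" using finS card_gt_0_iff by blast
  ultimately have ge: "p \<le> card (S (int p * t))" by (rule dvd_imp_le)
  \<comment> \<open>All solutions s of p s = p t modulo \<open>n\<close>, whether in
    \<open>T\<close> or not. There are at most p of them, and at least p lie in \<open>T\<close>, so
    all of them do.\<close>
  define I where "I = (\<lambda>i. (t + int q * i) mod int n) ` {0..<int p}"
  have SI: "S (int p * t) \<subseteq> I"
  proof
    fix s assume s: "s \<in> S (int p * t)"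
    then have "int n dvd int p * t - int p * s" by (simp add: S_def cong_iff_dvd_diff)
    then have "int p * int q dvd int p * (t - s)" using p(2) by (simp add: algebra_simps)
    then have "int q dvd t - s" using p0 by simp
    then obtain c where "t - s = int q * c" by (auto elim: dvdE)
    then have sc: "s = t + int q * (- c)" by (simp add: algebra_simps)
    have "[s = t + int q * ((- c) mod int p)] (mod int n)"
      unfolding sc by (rule lift) simp
    moreover have "s = s mod int n" using s by (simp add: S_def)
    ultimately have "s = (t + int q * ((- c) mod int p)) mod int n" by (simp add: cong_def)
    then show "s \<in> I" unfolding I_def using p0 by auto
  qed
  have "card I \<le> p" unfolding I_def using card_image_le[of "{0..<int p}"] by simp
  then have SIeq: "S (int p * t) = I"
    using ge SI by (intro card_seteq) (auto simp: I_def)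
  have "(t + int q * (l mod int p)) mod int n \<in> I" unfolding I_def using p0 by auto
  then have "(t + int q * (l mod int p)) mod int n \<in> T" using SIeq by (auto simp: S_def)
  moreover have "[(t + int q * (l mod int p)) mod int n = t + int q * l] (mod int n)"
    using lift[of "l mod int p" l] by simp
  ultimately show ?thesis using Tper by blast
qed

text \<open>If \<open>T\<close> avoided the multiples of q, it would be a union of cosets of the
  subgroup generated by q, by \<open>level_set_translation\<close>. Then x q and x 0 would have the
  same neighbours in the orbital graph of \<open>T\<close>. Having equal neighbourhoods is an
  invariant equivalence, so by primitivity all points would share their neighbours, and some point
  would be its own neighbour, which puts 0 into \<open>T\<close>.\<close>

lemma level_set_meets_subgroup:
  assumes p: "prime p" "n = p * q" and inv: "invariant (\<lambda>h. h \<in> T)"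
    and T0: "0 \<notin> T" and t: "t \<in> T"
  shows "\<exists>t\<in>T. int q dvd t"
proof (rule ccontr)
  assume "\<not> ?thesis"
  then have tr: "s + int q * l \<in> T" if "s \<in> T" for s l
    using level_set_translation[OF p inv that] that by blast
  have Tper: "h \<in> T \<longleftrightarrow> h' \<in> T" if "[h = h'] (mod int n)" for h h'
    using invariant_periodic[OF inv that] .
  define nb where "nb a = {x l | l i. a = x i \<and> l - i \<in> T}" for a
  have nb: "x l \<in> nb (x i) \<longleftrightarrow> l - i \<in> T" for l i
  proof
    assume "x l \<in> nb (x i)"
    then obtain l' i' where "x l = x l'" "x i = x i'" "l' - i' \<in> T" by (auto simp: nb_def)
    moreover from this have "[l - i = l' - i'] (mod int n)" by (intro cong_diff) (simp_all add: x_eq)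
    ultimately show "l - i \<in> T" using Tper by blast
  qed (auto simp: nb_def)
  have nbF: "nb a \<subseteq> range x" for a by (auto simp: nb_def)
  define R where "R = {(a, b). a \<in> range x \<and> b \<in> range x \<and> nb a = nb b}"
  have "equiv (range x) R"
    by (auto simp: R_def equiv_def refl_on_def sym_def trans_def)
  moreover have "(g a, g b) \<in> R" if g: "g \<in> G" and ab: "(a, b) \<in> R" for g a b
  proof -
    obtain \<phi> where "\<forall>l. g (x l) = x (\<phi> l)" using action_index[OF g] by blast
    then have \<phi>: "g (x l) = x (\<phi> l)" for l by blast
    have surj: "\<exists>l. x k = x (\<phi> l)" for k
    proof -
      have "x k \<in> g ` range x" using bij[OF g] by (auto simp: bij_betw_def)
      then show ?thesis using \<phi> by auto
    qed
    obtain i j where ij: "a = x i" "b = x j" "nb (x i) = nb (x j)" using ab by (auto simp: R_def)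
    have "c \<in> nb (g a) \<longleftrightarrow> c \<in> nb (g b)" if c: "c \<in> range x" for c
    proof -
      obtain l where l: "c = x (\<phi> l)" using surj c by blast
      have "c \<in> nb (g (x i)) \<longleftrightarrow> x l \<in> nb (x i)" for i
        using invariantD[OF inv g \<phi> \<phi>, of l i] unfolding \<phi> l nb by simp
      then show ?thesis unfolding ij(1,2) using ij(3) by simp
    qed
    then have "nb (g a) = nb (g b)" using nbF by blast
    then show ?thesis using ij \<phi> by (simp add: R_def)
  qed
  ultimately have "R = Id_on (range x) \<or> R = range x \<times> range x" by (rule primitive)
  moreover have "(x (int q), x 0) \<in> R"
  proof -
    have "x l \<in> nb (x (int q)) \<longleftrightarrow> x l \<in> nb (x 0)" for l
      unfolding nb using tr[of "l - int q" 1] tr[of "l" "-1"] by auto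
    then have "nb (x (int q)) = nb (x 0)" using nbF by blast
    then show ?thesis by (simp add: R_def)
  qed
  moreover have "x (int q) \<noteq> x 0"
  proof
    assume "x (int q) = x 0"
    then have "n dvd q" by (simp add: x_eq cong_0_iff)
    then have "n \<le> q" using p n0 by (intro dvd_imp_le) auto
    then show False using p n0 prime_gt_1_nat[of p] by simp
  qed
  ultimately have "R = range x \<times> range x" by auto
  then have "(x t, x 0) \<in> R" by simp
  then have "nb (x t) = nb (x 0)" by (simp add: R_def)
  moreover have "x t \<in> nb (x 0)" unfolding nb using t by simp
  ultimately have "x t \<in> nb (x t)" by simp
  then show False using T0 unfolding nb by simp
qed

text \<open>For a prime p dividing \<open>n\<close> and q = n / p, every level set of
  \<open>u\<close> away from 0 contains a multiple of q. The multiples of q form a group of order p,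
  and the units modulo \<open>n\<close> act transitively on its nonzero elements, so all these level
  sets contain q itself.\<close>

lemma unit_invariant_constant:
  fixes u :: "int \<Rightarrow> 'b"
  assumes inv: "invariant u" and unit: "\<And>m h. coprime m (int n) \<Longrightarrow> u (m * h) = u h"
  shows "\<exists>\<beta>. \<forall>h. \<not> int n dvd h \<longrightarrow> u h = \<beta>"
proof -
  obtain p where p: "prime p" "p dvd n" using prime_factor_nat[of n] n2 by auto
  then obtain q where q: "n = p * q" by (auto elim: dvdE)
  have "u h = u (int q)" if h: "\<not> int n dvd h" for h
  proof -
    define T where "T = {k. \<not> int n dvd k \<and> u k = u h}"
    have invT: "invariant (\<lambda>k. k \<in> T)"
      using invariant_comp2[OF invariant_dvd inv, of "\<lambda>d c. \<not> d \<and> c = u h"] by (simp add: T_def)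
    obtain t where t: "t \<in> T" "int q dvd t"
      using level_set_meets_subgroup[OF p(1) q invT, of h] h by (auto simp: T_def)
    then obtain t' where t': "t = int q * t'" by (auto elim: dvdE)
    have "\<not> int p dvd t'" using t(1) t' q by (auto simp: T_def mult.commute)
    then have "coprime t' (int p)" using p(1)
      by (metis coprime_commute prime_imp_coprime prime_nat_int_transfer)
    then obtain m0 where m0: "[t' * m0 = 1] (mod int p)" using cong_solve_coprime_int by blast
    then have "[m0 * t' = 1] (mod int p)" by (simp only: mult.commute)
    then have "coprime m0 (int p)" using coprime_iff_invertible_int by blast
    \<comment> \<open>The inverse of t' modulo p is lifted to a unit modulo
      \<open>n\<close>.\<close>
    then obtain m where m: "[m = m0] (mod int p)" "coprime m (int n)"
      using exists_coprime_in_residue_class[of m0 "int p" "int n"] n0 by auto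
    have "[t' * m = t' * m0] (mod int p)" using m(1) by (intro cong_mult) auto
    then have "[t' * m = 1] (mod int p)" using m0 cong_trans by blast
    then have "int p dvd t' * m - 1" by (simp add: cong_iff_dvd_diff)
    then have "int q * int p dvd int q * (t' * m - 1)" by (rule mult_dvd_mono[OF dvd_refl])
    then have "[m * t = int q] (mod int n)"
      unfolding t' q by (simp add: cong_iff_dvd_diff algebra_simps)
    then have "u (m * t) = u (int q)" by (rule invariant_periodic[OF inv])
    moreover have "u (m * t) = u t" using m(2) by (rule unit)
    ultimately show ?thesis using t(1) by (simp add: T_def)
  qed
  then show ?thesis by blast
qed


text \<open>A Gram matrix built from the group translates of \<open>k\<close> is an invariant
  integral circulant with all its columns in \<open>W\<close>. The scaled idempotent derived from it
  is invariant under units, hence constant off the diagonal, and differences of its columns are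
  nonzero multiples of differences of unit vectors.\<close>

theorem invariant_subspace_contains_differences:
  fixes W :: "('a \<Rightarrow> complex) set" and k :: "'a \<Rightarrow> int"
  assumes W0: "(\<lambda>_. 0) \<in> W"
    and Wadd: "\<And>v w. v \<in> W \<Longrightarrow> w \<in> W \<Longrightarrow> (\<lambda>y. v y + w y) \<in> W"
    and Wscale: "\<And>c w. w \<in> W \<Longrightarrow> (\<lambda>y. c * w y) \<in> W"
    and Wext: "\<And>v w. w \<in> W \<Longrightarrow> (\<And>y. y \<in> range x \<Longrightarrow> v y = w y) \<Longrightarrow> v \<in> W"
    and Winv: "\<And>g w. g \<in> G \<Longrightarrow> w \<in> W \<Longrightarrow> (\<lambda>y. w (g y)) \<in> W"
    and kW: "(\<lambda>y. of_int (k y)) \<in> W"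
    and nonconst: "k (x i0) \<noteq> k (x j0)"
  shows "(\<lambda>y. of_bool (y = x i) - of_bool (y = x j)) \<in> W"
proof -
  have Wsum: "(\<lambda>y. \<Sum>r\<in>I. w r y) \<in> W" if "\<And>r. r \<in> I \<Longrightarrow> w r \<in> W" for I :: "'d set" and w
    using that by (induction I rule: infinite_finite_induct) (auto intro: W0 Wadd)
  \<comment> \<open>The Gram matrix of the vectors with entries k (\<pi> a), where \<pi> runs
    through \<open>G\<close>: integral, symmetric and invariant.\<close>
  define K where "K a b = (\<Sum>\<pi>\<in>G. k (\<pi> a) * k (\<pi> b))" for a b
  have Kinv: "K (g a) (g b) = K a b" if g: "g \<in> G" and ab: "a \<in> range x" "b \<in> range x" for g a b
  proof -
    let ?c = "\<lambda>\<pi>. restrict (\<pi> \<circ> g) (range x)"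
    have gF: "g ` range x = range x" using bij[OF g] by (simp add: bij_betw_def)
    have "inj_on ?c G"
    proof (rule inj_onI)
      fix \<pi> \<pi>' assume \<pi>: "\<pi> \<in> G" "\<pi>' \<in> G" "?c \<pi> = ?c \<pi>'"
      show "\<pi> = \<pi>'"
      proof (rule extensionalityI[OF ext[OF \<pi>(1)] ext[OF \<pi>(2)]])
        fix y assume "y \<in> range x"
        then obtain z where z: "z \<in> range x" "y = g z" using gF by blast
        then show "\<pi> y = \<pi>' y" using fun_cong[OF \<pi>(3), of z] by simp
      qed
    qed
    moreover have "?c ` G \<subseteq> G" using comp g by blast
    ultimately have bb: "bij_betw ?c G G" using finite_G by (simp add: bij_betw_def endo_inj_surj)
    have "K (g a) (g b) = (\<Sum>\<pi>\<in>G. k (?c \<pi> a) * k (?c \<pi> b))" using ab by (simp add: K_def)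
    also have "\<dots> = K a b" unfolding K_def by (rule sum.reindex_bij_betw[OF bb])
    finally show ?thesis .
  qed
  define m where "m h = K (x h) (x 0)" for h
  obtain s where s: "s \<in> G" "\<And>i. s (x i) = x (i + 1)" using shift by blast
  have Ks: "K (x (i + int l)) (x (j + int l)) = K (x i) (x j)" for i j l
  proof (induction l)
    case (Suc l)
    have "K (s (x (i + int l))) (s (x (j + int l))) = K (x i) (x j)"
      using Kinv[OF s(1)] Suc by simp
    then show ?case unfolding s(2) by (simp add: algebra_simps)
  qed simp
  have Km: "K (x i) (x j) = m (i - j)" for i j
  proof -
    \<comment> \<open>Only translations by nonnegative amounts come from iterating the shift, so
      \<open>j\<close> is moved to 0 by the nonnegative residue of - j.\<close>
    define l where "l = nat ((- j) mod int n)"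
    have l: "int l = (- j) mod int n" using n0 by (simp add: l_def)
    have "[j + int l = j + (- j)] (mod int n)" unfolding l by (intro cong_add cong_refl) simp
    then have j0: "x (j + int l) = x 0" by (simp add: x_eq)
    have "[i + int l = i + (- j)] (mod int n)" unfolding l by (intro cong_add cong_refl) simp
    then have i0: "x (i + int l) = x (i - j)" by (simp add: x_eq)
    show ?thesis using Ks[of i l j] unfolding i0 j0 by (simp add: m_def)
  qed
  have minv: "invariant m" unfolding invariant_def
    using Kinv by (metis Km rangeI)
  define f where "f = (\<Sum>l\<in>{0..<int n}. monom (m l) (nat l))"
  have cf: "cyc_coeff n f h = m h" for h unfolding f_def
    by (rule cyc_coeff_sum_monom[OF n0 invariant_periodic[OF minv]])
  then have cff: "cyc_coeff n f = m" by blast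
  have symf: "cyc_sym n f" unfolding cyc_sym_def
  proof
    fix h
    have "K (x 0) (x h) = K (x h) (x 0)" by (simp add: K_def mult.commute)
    then show "cyc_coeff n f (- h) = cyc_coeff n f h" unfolding Km cf by simp
  qed
  obtain N c where N: "N \<noteq> 0"
    and NE: "cyc_coeff n (f * (f * (\<Sum>r\<le>n. smult (c r) (f ^ r)))) = cyc_coeff n (smult N f)"
    using exists_scaled_idempotent[OF n0 symf] .
  define E' where "E' = (\<Sum>r\<le>n. smult (c r) (f ^ r))"
  define E where "E = f * E'"
  have fE: "cyc_coeff n (f * E) = cyc_coeff n (smult N f)" using NE by (simp add: E_def E'_def)
  have "E * E = (f * E) * E'" unfolding E_def by (simp only: mult_ac)
  then have "cyc_coeff n (E * E) = cyc_coeff n (smult N f * E')" 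
    by (simp only: cyc_coeff_mult_cong[OF n0 fE])
  also have "smult N f * E' = smult N E" by (simp add: E_def)
  finally have idem: "cyc_coeff n (E * E) = cyc_coeff n (smult N E)" .
  have invf: "invariant (cyc_coeff n f)" unfolding cff by (rule minv)
  have "invariant (\<lambda>h. \<Sum>r\<le>n. c r * cyc_coeff n (f ^ r) h)"
    by (intro invariant_sum invariant_comp[OF invariant_cyc_coeff_power[OF invf]])
  then have "invariant (cyc_coeff n E')" by (simp add: E'_def cyc_coeff_sum[abs_def])
  then have invE: "invariant (cyc_coeff n E)" unfolding E_def by (rule invariant_cyc_coeff_mult[OF invf])
  obtain \<beta> where \<beta>: "\<And>h. \<not> int n dvd h \<Longrightarrow> cyc_coeff n E h = \<beta>"
    using unit_invariant_constant[OF invE scaled_idempotent_unit_mult[OF n0 N idem]] by blast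
  define \<alpha> where "\<alpha> = cyc_coeff n E 0"
  have cE: "cyc_coeff n E h = \<beta> + (\<alpha> - \<beta>) * of_bool (int n dvd h)" for h
  proof (cases "int n dvd h")
    case True
    then have "cyc_coeff n E h = cyc_coeff n E 0" by (intro cyc_coeff_cong) (simp add: cong_0_iff)
    then show ?thesis using True by (simp add: \<alpha>_def)
  qed (simp add: \<beta>)
  \<comment> \<open>Here E = \<beta> J + (\<alpha> - \<beta>) I with J the all-ones matrix, while E
    f = N f. If N differed from \<alpha> - \<beta>, every entry of f would be the same number. The
    squared distance of any two of the vectors behind the Gram matrix would then be 0, against the
    choice of i0 and j0.\<close>
  have N\<alpha>: "N = \<alpha> - \<beta>"
  proof (rule ccontr)
    assume ne: "N \<noteq> \<alpha> - \<beta>"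
    define S where "S = (\<Sum>l\<in>{0..<int n}. m l)"
    have "(N - (\<alpha> - \<beta>)) * m h = \<beta> * S" for h
    proof -
      have "N * m h = cyc_coeff n (E * f) h" using fE cf by (simp add: fun_eq_iff mult.commute)
      also have "\<dots> = (\<Sum>l\<in>{0..<int n}. (\<beta> + (\<alpha> - \<beta>) * of_bool (int n dvd h - l)) * m l)"
        unfolding cyc_coeff_mult[OF n0] cE cf by simp
      also have "\<dots> = \<beta> * S + (\<alpha> - \<beta>) * (\<Sum>l\<in>{0..<int n}. of_bool (int n dvd h - l) * m l)"
        by (simp only: S_def sum_distrib_left sum.distrib distrib_right mult.assoc)
      also have "(\<Sum>l\<in>{0..<int n}. of_bool (int n dvd h - l) * m l) = cyc_coeff n (1 * f) h"
        unfolding cyc_coeff_mult[OF n0] cyc_coeff_1 cf by (intro sum.cong) auto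
      also have "\<dots> = m h" by (simp add: cf)
      finally show ?thesis by (simp add: algebra_simps)
    qed
    then have mc: "m h = m 0" for h using ne by (metis mult_cancel_left right_minus_eq)
    have "(\<Sum>\<pi>\<in>G. (k (\<pi> (x i0)) - k (\<pi> (x j0)))\<^sup>2) = K (x i0) (x i0) + K (x j0) (x j0) - 2 * K (x i0) (x j0)"
      unfolding K_def by (simp add: power2_diff sum.distrib sum_subtractf sum_distrib_left power2_eq_square algebra_simps)
    also have "\<dots> = 0" unfolding Km using mc by (metis add_diff_cancel_left' cancel_comm_monoid_add_class.diff_cancel mult_2)
    finally have "(\<Sum>\<pi>\<in>G. (k (\<pi> (x i0)) - k (\<pi> (x j0)))\<^sup>2) = 0" .
    then have all0: "k (\<pi> (x i0)) = k (\<pi> (x j0))" if "\<pi> \<in> G" for \<pi>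
      using that finite_G by (simp add: sum_nonneg_eq_0_iff)
    \<comment> \<open>Positive powers of the shift lie in \<open>G\<close> by closure; the n-th one
      fixes every point.\<close>
    have "k (x (i0 + int l)) = k (x (j0 + int l))" if "l > 0" for l
    proof -
      have "\<exists>\<pi>\<in>G. \<forall>i. \<pi> (x i) = x (i + int l)" using that
      proof (induction l)
        case (Suc l)
        show ?case
        proof (cases "l = 0")
          case True then show ?thesis using s by auto
        next
          case False
          then obtain \<pi> where \<pi>: "\<pi> \<in> G" "\<And>i. \<pi> (x i) = x (i + int l)" using Suc by auto
          have "restrict (s \<circ> \<pi>) (range x) (x i) = x (i + int (Suc l))" for i
            using \<pi>(2) s(2) by (simp add: algebra_simps)
          then show ?thesis using comp[OF s(1) \<pi>(1)] by blast
        qed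
      qed simp
      then obtain \<pi> where "\<pi> \<in> G" "\<And>i. \<pi> (x i) = x (i + int l)" by blast
      then show ?thesis using all0[of \<pi>] by simp
    qed
    moreover have "x (i0 + int n) = x i0" "x (j0 + int n) = x j0" by (simp_all add: x_eq cong_def)
    ultimately show False using nonconst n0 by metis
  qed
  have row_f: "(\<lambda>y. of_int (K y (x j))) \<in> W" for j
  proof -
    have "(\<lambda>y. \<Sum>\<pi>\<in>G. of_int (k (\<pi> (x j))) * of_int (k (\<pi> y))) \<in> W"
      by (intro Wsum Wscale) (rule Winv[OF _ kW])
    then show ?thesis by (simp add: K_def mult.commute)
  qed
  have row_E: "\<exists>w\<in>W. \<forall>i. w (x i) = of_int (cyc_coeff n E (i - j))" for j
  proof
    \<comment> \<open>Since E = f E', a column of E is a combination of columns of f.\<close>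
    let ?w = "\<lambda>y. \<Sum>l\<in>{0..<int n}. of_int (cyc_coeff n E' l) * of_int (K y (x (j + l))) :: complex"
    show "?w \<in> W" by (intro Wsum Wscale row_f)
    show "\<forall>i. ?w (x i) = of_int (cyc_coeff n E (i - j))"
      unfolding E_def cyc_coeff_mult[OF n0] Km cf by (simp add: algebra_simps)
  qed
  obtain v where v: "v \<in> W" "\<And>l. v (x l) = of_int (cyc_coeff n E (l - i))" using row_E by blast
  obtain w where w: "w \<in> W" "\<And>l. w (x l) = of_int (cyc_coeff n E (l - j))" using row_E by blast
  have "(\<lambda>y. v y + (- 1) * w y) \<in> W" using v w by (intro Wadd Wscale)
  then have "(\<lambda>y. (1 / of_int N) * (v y + (- 1) * w y)) \<in> W" by (rule Wscale)
  then show ?thesis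
  proof (rule Wext)
    fix y assume "y \<in> range x"
    then obtain l where l: "y = x l" by blast
    have b: "of_bool (x l = x i) = (of_bool (int n dvd l - i) :: complex)" for i l
      by (simp add: x_eq cong_iff_dvd_diff)
    show "of_bool (y = x i) - of_bool (y = x j) = (1 / of_int N) * (v y + (- 1) * w y)"
      unfolding l b v w cE using N by (simp add: N\<alpha>[symmetric] field_simps)
  qed
qed

end

subsection \<open>Polynomials constant on fibres\<close>

lemma poly_adic_expansion:
  fixes B F :: "'a :: field poly"
  assumes "degree B > 0"
  shows "\<exists>a N. F = (\<Sum>i\<le>(N::nat). a i * B ^ i) \<and> (\<forall>i. degree (a i) < degree B)"
proof (induction "degree F" arbitrary: F rule: less_induct)
  case less
  show ?case
  proof (cases "degree F < degree B")
    case True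
    show ?thesis by (rule exI[of _ "\<lambda>_. F"], rule exI[of _ 0]) (use True in simp)
  next
    case False
    have "degree (F div B) < degree F" using assms False by (intro degree_div_less) auto
    then obtain a N where a: "F div B = (\<Sum>i\<le>(N::nat). a i * B ^ i)" "\<forall>i. degree (a i) < degree B"
      using less by blast
    define a' where "a' i = (if i = 0 then F mod B else a (i - 1))" for i
    have "F = F mod B + (\<Sum>i\<le>N. a i * B ^ i) * B" using a(1) by (metis mod_div_mult_eq mult.commute)
    also have "\<dots> = a' 0 * B ^ 0 + (\<Sum>i\<le>N. a' (Suc i) * B ^ Suc i)"
      by (simp add: a'_def sum_distrib_left algebra_simps)
    also have "\<dots> = (\<Sum>i\<le>Suc N. a' i * B ^ i)" by (rule sum.atMost_Suc_shift[symmetric])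
    finally have "F = (\<Sum>i\<le>Suc N. a' i * B ^ i)" .
    moreover have "\<forall>i. degree (a' i) < degree B"
      using a(2) assms degree_mod_less'[of B F] by (cases "F mod B = 0"; cases "B = 0") (auto simp: a'_def)
    ultimately show ?thesis by blast
  qed
qed

text \<open>In the B-adic expansion of F the coefficients have degree below that of B, so on each
  such fibre they add up to a constant polynomial.\<close>

lemma poly_comp_if_constant_on_fibres:
  fixes B F :: "'a :: field poly"
  assumes B: "degree B > 0" and inf: "infinite Z"
    and fib: "\<And>\<beta>. \<beta> \<in> Z \<Longrightarrow> \<exists>S c. finite S \<and> card S = degree B \<and> (\<forall>x\<in>S. poly B x = \<beta> \<and> poly F x = c)"
  shows "\<exists>A. F = A \<circ>\<^sub>p B"
proof -
  obtain a N where a: "F = (\<Sum>i\<le>(N::nat). a i * B ^ i)" "\<forall>i. degree (a i) < degree B"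
    using poly_adic_expansion[OF B] by blast
  have const: "coeff (a i) k = 0" if k: "k > 0" and i: "i \<le> N" for i k
  proof -
    \<comment> \<open>The k-th coefficient of the expansion with \<open>B\<close> replaced by a
      fibre value, as a polynomial in that value.\<close>
    define p where "p = (\<Sum>i\<le>N. monom (coeff (a i) k) i)"
    have root: "poly p \<beta> = 0" if Z: "\<beta> \<in> Z" for \<beta>
    proof -
      obtain S c where S: "finite S" "card S = degree B" "\<And>x. x \<in> S \<Longrightarrow> poly B x = \<beta>" "\<And>x. x \<in> S \<Longrightarrow> poly F x = c"
        using fib[OF Z] by blast
      \<comment> \<open>On the fibre \<open>F\<close> agrees with its expansion in which
        \<open>B\<close> is replaced by \<beta>. This has degree below that of \<open>B\<close>,
        whereas \<open>s\<close> vanishes at \<open>degree B\<close> points.\<close>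
      define s where "s = (\<Sum>i\<le>N. smult (\<beta> ^ i) (a i)) - [:c:]"
      have "poly s x = 0" if "x \<in> S" for x
        using S(3,4)[OF that] unfolding s_def a(1) by (simp add: poly_sum mult.commute)
      then have "S \<subseteq> {x. poly s x = 0}" by blast
      moreover have "degree s < degree B"
        unfolding s_def using a(2) B
        by (intro degree_diff_less degree_sum_less) (auto intro: le_less_trans[OF degree_smult_le])
      ultimately have "s = 0"
        using S(1,2) card_poly_roots_bound[of s] poly_roots_finite[of s] card_mono[of "{x. poly s x = 0}" S]
        by (cases "s = 0") auto
      then have "coeff s k = 0" by simp
      then show ?thesis using k unfolding s_def p_def
        by (simp add: coeff_sum poly_sum poly_monom coeff_pCons mult.commute split: nat.splits)
    qed
    have "p = 0"
    proof (rule ccontr)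
      assume "p \<noteq> 0"
      then have "finite {x. poly p x = 0}" by (rule poly_roots_finite)
      then show False using inf root finite_subset[of Z "{x. poly p x = 0}"] by blast
    qed
    then have "coeff p i = 0" by simp
    then show ?thesis using i by (simp add: p_def coeff_sum)
  qed
  then have "a i = [:coeff (a i) 0:]" if "i \<le> N" for i using that
    by (intro poly_eqI) (auto simp: coeff_pCons split: nat.splits)
  then have "F = (\<Sum>i\<le>N. smult (coeff (a i) 0) (B ^ i))"
    unfolding a(1) by (intro sum.cong refl) (metis atMost_iff mult_pCons_left mult_zero_left add_0_right pCons_0_0)
  also have "\<dots> = (\<Sum>i\<le>N. monom (coeff (a i) 0) i) \<circ>\<^sub>p B"
  proof -
    have "monom c i \<circ>\<^sub>p B = smult c (B ^ i)" for c i
      by (induction i) (simp_all add: monom_0 monom_Suc pcompose_pCons)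
    then show ?thesis by (simp add: pcompose_sum)
  qed
  finally show ?thesis by (rule exI)
qed

subsection \<open>The covering defined by a polynomial\<close>

text \<open>The set \<open>V\<close> contains the critical values and may be larger, so that further
  points can be removed from the base.\<close>

locale poly_covering =
  fixes P :: "complex poly" and V :: "complex set"
  assumes deg: "degree P > 0" and finV: "finite V"
    and crit: "poly (pderiv P) z = 0 \<Longrightarrow> poly P z \<in> V"
begin

lemma cont: "continuous_on S (poly P)"
  using continuous_on_poly[OF continuous_on_id, of S P] by simp

lemma hol: "poly P holomorphic_on S"
  using poly_holomorphic_on[OF holomorphic_on_ident, of P S] by simp

abbreviation "regular \<equiv> poly P -` (- V)"

definition "fib t = {z. poly P z = t}"

lemma finite_fib: "finite (fib t)"
proof -
  have "P - [:t:] \<noteq> 0" using deg by (metis degree_pCons_0 eq_iff_diff_eq_0 less_irrefl)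
  then show ?thesis using poly_roots_finite[of "P - [:t:]"] by (simp add: fib_def)
qed

lemma card_fib:
  assumes "t \<notin> V"
  shows "card (fib t) = degree P"
proof -
  let ?p = "P - [:t:]"
  have dp: "degree ?p = degree P" using degree_add_eq_left[of "- [:t:]" P] deg by (simp only: diff_conv_add_uminus degree_minus degree_pCons_0)
  have "?p \<noteq> 0" using deg dp by auto
  have "rsquarefree ?p" unfolding rsquarefree_roots
    using crit assms by (auto simp: pderiv_diff pderiv_pCons)
  then have "smult (lead_coeff ?p) (\<Prod>z|poly ?p z = 0. [:- z, 1:]) = ?p"
    by (rule complex_poly_decompose_rsquarefree)
  then have "degree (\<Prod>z|poly ?p z = 0. [:- z, 1:]) = degree ?p"
    using \<open>?p \<noteq> 0\<close> by (metis degree_smult_eq leading_coeff_0_iff)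
  then show ?thesis using dp by (simp add: degree_prod_sum_eq fib_def)
qed

lemma poly_local_inverse:
  assumes "poly P y \<notin> V" "\<epsilon> > 0"
  obtains r g where "0 < r" "r \<le> \<epsilon>" "inj_on (poly P) (ball y r)" "open (poly P ` ball y r)"
    "g holomorphic_on (poly P ` ball y r)" "\<And>z. z \<in> ball y r \<Longrightarrow> g (poly P z) = z"
proof -
  have "deriv (poly P) y \<noteq> 0" using assms crit by (auto simp: poly_DERIV[THEN DERIV_imp_deriv])
  then obtain r0 where r0: "r0 > 0" "ball y r0 \<subseteq> UNIV" "inj_on (poly P) (ball y r0)"
    by (rule has_complex_derivative_locally_injective[OF hol UNIV_I open_UNIV])
  define r where "r = min r0 \<epsilon>"
  have r: "r > 0" "inj_on (poly P) (ball y r)"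
    using r0(1) assms by (simp_all add: r_def inj_on_subset[OF r0(3) subset_ball])
  obtain g where "g holomorphic_on (poly P ` ball y r)" "\<And>z. z \<in> ball y r \<Longrightarrow> g (poly P z) = z"
    by (rule holomorphic_has_inverse[OF hol _ r(2)]) auto
  moreover have "open (poly P ` ball y r)" using open_mapping_thm3[OF hol _ r(2)] by simp
  moreover have "r \<le> \<epsilon>" by (simp add: r_def)
  ultimately show ?thesis using that[OF r(1) _ r(2)] by blast
qed

text \<open>P is inverted on disjoint discs around the points of the fibre, and the images of the
  discs share a ball about \<open>t\<close>. That the inverses reach every preimage follows by
  counting, since all fibres outside \<open>V\<close> have \<open>degree P\<close> points.\<close>

lemma local_branches:
  assumes t: "t \<notin> V"
  obtains r br where "r > 0" "ball t r \<subseteq> - V"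
    "\<And>y. y \<in> fib t \<Longrightarrow> br y holomorphic_on ball t r" "\<And>y. y \<in> fib t \<Longrightarrow> br y t = y"
    "\<And>y s. y \<in> fib t \<Longrightarrow> s \<in> ball t r \<Longrightarrow> poly P (br y s) = s"
    "\<And>y. y \<in> fib t \<Longrightarrow> open (br y ` ball t r)"
    "\<And>y y'. y \<in> fib t \<Longrightarrow> y' \<in> fib t \<Longrightarrow> y \<noteq> y' \<Longrightarrow> disjnt (br y ` ball t r) (br y' ` ball t r)"
    "\<And>z. poly P z \<in> ball t r \<Longrightarrow> \<exists>y\<in>fib t. z = br y (poly P z)"
proof -
  obtain \<epsilon> where \<epsilon>: "\<epsilon> > 0" "\<And>y y'. y \<in> fib t \<Longrightarrow> y' \<in> fib t \<Longrightarrow> y \<noteq> y' \<Longrightarrow> 2 * \<epsilon> \<le> dist y y'"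
  proof -
    \<comment> \<open>The element 1 covers the case of a fibre with a single point.\<close>
    define D where "D = insert 1 ((\<lambda>(y, y'). dist y y') ` {(y, y'). y \<in> fib t \<and> y' \<in> fib t \<and> y \<noteq> y'})"
    have "finite {(y, y'). y \<in> fib t \<and> y' \<in> fib t \<and> y \<noteq> y'}"
      by (rule finite_subset[of _ "fib t \<times> fib t"]) (auto simp: finite_fib)
    then have D: "finite D" "D \<noteq> {}" by (auto simp: D_def)
    then have "Min D > 0" by (subst Min_gr_iff) (auto simp: D_def)
    moreover have "Min D \<le> dist y y'" if "y \<in> fib t" "y' \<in> fib t" "y \<noteq> y'" for y y'
      using that D by (intro Min_le) (auto simp: D_def)
    ultimately show ?thesis using that[of "Min D / 2"] by simp
  qed
  have "\<forall>y\<in>fib t. \<exists>r g. 0 < r \<and> r \<le> \<epsilon> \<and> inj_on (poly P) (ball y r) \<and> open (poly P ` ball y r) \<and>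
     g holomorphic_on (poly P ` ball y r) \<and> (\<forall>z\<in>ball y r. g (poly P z) = z)"
  proof
    fix y assume "y \<in> fib t"
    then have "poly P y \<notin> V" using t by (simp add: fib_def)
    from poly_local_inverse[OF this \<epsilon>(1)] show "\<exists>r g. 0 < r \<and> r \<le> \<epsilon> \<and> inj_on (poly P) (ball y r) \<and> open (poly P ` ball y r) \<and>
     g holomorphic_on (poly P ` ball y r) \<and> (\<forall>z\<in>ball y r. g (poly P z) = z)" by metis
  qed
  then obtain \<rho> br where br: "\<And>y. y \<in> fib t \<Longrightarrow> 0 < \<rho> y \<and> \<rho> y \<le> \<epsilon> \<and> open (poly P ` ball y (\<rho> y)) \<and>
     br y holomorphic_on (poly P ` ball y (\<rho> y)) \<and> (\<forall>z\<in>ball y (\<rho> y). br y (poly P z) = z)"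
    by metis
  define O' where "O' = - V \<inter> (\<Inter>y\<in>fib t. poly P ` ball y (\<rho> y))"
  have "open O'" unfolding O'_def using finV finite_fib br
    by (intro open_Int open_INT) (auto simp: finite_imp_closed)
  moreover have "t \<in> O'"
  proof -
    have "t \<in> poly P ` ball y (\<rho> y)" if "y \<in> fib t" for y
      using br[OF that] that by (auto simp: fib_def intro!: image_eqI[of t "poly P" y])
    then show ?thesis using t by (auto simp: O'_def)
  qed
  ultimately obtain r where r: "r > 0" "ball t r \<subseteq> O'" by (metis openE)
  have im: "ball t r \<subseteq> poly P ` ball y (\<rho> y)" if "y \<in> fib t" for y
    using r(2) that by (auto simp: O'_def)
  have inv: "poly P (br y s) = s" "br y s \<in> ball y (\<rho> y)" if y: "y \<in> fib t" and s: "s \<in> ball t r" for y s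
  proof -
    obtain z where "z \<in> ball y (\<rho> y)" "s = poly P z" using im[OF y] s by blast
    then show "poly P (br y s) = s" "br y s \<in> ball y (\<rho> y)" using br[OF y] by auto
  qed
  have holb: "br y holomorphic_on ball t r" if "y \<in> fib t" for y
    using br[OF that] im[OF that] by (meson holomorphic_on_subset)
  have injb: "inj_on (br y) (ball t r)" if "y \<in> fib t" for y
    by (rule inj_on_inverseI[of _ "poly P"]) (rule inv(1)[OF that])
  have disj: "disjnt (br y ` ball t r) (br y' ` ball t r)" if y: "y \<in> fib t" "y' \<in> fib t" "y \<noteq> y'" for y y'
  proof -
    have "disjnt (ball y (\<rho> y)) (ball y' (\<rho> y'))"
    proof (rule ccontr)
      assume "\<not> ?thesis"
      then obtain z where "dist y z < \<rho> y" "dist y' z < \<rho> y'" by (auto simp: disjnt_iff)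
      then have "dist y y' < \<rho> y + \<rho> y'" by (metis add_strict_mono dist_commute dist_triangle le_less_trans)
      then show False using \<epsilon>(2)[OF y] br[OF y(1)] br[OF y(2)] by linarith
    qed
    moreover have "br y ` ball t r \<subseteq> ball y (\<rho> y)" "br y' ` ball t r \<subseteq> ball y' (\<rho> y')"
      using inv(2)[OF y(1)] inv(2)[OF y(2)] by (meson image_subsetI)+
    ultimately show ?thesis by (meson disjnt_subset1 disjnt_subset2)
  qed
  show ?thesis
  proof (rule that[of r br])
    show "r > 0" "ball t r \<subseteq> - V" using r by (auto simp: O'_def)
    show "br y t = y" if y: "y \<in> fib t" for y
      using br[OF y] y by (auto simp: fib_def)
    show "open (br y ` ball t r)" if "y \<in> fib t" for y
      using open_mapping_thm3[OF holb[OF that] _ injb[OF that]] by simp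
    show "\<exists>y\<in>fib t. z = br y (poly P z)" if z: "poly P z \<in> ball t r" for z
    proof -
      let ?s = "poly P z"
      have "?s \<notin> V" using z r by (auto simp: O'_def)
      have "inj_on (\<lambda>y. br y ?s) (fib t)"
        using disj z by (fastforce simp: inj_on_def disjnt_iff)
      then have "card ((\<lambda>y. br y ?s) ` fib t) = card (fib ?s)"
        using card_fib t \<open>?s \<notin> V\<close> by (simp add: card_image)
      moreover have "(\<lambda>y. br y ?s) ` fib t \<subseteq> fib ?s" using inv(1) z by (auto simp: fib_def)
      ultimately have "(\<lambda>y. br y ?s) ` fib t = fib ?s" by (intro card_subset_eq finite_fib)
      moreover have "z \<in> fib ?s" by (simp add: fib_def)
      ultimately show ?thesis by blast
    qed
  qed (use holb inv disj in auto)
qed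

lemma covering: "covering_space regular (poly P) (- V)"
proof
  show "continuous_on regular (poly P)" by (rule cont)
  show "poly P ` regular = - V"
  proof -
    have "t \<in> poly P ` regular" if "t \<notin> V" for t
    proof -
      have "fib t \<noteq> {}" using card_fib[OF that] deg by auto
      then obtain z where "poly P z = t" by (auto simp: fib_def)
      then show ?thesis using that by auto
    qed
    then show ?thesis by auto
  qed
  have opt: "open regular" using finV by (intro open_vimage cont) (auto simp: finite_imp_closed)
  fix t assume "t \<in> - V"
  then have "t \<notin> V" by simp
  then obtain r br where b: "r > 0" "ball t r \<subseteq> - V"
    "\<And>y. y \<in> fib t \<Longrightarrow> br y holomorphic_on ball t r" "\<And>y. y \<in> fib t \<Longrightarrow> br y t = y"
    "\<And>y s. y \<in> fib t \<Longrightarrow> s \<in> ball t r \<Longrightarrow> poly P (br y s) = s"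
    "\<And>y. y \<in> fib t \<Longrightarrow> open (br y ` ball t r)"
    "\<And>y y'. y \<in> fib t \<Longrightarrow> y' \<in> fib t \<Longrightarrow> y \<noteq> y' \<Longrightarrow> disjnt (br y ` ball t r) (br y' ` ball t r)"
    "\<And>z. poly P z \<in> ball t r \<Longrightarrow> \<exists>y\<in>fib t. z = br y (poly P z)"
    by (rule local_branches) blast
  define v where "v = (\<lambda>y. br y ` ball t r) ` fib t"
  have "\<Union>v = regular \<inter> poly P -` ball t r"
  proof
    show "\<Union>v \<subseteq> regular \<inter> poly P -` ball t r" using b(2,5) by (force simp: v_def)
    show "regular \<inter> poly P -` ball t r \<subseteq> \<Union>v" using b(8) by (force simp: v_def)
  qed
  moreover have "\<forall>u\<in>v. openin (top_of_set regular) u"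
    using b(2,5,6) by (intro ballI open_subset) (auto simp: v_def)
  moreover have "pairwise disjnt v" unfolding v_def pairwise_def using b(7) by blast
  moreover have "\<forall>u\<in>v. \<exists>q. homeomorphism u (ball t r) (poly P) q"
  proof
    fix u assume u: "u \<in> v"
    obtain y where y: "y \<in> fib t" "u = br y ` ball t r" using u unfolding v_def by blast
    have "homeomorphism u (ball t r) (poly P) (br y)"
      unfolding homeomorphism_def y(2)
      using b(5)[OF y(1)] holomorphic_on_imp_continuous_on[OF b(3)[OF y(1)]]
      by (auto simp: image_image cont)
    then show "\<exists>q. homeomorphism u (ball t r) (poly P) q" by (intro exI[of _ "br y"])
  qed
  moreover have "openin (top_of_set (- V)) (ball t r)" using b(2) by (intro open_subset) auto
  moreover have "t \<in> ball t r" using b(1) by simp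
  ultimately have "t \<in> ball t r \<and> openin (top_of_set (- V)) (ball t r) \<and>
    (\<exists>v. \<Union>v = regular \<inter> poly P -` ball t r \<and> (\<forall>u\<in>v. openin (top_of_set regular) u) \<and>
      pairwise disjnt v \<and> (\<forall>u\<in>v. \<exists>q. homeomorphism u (ball t r) (poly P) q))"
    by (intro conjI exI[of _ v])
  then show "\<exists>T. t \<in> T \<and> openin (top_of_set (- V)) T \<and>
    (\<exists>v. \<Union>v = regular \<inter> poly P -` T \<and> (\<forall>u\<in>v. openin (top_of_set regular) u) \<and> pairwise disjnt v \<and>
    (\<forall>u\<in>v. \<exists>q. homeomorphism u T (poly P) q))" by (intro exI[of _ "ball t r"])
qed


section \<open>Path lifting and the monodromy action\<close>

definition lift :: "(real \<Rightarrow> complex) \<Rightarrow> complex \<Rightarrow> real \<Rightarrow> complex" where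
  "lift \<gamma> y = (SOME h. path h \<and> pathstart h = y \<and> (\<forall>s\<in>{0..1}. poly P (h s) = \<gamma> s))"

definition transport :: "(real \<Rightarrow> complex) \<Rightarrow> complex \<Rightarrow> complex" where
  "transport \<gamma> y = pathfinish (lift \<gamma> y)"

lemma lift_exists:
  assumes "path \<gamma>" "path_image \<gamma> \<subseteq> - V" "poly P y = pathstart \<gamma>"
  shows "\<exists>h. path h \<and> pathstart h = y \<and> (\<forall>s\<in>{0..1}. poly P (h s) = \<gamma> s)"
proof -
  have "pathstart \<gamma> \<in> - V" using assms(2) pathstart_in_path_image by blast
  then have "y \<in> regular" using assms(3) by simp
  from covering_space_lift_path_strong[OF covering this assms(1,2) assms(3)[symmetric]]
  show ?thesis by metis
qed

lemma lift_props:
  assumes "path \<gamma>" "path_image \<gamma> \<subseteq> - V" "poly P y = pathstart \<gamma>"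
  shows "path (lift \<gamma> y)" "pathstart (lift \<gamma> y) = y" "\<And>s. s \<in> {0..1} \<Longrightarrow> poly P (lift \<gamma> y s) = \<gamma> s"
  using someI_ex[OF lift_exists[OF assms]] unfolding lift_def by blast+

text \<open>The parameter space is general because lifts are compared on intervals, discs,
  half-planes and on the domain of the logarithms.\<close>

lemma continuous_lift_unique:
  fixes f :: "'b :: topological_space \<Rightarrow> complex"
  assumes "connected T" "continuous_on T g1" "continuous_on T g2"
    and "\<And>x. x \<in> T \<Longrightarrow> poly P (g1 x) = f x" "\<And>x. x \<in> T \<Longrightarrow> poly P (g2 x) = f x"
    and "f ` T \<subseteq> - V" "a \<in> T" "g1 a = g2 a" "x \<in> T"
  shows "g1 x = g2 x"
proof (rule covering_space_lift_unique[OF covering, of g1 a g2 T f])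
  have "continuous_on T (\<lambda>x. poly P (g1 x))" using assms(2) by (rule continuous_on_poly)
  then show "continuous_on T f" using assms(4) by (simp cong: continuous_on_cong)
qed (use assms in auto)

lemma transport_eq:
  assumes "path \<gamma>" "path_image \<gamma> \<subseteq> - V" "path h" "\<And>s. s \<in> {0..1} \<Longrightarrow> poly P (h s) = \<gamma> s"
  shows "transport \<gamma> (pathstart h) = pathfinish h"
proof -
  have st: "poly P (pathstart h) = pathstart \<gamma>" using assms(4)[of 0] by (simp add: pathstart_def)
  note L = lift_props[OF assms(1,2) st]
  have "lift \<gamma> (pathstart h) 1 = h 1"
  proof (rule continuous_lift_unique[of "{0..1::real}" _ _ \<gamma> 0])
    show "continuous_on {0..1} (lift \<gamma> (pathstart h))" "continuous_on {0..1} h"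
      using L(1) assms(3) by (simp_all add: path_def)
    show "\<gamma> ` {0..1} \<subseteq> - V" using assms(2) by (simp add: path_image_def)
    show "lift \<gamma> (pathstart h) 0 = h 0" using L(2) by (simp add: pathstart_def)
  qed (use L(3) assms(4) in auto)
  then show ?thesis by (simp add: transport_def pathfinish_def)
qed

lemma transport_in_fib:
  assumes "path \<gamma>" "path_image \<gamma> \<subseteq> - V" "y \<in> fib (pathstart \<gamma>)"
  shows "transport \<gamma> y \<in> fib (pathfinish \<gamma>)"
  using lift_props(3)[OF assms(1,2), of y 1] assms(3)
  by (simp add: fib_def transport_def pathfinish_def)

lemma transport_join:
  assumes "path \<gamma>" "path_image \<gamma> \<subseteq> - V" "path \<delta>" "path_image \<delta> \<subseteq> - V"
    and "pathfinish \<gamma> = pathstart \<delta>" "y \<in> fib (pathstart \<gamma>)"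
  shows "transport (\<gamma> +++ \<delta>) y = transport \<delta> (transport \<gamma> y)"
proof -
  have y: "poly P y = pathstart \<gamma>" using assms(6) by (simp add: fib_def)
  have y': "poly P (transport \<gamma> y) = pathstart \<delta>"
    using transport_in_fib[OF assms(1,2,6)] assms(5) by (simp add: fib_def)
  note L = lift_props[OF assms(1,2) y] and L' = lift_props[OF assms(3,4) y']
  let ?h = "lift \<gamma> y +++ lift \<delta> (transport \<gamma> y)"
  have eq: "pathfinish (lift \<gamma> y) = pathstart (lift \<delta> (transport \<gamma> y))"
    using L'(2) by (simp add: transport_def)
  have "transport (\<gamma> +++ \<delta>) (pathstart ?h) = pathfinish ?h"
  proof (rule transport_eq)
    show "path (\<gamma> +++ \<delta>)" using assms by simp
    show "path_image (\<gamma> +++ \<delta>) \<subseteq> - V" using assms path_image_join by (simp add: path_image_join)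
    show "path ?h" using L(1) L'(1) eq by simp
    show "poly P (?h s) = (\<gamma> +++ \<delta>) s" if "s \<in> {0..1}" for s
      using that L(3)[of "2 * s"] L'(3)[of "2 * s - 1"] by (auto simp: joinpaths_def)
  qed
  then show ?thesis using L(2) by (simp add: transport_def)
qed

lemma transport_reverse:
  assumes "path \<gamma>" "path_image \<gamma> \<subseteq> - V" "y \<in> fib (pathstart \<gamma>)"
  shows "transport (reversepath \<gamma>) (transport \<gamma> y) = y"
proof -
  have y: "poly P y = pathstart \<gamma>" using assms(3) by (simp add: fib_def)
  note L = lift_props[OF assms(1,2) y]
  have "transport (reversepath \<gamma>) (pathstart (reversepath (lift \<gamma> y))) = pathfinish (reversepath (lift \<gamma> y))"
  proof (rule transport_eq)
    show "poly P (reversepath (lift \<gamma> y) s) = reversepath \<gamma> s" if "s \<in> {0..1}" for s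
      using that L(3)[of "1 - s"] by (simp add: reversepath_def)
  qed (use assms L in auto)
  then show ?thesis using L(2) by (simp add: transport_def)
qed

lemma transport_bij:
  assumes "path \<gamma>" "path_image \<gamma> \<subseteq> - V"
  shows "bij_betw (transport \<gamma>) (fib (pathstart \<gamma>)) (fib (pathfinish \<gamma>))"
proof (rule bij_betw_byWitness[of _ "transport (reversepath \<gamma>)"])
  have r: "path (reversepath \<gamma>)" "path_image (reversepath \<gamma>) \<subseteq> - V" using assms by auto
  show "\<forall>y\<in>fib (pathstart \<gamma>). transport (reversepath \<gamma>) (transport \<gamma> y) = y"
    using transport_reverse[OF assms] by blast
  show "\<forall>y\<in>fib (pathfinish \<gamma>). transport \<gamma> (transport (reversepath \<gamma>) y) = y"
    using transport_reverse[OF r] by simp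
  show "transport \<gamma> ` fib (pathstart \<gamma>) \<subseteq> fib (pathfinish \<gamma>)"
    using transport_in_fib[OF assms] by blast
  show "transport (reversepath \<gamma>) ` fib (pathfinish \<gamma>) \<subseteq> fib (pathstart \<gamma>)"
    using transport_in_fib[OF r] by auto
qed

section \<open>Linear relations between germs of branches\<close>

definition branches :: "complex \<Rightarrow> real \<Rightarrow> 'i set \<Rightarrow> ('i \<Rightarrow> complex) \<Rightarrow> ('i \<Rightarrow> complex \<Rightarrow> complex) \<Rightarrow> bool" where
  "branches t r I pt br \<longleftrightarrow> r > 0 \<and> ball t r \<subseteq> - V \<and>
     (\<forall>i\<in>I. br i holomorphic_on ball t r \<and> br i t = pt i \<and> (\<forall>s\<in>ball t r. poly P (br i s) = s))"

text \<open>The coefficients belong to indices rather than to points of the fibre, so continuation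
  along a path moves \<open>pt\<close> and leaves \<open>u\<close> unchanged.\<close>

definition germ_rel :: "complex poly \<Rightarrow> complex \<Rightarrow> 'i set \<Rightarrow> ('i \<Rightarrow> complex) \<Rightarrow> ('i \<Rightarrow> complex) \<Rightarrow> bool" where
  "germ_rel Q t I pt u \<longleftrightarrow> (\<exists>r br. branches t r I pt br \<and> (\<forall>s\<in>ball t r. (\<Sum>i\<in>I. u i * poly Q (br i s)) = 0))"

lemma germ_relI:
  "branches t r I pt br \<Longrightarrow> (\<And>s. s \<in> ball t r \<Longrightarrow> (\<Sum>i\<in>I. u i * poly Q (br i s)) = 0) \<Longrightarrow> germ_rel Q t I pt u"
  unfolding germ_rel_def by blast

lemma branches_exist:
  assumes "t \<notin> V" "\<And>i. i \<in> I \<Longrightarrow> poly P (pt i) = t"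
  shows "\<exists>r br. branches t r I pt br"
proof -
  obtain r br where b: "r > 0" "ball t r \<subseteq> - V"
    "\<And>y. y \<in> fib t \<Longrightarrow> br y holomorphic_on ball t r" "\<And>y. y \<in> fib t \<Longrightarrow> br y t = y"
    "\<And>y s. y \<in> fib t \<Longrightarrow> s \<in> ball t r \<Longrightarrow> poly P (br y s) = s"
    using assms(1) by (rule local_branches) blast
  have "branches t r I pt (\<lambda>i. br (pt i))"
    unfolding branches_def using b assms(2) by (simp add: fib_def)
  then show ?thesis by (intro exI)
qed

lemma branches_mono:
  assumes "branches t r I pt br" "s \<in> ball t r" "r' > 0" "ball s r' \<subseteq> ball t r"
  shows "branches s r' I (\<lambda>i. br i s) br"
  using assms unfolding branches_def by (auto intro: holomorphic_on_subset)

lemma branches_unique: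
  assumes "branches t r I pt br" "branches t r' I pt br'" "i \<in> I" "s \<in> ball t r" "s \<in> ball t r'"
  shows "br i s = br' i s"
proof (rule continuous_lift_unique[of "ball t (min r r')" "br i" "br' i" "\<lambda>s. s" t s])
  have sub: "ball t (min r r') \<subseteq> ball t r" "ball t (min r r') \<subseteq> ball t r'" by auto
  show "continuous_on (ball t (min r r')) (br i)" "continuous_on (ball t (min r r')) (br' i)"
    using assms(1-3) sub unfolding branches_def
    by (meson continuous_on_subset holomorphic_on_imp_continuous_on)+
qed (use assms in \<open>auto simp: branches_def\<close>)

lemma branches_sum_holomorphic:
  assumes "branches t r I pt br"
  shows "(\<lambda>s. \<Sum>i\<in>I. u i * poly Q (br i s)) holomorphic_on ball t r"
  using assms unfolding branches_def by (intro holomorphic_intros) auto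

text \<open>By the identity theorem, a relation that holds for one choice of disc and branches holds
  for every choice.\<close>

lemma germ_relD:
  assumes "germ_rel Q t I pt u" "branches t r I pt br" "s \<in> ball t r"
  shows "(\<Sum>i\<in>I. u i * poly Q (br i s)) = 0"
proof -
  obtain r' br' where b: "branches t r' I pt br'" "\<And>s. s \<in> ball t r' \<Longrightarrow> (\<Sum>i\<in>I. u i * poly Q (br' i s)) = 0"
    using assms(1) unfolding germ_rel_def by blast
  have pos: "r > 0" "r' > 0" using b(1) assms(2) by (auto simp: branches_def)
  show ?thesis
  proof (rule analytic_continuation_open[of "ball t (min r r')" "ball t r" "\<lambda>s. \<Sum>i\<in>I. u i * poly Q (br i s)" "\<lambda>_. 0"])
    show "(\<Sum>i\<in>I. u i * poly Q (br i s)) = 0" if "s \<in> ball t (min r r')" for s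
    proof -
      have "(\<Sum>i\<in>I. u i * poly Q (br i s)) = (\<Sum>i\<in>I. u i * poly Q (br' i s))"
        using branches_unique[OF assms(2) b(1)] that by (intro sum.cong) auto
      then show ?thesis using b(2) that by simp
    qed
  qed (use pos assms(3) branches_sum_holomorphic[OF assms(2)] in auto)
qed

text \<open>The right-hand side does not depend on \<open>s\<close>, which makes the truth of a
  relation locally constant along a path.\<close>

lemma germ_rel_branches_iff:
  assumes b: "branches t r I pt br" and s: "s \<in> ball t r"
  shows "germ_rel Q s I (\<lambda>i. br i s) u \<longleftrightarrow> (\<forall>t'\<in>ball t r. (\<Sum>i\<in>I. u i * poly Q (br i t')) = 0)"
proof -
  obtain r' where r': "r' > 0" "ball s r' \<subseteq> ball t r" using s by (metis open_ball openE)
  have b': "branches s r' I (\<lambda>i. br i s) br" by (rule branches_mono[OF b s r'])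
  show ?thesis
  proof
    assume g: "germ_rel Q s I (\<lambda>i. br i s) u"
    show "\<forall>t'\<in>ball t r. (\<Sum>i\<in>I. u i * poly Q (br i t')) = 0"
    proof
      fix t' assume t': "t' \<in> ball t r"
      show "(\<Sum>i\<in>I. u i * poly Q (br i t')) = 0"
        by (rule analytic_continuation_open[of "ball s r'" "ball t r" "\<lambda>s. \<Sum>i\<in>I. u i * poly Q (br i s)" "\<lambda>_. 0"])
          (use r' t' branches_sum_holomorphic[OF b] germ_relD[OF g b'] in auto)
    qed
  next
    assume "\<forall>t'\<in>ball t r. (\<Sum>i\<in>I. u i * poly Q (br i t')) = 0"
    then show "germ_rel Q s I (\<lambda>i. br i s) u" unfolding germ_rel_def using b' r' by blast
  qed
qed

lemma germ_rel_cong_pt: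
  "(\<And>i. i \<in> I \<Longrightarrow> pt i = pt' i) \<Longrightarrow> germ_rel Q t I pt u \<longleftrightarrow> germ_rel Q t I pt' u"
  unfolding germ_rel_def branches_def by simp


text \<open>Permanence of relations under analytic continuation: the truth of the relation at time s
  is a locally constant function on the unit interval.\<close>

lemma germ_rel_transport:
  assumes \<gamma>: "path \<gamma>" "path_image \<gamma> \<subseteq> - V" and pt: "\<And>i. i \<in> I \<Longrightarrow> pt i \<in> fib (pathstart \<gamma>)"
  shows "germ_rel Q (pathstart \<gamma>) I pt u \<longleftrightarrow> germ_rel Q (pathfinish \<gamma>) I (\<lambda>i. transport \<gamma> (pt i)) u"
proof -
  have pt': "poly P (pt i) = pathstart \<gamma>" if "i \<in> I" for i using pt[OF that] by (simp add: fib_def)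
  note L = lift_props[OF \<gamma> pt']
  define A where "A s = germ_rel Q (\<gamma> s) I (\<lambda>i. lift \<gamma> (pt i) s) u" for s
  have "A constant_on {0..1}"
  proof (rule locally_constant_imp_constant)
    fix s :: real assume s: "s \<in> {0..1}"
    have "\<gamma> s \<notin> V" using s \<gamma>(2) unfolding path_image_def by (metis ComplD image_subset_iff)
    then have "\<exists>r br. branches (\<gamma> s) r I (\<lambda>i. lift \<gamma> (pt i) s) br"
      by (rule branches_exist) (rule L(3)[OF _ s])
    then obtain r br where b: "branches (\<gamma> s) r I (\<lambda>i. lift \<gamma> (pt i) s) br" by blast
    have r: "r > 0" using b by (simp add: branches_def)
    have cont: "continuous_on {0..1} \<gamma>" using \<gamma>(1) by (simp add: path_def)
    then obtain \<delta> where \<delta>: "\<delta> > 0" "\<And>s'. s' \<in> {0..1} \<Longrightarrow> dist s' s < \<delta> \<Longrightarrow> dist (\<gamma> s') (\<gamma> s) < r"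
      using s r unfolding continuous_on_iff by blast
    define T where "T = {0..1} \<inter> ball s \<delta>"
    have sT: "s \<in> T" using s \<delta> by (simp add: T_def)
    have \<gamma>T: "\<gamma> s' \<in> ball (\<gamma> s) r" if "s' \<in> T" for s'
      using that \<delta>(2)[of s'] by (simp add: T_def dist_commute)
    have "convex T" unfolding T_def by (intro convex_Int convex_ball) auto
    then have conT: "connected T" by (rule convex_connected)
    \<comment> \<open>Close to s the lifts run along the branches over the disc at \<gamma> s, by
      uniqueness of lifts.\<close>
    have brs: "lift \<gamma> (pt i) s' = br i (\<gamma> s')" if i: "i \<in> I" and s': "s' \<in> T" for i s'
    proof (rule continuous_lift_unique[OF conT, of _ _ \<gamma> s s'])
      show "continuous_on T (lift \<gamma> (pt i))"
        using L(1)[OF i] unfolding path_def T_def by (rule continuous_on_subset) simp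
      have "continuous_on (ball (\<gamma> s) r) (br i)"
        using b i by (auto simp: branches_def intro: holomorphic_on_imp_continuous_on)
      moreover have "continuous_on T \<gamma>" using cont unfolding T_def by (rule continuous_on_subset) simp
      ultimately show "continuous_on T (\<lambda>s. br i (\<gamma> s))"
        using \<gamma>T by (intro continuous_on_compose2[of "ball (\<gamma> s) r" "br i" T \<gamma>]) auto
      show "poly P (lift \<gamma> (pt i) x) = \<gamma> x" if "x \<in> T" for x
        using L(3)[OF i] that by (simp add: T_def)
      show "poly P (br i (\<gamma> x)) = \<gamma> x" if "x \<in> T" for x
        using b i \<gamma>T[OF that] by (simp add: branches_def)
      show "\<gamma> ` T \<subseteq> - V" using \<gamma>(2) by (auto simp: path_image_def T_def)
      show "lift \<gamma> (pt i) s = br i (\<gamma> s)" using b i by (simp add: branches_def)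
    qed (use sT s' in auto)
    have "A s' \<longleftrightarrow> (\<forall>t'\<in>ball (\<gamma> s) r. (\<Sum>i\<in>I. u i * poly Q (br i t')) = 0)" if s': "s' \<in> T" for s'
    proof -
      have "A s' \<longleftrightarrow> germ_rel Q (\<gamma> s') I (\<lambda>i. br i (\<gamma> s')) u"
        unfolding A_def using brs s' by (intro germ_rel_cong_pt) blast
      then show ?thesis using germ_rel_branches_iff[OF b \<gamma>T[OF s']] by simp
    qed
    then have "A s' = A s" if "s' \<in> T" for s' using sT that by simp
    moreover have "openin (top_of_set {0..1}) T" unfolding T_def by (intro openin_open_Int) simp
    ultimately show "\<exists>T. openin (top_of_set {0..1}) T \<and> s \<in> T \<and> (\<forall>x\<in>T. A x = A s)"
      using sT by metis
  qed simp
  then obtain c where c: "\<And>s. s \<in> {0..1} \<Longrightarrow> A s = c" unfolding constant_on_def by blast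
  have "germ_rel Q (pathstart \<gamma>) I pt u = A 0"
    unfolding A_def pathstart_def by (rule germ_rel_cong_pt) (use L(2) in \<open>simp add: pathstart_def\<close>)
  also have "A 0 = A 1" using c[of 0] c[of 1] by simp
  also have "A 1 = germ_rel Q (pathfinish \<gamma>) I (\<lambda>i. transport \<gamma> (pt i)) u"
    unfolding A_def pathfinish_def transport_def ..
  finally show ?thesis .
qed

lemma germ_rel_reindex:
  assumes "bij_betw g J I" "germ_rel Q t I pt u"
  shows "germ_rel Q t J (\<lambda>j. pt (g j)) (\<lambda>j. u (g j))"
proof -
  obtain r br where b: "branches t r I pt br" "\<And>s. s \<in> ball t r \<Longrightarrow> (\<Sum>i\<in>I. u i * poly Q (br i s)) = 0"
    using assms(2) unfolding germ_rel_def by blast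
  have "branches t r J (\<lambda>j. pt (g j)) (\<lambda>j. br (g j))"
    using b(1) bij_betwE[OF assms(1)] unfolding branches_def by blast
  then show ?thesis
  proof (rule germ_relI)
    fix s assume "s \<in> ball t r"
    then have "(\<Sum>i\<in>I. u i * poly Q (br i s)) = 0" by (rule b(2))
    then show "(\<Sum>j\<in>J. u (g j) * poly Q (br (g j) s)) = 0"
      by (simp only: sum.reindex_bij_betw[OF assms(1), of "\<lambda>i. u i * poly Q (br i s)"])
  qed
qed

end

subsection \<open>Imprimitive monodromy and decompositions\<close>

lemma poly_norm_le:
  fixes p :: "complex poly"
  shows "norm (poly p z) \<le> (\<Sum>i\<le>degree p. norm (coeff p i)) * (1 + norm z) ^ degree p"
proof -
  have "norm (poly p z) \<le> (\<Sum>i\<le>degree p. norm (coeff p i) * norm z ^ i)"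
    unfolding poly_altdef by (intro order.trans[OF norm_sum]) (simp add: norm_mult norm_power)
  also have "\<dots> \<le> (\<Sum>i\<le>degree p. norm (coeff p i) * (1 + norm z) ^ degree p)"
  proof (intro sum_mono mult_left_mono)
    fix i assume "i \<in> {..degree p}"
    then have "norm z ^ i \<le> (1 + norm z) ^ i" "(1 + norm z) ^ i \<le> (1 + norm z) ^ degree p"
      by (auto intro: power_mono power_increasing)
    then show "norm z ^ i \<le> (1 + norm z) ^ degree p" by linarith
  qed simp
  finally show ?thesis by (simp add: sum_distrib_right)
qed

text \<open>For large y the leading term dominates, so |P(y)| is at least a constant times |y|^n,
  while |P(x)| is at most a constant times (1 + |x|)^n. The bound yields polynomial growth of
  symmetric functions of points in a fibre.\<close>

lemma poly_same_value_norm_le: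
  fixes P :: "complex poly"
  assumes "degree P > 0"
  obtains C where "C > 0" "\<And>x y. poly P x = poly P y \<Longrightarrow> norm y \<le> C * (1 + norm x)"
proof -
  define n where "n = degree P"
  have n: "n > 0" using assms by (simp add: n_def)
  define l where "l = norm (lead_coeff P)"
  have l: "l > 0" using assms by (auto simp: l_def)
  define R where "R = P - monom (lead_coeff P) n"
  define B where "B = (\<Sum>i\<le>degree P. norm (coeff P i))"
  define D where "D = (\<Sum>i\<le>degree R. norm (coeff R i))"
  have B: "B \<ge> 0" and D: "D \<ge> 0" by (auto simp: B_def D_def intro: sum_nonneg)
  have dR: "degree R \<le> n - 1"
  proof (rule degree_le, intro allI impI)
    fix i assume "n - 1 < i"
    then show "coeff R i = 0" using n by (cases "i = n") (auto simp: R_def n_def coeff_eq_0)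
  qed
  \<comment> \<open>The summand 1 ensures |y| >= 1 beyond C, the next one makes the lower terms at
    most half the leading term, and the last one gives C^n >= 2 B / l.\<close>
  define C where "C = 1 + 2 * D * 2 ^ n / l + 2 * B / l"
  have C: "C \<ge> 1" "C \<ge> 2 * D * 2 ^ n / l" "C \<ge> 2 * B / l" using B D l by (auto simp: C_def)
  have main: "norm y \<le> C * (1 + norm x)" if eq: "poly P x = poly P y" for x y
  proof (cases "norm y \<le> C")
    case True
    have "C * 1 \<le> C * (1 + norm x)" using C by (intro mult_left_mono) auto
    then show ?thesis using True by linarith
  next
    case False
    have y1: "norm y \<ge> 1" using False C by linarith
    have "norm (poly R y) \<le> D * (1 + norm y) ^ degree R" unfolding D_def by (rule poly_norm_le)
    also have "\<dots> \<le> D * (1 + norm y) ^ (n - 1)" using dR D by (intro mult_left_mono power_increasing) auto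
    also have "\<dots> \<le> D * (2 * norm y) ^ (n - 1)" using y1 D by (intro mult_left_mono power_mono) auto
    also have "\<dots> \<le> D * (2 ^ n * norm y ^ (n - 1))"
      using D unfolding power_mult_distrib by (intro mult_left_mono mult_right_mono power_increasing) auto
    finally have "norm (poly R y) \<le> D * 2 ^ n * norm y ^ (n - 1)" by simp
    also have "D * 2 ^ n \<le> l / 2 * norm y"
    proof -
      have "2 * D * 2 ^ n / l \<le> norm y" using False C by linarith
      then show ?thesis using l by (simp add: field_simps)
    qed
    then have "D * 2 ^ n * norm y ^ (n - 1) \<le> l / 2 * norm y * norm y ^ (n - 1)"
      by (intro mult_right_mono) auto
    also have "\<dots> = l / 2 * norm y ^ n" using n by (simp add: power_eq_if)
    finally have R: "norm (poly R y) \<le> l / 2 * norm y ^ n" .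
    have "poly P y = lead_coeff P * y ^ n + poly R y" by (simp add: R_def poly_monom)
    then have "norm (poly P y) \<ge> norm (lead_coeff P * y ^ n) - norm (poly R y)"
      by (simp add: norm_diff_ineq)
    then have "l / 2 * norm y ^ n \<le> norm (poly P y)" using R by (simp add: l_def norm_mult norm_power)
    also have "\<dots> \<le> B * (1 + norm x) ^ n" unfolding eq[symmetric] B_def n_def by (rule poly_norm_le)
    finally have "norm y ^ n \<le> 2 * B / l * (1 + norm x) ^ n" using l by (simp add: field_simps)
    also have "\<dots> \<le> C ^ n * (1 + norm x) ^ n"
    proof (intro mult_right_mono)
      have "C ^ 1 \<le> C ^ n" using C n by (intro power_increasing) auto
      then show "2 * B / l \<le> C ^ n" using C by simp
    qed simp
    finally have "norm y ^ n \<le> (C * (1 + norm x)) ^ n" by (simp add: power_mult_distrib)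
    then show ?thesis using C n by (intro power_le_imp_le_base[of "norm y" "n - 1"]) auto
  qed
  have "C > 0" using C by linarith
  then show ?thesis using main by (rule that)
qed

text \<open>The growth bound keeps \<open>f\<close> bounded near each point of \<open>X\<close>, so
  these singularities are removable, and Liouville's theorem applies to the entire
  extension.\<close>

lemma holomorphic_poly_growth_imp_poly:
  assumes "finite X" "f holomorphic_on (- X)" "\<And>z. z \<notin> X \<Longrightarrow> norm (f z) \<le> B * (1 + norm z) ^ m"
  shows "\<exists>p. degree p \<le> m \<and> (\<forall>z. z \<notin> X \<longrightarrow> poly p z = f z)"
proof -
  have B: "B \<ge> 0"
  proof -
    obtain z where "z \<notin> X" using assms(1) ex_new_if_finite infinite_UNIV_char_0 by blast
    then have "0 \<le> B * (1 + norm z) ^ m" using assms(3) norm_ge_zero order_trans by blast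
    moreover have "(1 + norm z) ^ m > 0" by (intro zero_less_power) (simp add: add_pos_nonneg)
    ultimately show ?thesis by (simp add: zero_le_mult_iff)
  qed
  have "\<exists>g. g holomorphic_on UNIV \<and> (\<forall>z\<in>UNIV - X. g z = f z)"
  proof (rule removable_singularities[OF assms(1)])
    fix z assume z: "z \<in> X"
    define U where "U = ball z 1 - (X - {z})"
    have "open U" using assms(1) unfolding U_def by (intro open_Diff) (auto simp: finite_imp_closed)
    moreover have "z \<in> U" by (simp add: U_def)
    ultimately have ev: "eventually (\<lambda>w. w \<in> U - {z}) (at z)"
      by (auto simp: eventually_at_filter intro: eventually_mono[OF eventually_nhds_in_open])
    show "f \<in> O[at z](\<lambda>_. 1)"
    proof (rule bigoI[of _ "B * (2 + norm z) ^ m"])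
      show "eventually (\<lambda>w. norm (f w) \<le> B * (2 + norm z) ^ m * norm (1::complex)) (at z)"
      proof (rule eventually_mono[OF ev])
        fix w assume w: "w \<in> U - {z}"
        then have "w \<notin> X" "dist z w < 1" by (auto simp: U_def)
        have "norm w \<le> norm z + 1" using \<open>dist z w < 1\<close> norm_triangle_ineq2[of w z]
          by (simp add: dist_norm norm_minus_commute)
        then have "(1 + norm w) ^ m \<le> (2 + norm z) ^ m" by (intro power_mono) auto
        then have "B * (1 + norm w) ^ m \<le> B * (2 + norm z) ^ m" using B by (rule mult_left_mono)
        then show "norm (f w) \<le> B * (2 + norm z) ^ m * norm (1::complex)"
          using assms(3)[OF \<open>w \<notin> X\<close>] by simp
      qed
    qed
  qed (use assms(2) in \<open>auto simp: Compl_eq_Diff_UNIV\<close>)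
  then obtain g where g: "g holomorphic_on UNIV" "\<And>z. z \<notin> X \<Longrightarrow> g z = f z" by blast
  obtain A where A: "\<And>z. z \<in> X \<Longrightarrow> norm z \<le> A"
    using finite_imp_bounded[OF assms(1)] by (auto simp: bounded_iff)
  define p where "p = (\<Sum>k\<le>m. monom ((deriv ^^ k) g 0 / fact k) k)"
  have "poly p z = g z" for z
  proof -
    have "g z = (\<Sum>k\<le>m. (deriv ^^ k) g 0 / fact k * z ^ k)"
    proof (rule Liouville_polynomial[OF g(1), of "max (A + 1) 1" "B * 2 ^ m"])
      fix z :: complex assume z: "max (A + 1) 1 \<le> norm z"
      then have "z \<notin> X" using A by force
      then have "norm (g z) \<le> B * (1 + norm z) ^ m" using assms(3) g(2) by simp
      also have "\<dots> \<le> B * (2 * norm z) ^ m" using z B by (intro mult_left_mono power_mono) auto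
      finally show "norm (g z) \<le> B * 2 ^ m * norm z ^ m" by (simp add: power_mult_distrib)
    qed
    then show ?thesis by (simp add: p_def poly_sum poly_monom)
  qed
  moreover have "degree p \<le> m" unfolding p_def
    by (intro degree_sum_le) (auto intro: order.trans[OF degree_monom_le])
  ultimately show ?thesis using g(2) by (intro exI[of _ p]) simp
qed

lemma prod_norm_le_power:
  fixes f :: "'a \<Rightarrow> complex"
  assumes "\<And>y. y \<in> S \<Longrightarrow> norm (f y) \<le> B"
  shows "norm (\<Prod>y\<in>S. f y) \<le> B ^ card S"
proof -
  have "norm (\<Prod>y\<in>S. f y) = (\<Prod>y\<in>S. norm (f y))" by (rule prod_norm[symmetric])
  also have "\<dots> \<le> (\<Prod>y\<in>S. B)" using assms by (intro prod_mono) auto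
  finally show ?thesis by simp
qed

lemma holomorphic_on_local:
  assumes "\<And>x. x \<in> S \<Longrightarrow> \<exists>A. open A \<and> x \<in> A \<and> f holomorphic_on A"
  shows "f holomorphic_on S"
  unfolding holomorphic_on_def
proof
  fix x assume "x \<in> S"
  then obtain A where "open A" "x \<in> A" "f holomorphic_on A" using assms by blast
  then show "f field_differentiable (at x within S)"
    using holomorphic_on_imp_differentiable_at field_differentiable_at_within by blast
qed

context poly_covering
begin

lemma finite_irregular: "finite (- regular)"
proof -
  have "- regular = (\<Union>v\<in>V. fib v)" by (auto simp: fib_def)
  then show ?thesis using finV finite_fib by simp
qed

lemma path_connected_regular: "path_connected regular"
  using path_connected_complement_countable[of "- regular"] finite_irregular
  by (simp add: countable_finite)

text \<open>A path in the domain is itself the lift of its image.\<close>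

lemma path_push:
  assumes "path c" "path_image c \<subseteq> regular"
  shows "path (\<lambda>s. poly P (c s))" "path_image (\<lambda>s. poly P (c s)) \<subseteq> - V"
    "pathstart (\<lambda>s. poly P (c s)) = poly P (pathstart c)" "pathfinish (\<lambda>s. poly P (c s)) = poly P (pathfinish c)"
    "transport (\<lambda>s. poly P (c s)) (pathstart c) = pathfinish c"
proof -
  show p: "path (\<lambda>s. poly P (c s))" using assms(1) unfolding path_def by (rule continuous_on_poly)
  show i: "path_image (\<lambda>s. poly P (c s)) \<subseteq> - V" using assms(2) by (auto simp: path_image_def)
  show "pathstart (\<lambda>s. poly P (c s)) = poly P (pathstart c)" "pathfinish (\<lambda>s. poly P (c s)) = poly P (pathfinish c)"
    by (simp_all add: pathstart_def pathfinish_def)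
  show "transport (\<lambda>s. poly P (c s)) (pathstart c) = pathfinish c"
    by (rule transport_eq[OF p i assms(1)]) simp
qed

lemma lift_cong:
  assumes "\<And>s. s \<in> {0..1} \<Longrightarrow> \<gamma> s = \<delta> s"
  shows "lift \<gamma> = lift \<delta>"
proof -
  have "(\<forall>s\<in>{0..1}. poly P (h s) = \<gamma> s) \<longleftrightarrow> (\<forall>s\<in>{0..1}. poly P (h s) = \<delta> s)" for h
    using assms by (intro ball_cong) auto
  then show ?thesis unfolding lift_def by simp
qed

lemma transport_cong: "(\<And>s. s \<in> {0..1} \<Longrightarrow> \<gamma> s = \<delta> s) \<Longrightarrow> transport \<gamma> = transport \<delta>"
  unfolding transport_def by (subst lift_cong[of \<gamma> \<delta>]) simp_all

lemma transport_local:
  assumes b: "branches t r I pt br" and i: "i \<in> I"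
    and c: "path \<gamma>" "path_image \<gamma> \<subseteq> ball t r" "pathstart \<gamma> = t"
  shows "transport \<gamma> (pt i) = br i (pathfinish \<gamma>)"
proof -
  have V: "path_image \<gamma> \<subseteq> - V" using b c(2) unfolding branches_def by blast
  have in_ball: "\<gamma> s \<in> ball t r" if "s \<in> {0..1}" for s using c(2) that unfolding path_image_def by blast
  have "continuous_on (ball t r) (br i)"
    using b i by (auto simp: branches_def intro: holomorphic_on_imp_continuous_on)
  then have "path (\<lambda>s. br i (\<gamma> s))"
    using c(1) in_ball unfolding path_def by (intro continuous_on_compose2[of "ball t r" "br i" _ \<gamma>]) auto
  then have "transport \<gamma> (pathstart (\<lambda>s. br i (\<gamma> s))) = pathfinish (\<lambda>s. br i (\<gamma> s))"
    using b i in_ball by (intro transport_eq[OF c(1) V]) (auto simp: branches_def)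
  moreover have "br i t = pt i" using b i by (simp add: branches_def)
  ultimately show ?thesis using c(3) by (simp add: pathstart_def pathfinish_def)
qed

text \<open>A nontrivial block of the monodromy group is moved along paths to every regular point x. The
  product over the block of x, as a function of x, is an entire function of polynomial growth, hence a
  polynomial, and P is a function of it.\<close>

theorem decomposition_if_imprimitive:
  assumes t1: "t1 \<notin> V" and R: "equiv (fib t1) R"
    and inv: "\<And>\<gamma> p q. path \<gamma> \<Longrightarrow> path_image \<gamma> \<subseteq> - V \<Longrightarrow> pathstart \<gamma> = t1 \<Longrightarrow> pathfinish \<gamma> = t1
        \<Longrightarrow> (p, q) \<in> R \<Longrightarrow> (transport \<gamma> p, transport \<gamma> q) \<in> R"
    and nontriv: "R \<noteq> Id_on (fib t1)" "R \<noteq> fib t1 \<times> fib t1"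
  shows "\<exists>A B. degree A \<ge> 2 \<and> degree B \<ge> 2 \<and> P = A \<circ>\<^sub>p B"
proof -
  have Rsub: "R \<subseteq> fib t1 \<times> fib t1" and Rrefl: "\<And>y. y \<in> fib t1 \<Longrightarrow> (y, y) \<in> R"
    and Rsym: "\<And>p q. (p, q) \<in> R \<Longrightarrow> (q, p) \<in> R" and Rtrans: "\<And>p q s. (p, q) \<in> R \<Longrightarrow> (q, s) \<in> R \<Longrightarrow> (p, s) \<in> R"
    using R by (auto simp: equiv_def refl_on_def elim: symE transE)
  obtain x0 x1 where x01: "(x0, x1) \<in> R" "x0 \<noteq> x1"
    using nontriv(1) Rsub Rrefl by (auto simp: Id_on_def)
  define K where "K = R `` {x0}"
  have x0: "x0 \<in> fib t1" "x0 \<in> K" "x1 \<in> K" using x01 Rsub Rrefl by (auto simp: K_def)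
  have KF: "K \<subseteq> fib t1" using Rsub by (auto simp: K_def)
  then have finK: "finite K" using finite_fib finite_subset by blast
  define m where "m = card K"
  have "card {x0, x1} \<le> m" unfolding m_def using x0 by (intro card_mono[OF finK]) auto
  then have m2: "m \<ge> 2" using x01(2) by simp
  have "K \<noteq> fib t1"
  proof
    assume K: "K = fib t1"
    have "(p, q) \<in> R" if "p \<in> fib t1" "q \<in> fib t1" for p q
      using that unfolding K[symmetric] K_def by (blast intro: Rsym Rtrans)
    then show False using nontriv(2) Rsub by auto
  qed
  then obtain z1 where z1: "z1 \<in> fib t1" "z1 \<notin> K" using KF by blast
  \<comment> \<open>The block \<open>K\<close> is carried along with a path from x0 to x in the
    domain of P. Two such paths differ by a loop at t1 whose transport fixes x0 and so preserves
    \<open>K\<close>; the result depends on x alone.\<close>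
  define Bl where "Bl x = {z. \<exists>c y. path c \<and> path_image c \<subseteq> regular \<and> pathstart c = x0 \<and> pathfinish c = x \<and>
      y \<in> K \<and> z = transport (\<lambda>s. poly P (c s)) y}" for x
  have Px0: "poly P x0 = t1" and x0r: "x0 \<in> regular" using x0(1) t1 by (auto simp: fib_def)
  have Bl_eq: "Bl x = transport (\<lambda>s. poly P (c s)) ` K"
    if c: "path c" "path_image c \<subseteq> regular" "pathstart c = x0" "pathfinish c = x" for c x
  proof
    show "transport (\<lambda>s. poly P (c s)) ` K \<subseteq> Bl x" unfolding Bl_def using c by blast
    show "Bl x \<subseteq> transport (\<lambda>s. poly P (c s)) ` K"
    proof
      fix z assume "z \<in> Bl x"
      then obtain d y where d: "path d" "path_image d \<subseteq> regular" "pathstart d = x0" "pathfinish d = x"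
        and y: "y \<in> K" "z = transport (\<lambda>s. poly P (d s)) y" unfolding Bl_def by blast
      let ?c = "\<lambda>s. poly P (c s)" and ?d = "\<lambda>s. poly P (d s)"
      note pc = path_push[OF c(1,2)] and pd = path_push[OF d(1,2)]
      have rc: "path (reversepath ?c)" "path_image (reversepath ?c) \<subseteq> - V" using pc(1,2) by auto
      have yF: "y \<in> fib t1" using y KF by blast
      have jn: "pathfinish ?d = pathstart (reversepath ?c)" using pc(4) pd(4) c(4) d(4) by simp
      have sd: "pathstart ?d = t1" using pd(3) d(3) Px0 by simp
      let ?g = "?d +++ reversepath ?c"
      have loop: "path ?g" "path_image ?g \<subseteq> - V" "pathstart ?g = t1" "pathfinish ?g = t1"
        using pd(1,2) rc jn sd pc(3) c(3) Px0 by (auto simp: path_image_join)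
      have tg: "transport ?g p = transport (reversepath ?c) (transport ?d p)" if "p \<in> fib t1" for p
        by (rule transport_join[OF pd(1,2) rc jn]) (use that sd in simp)
      have "transport ?g x0 = transport (reversepath ?c) x"
        using tg[OF x0(1)] pd(5) d(3,4) by simp
      also have "x = transport ?c x0" using pc(5) c(3,4) by simp
      also have "transport (reversepath ?c) (transport ?c x0) = x0"
        by (rule transport_reverse[OF pc(1,2)]) (use pc(3) c(3) Px0 x0(1) in simp)
      finally have gx0: "transport ?g x0 = x0" .
      have "(transport ?g x0, transport ?g y) \<in> R" using y(1) by (intro inv loop) (simp add: K_def)
      then have gy: "transport ?g y \<in> K" unfolding gx0 by (simp add: K_def)
      have zF: "z \<in> fib (pathstart (reversepath ?c))"
        using transport_in_fib[OF pd(1,2), of y] yF sd y(2) jn by simp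
      have "transport (reversepath (reversepath ?c)) (transport (reversepath ?c) z) = z"
        by (rule transport_reverse[OF rc zF])
      then have "transport ?c (transport ?g y) = z" using tg[OF yF] y(2) by simp
      then show "z \<in> transport ?c ` K" using gy by blast
    qed
  qed
  have path_ex: "\<exists>c. path c \<and> path_image c \<subseteq> regular \<and> pathstart c = x0 \<and> pathfinish c = x" if "x \<in> regular" for x
    using path_connected_regular x0r that unfolding path_connected_def by blast
  have Bl_move: "Bl x' = transport (\<lambda>s. poly P (e s)) ` Bl x"
    if e: "path e" "path_image e \<subseteq> regular" "pathstart e = x" "pathfinish e = x'" for e x x'
  proof -
    have "x \<in> regular" using e(2,3) pathstart_in_path_image by blast
    then obtain c where c: "path c" "path_image c \<subseteq> regular" "pathstart c = x0" "pathfinish c = x" using path_ex by blast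
    note pc = path_push[OF c(1,2)] and pe = path_push[OF e(1,2)]
    have "path (c +++ e)" "path_image (c +++ e) \<subseteq> regular" using c e by (auto simp: path_image_join)
    then have "Bl x' = transport (\<lambda>s. poly P ((c +++ e) s)) ` K" using c(3) e(4) by (intro Bl_eq) auto
    also have "(\<lambda>s. poly P ((c +++ e) s)) = (\<lambda>s. poly P (c s)) +++ (\<lambda>s. poly P (e s))"
      by (auto simp: joinpaths_def)
    also have "transport \<dots> ` K = (\<lambda>y. transport (\<lambda>s. poly P (e s)) (transport (\<lambda>s. poly P (c s)) y)) ` K"
    proof (rule image_cong[OF refl])
      fix y assume "y \<in> K"
      then have "y \<in> fib (pathstart (\<lambda>s. poly P (c s)))" using KF pc(3) c(3) Px0 by auto
      then show "transport ((\<lambda>s. poly P (c s)) +++ (\<lambda>s. poly P (e s))) y = transport (\<lambda>s. poly P (e s)) (transport (\<lambda>s. poly P (c s)) y)"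
        using pc(4) pe(3) c(4) e(3) by (intro transport_join[OF pc(1,2) pe(1,2)]) simp_all
    qed
    also have "\<dots> = transport (\<lambda>s. poly P (e s)) ` Bl x" unfolding Bl_eq[OF c] by (simp add: image_image)
    finally show ?thesis .
  qed
  have Bl_card: "card (Bl x) = m" and Bl_fib: "Bl x \<subseteq> fib (poly P x)" and Bl_self: "x \<in> Bl x" if x: "x \<in> regular" for x
  proof -
    obtain c where c: "path c" "path_image c \<subseteq> regular" "pathstart c = x0" "pathfinish c = x" using path_ex[OF x] by blast
    note pc = path_push[OF c(1,2)]
    have bij: "bij_betw (transport (\<lambda>s. poly P (c s))) (fib t1) (fib (poly P x))"
      using transport_bij[OF pc(1,2)] pc(3,4) c(3,4) Px0 by simp
    then have inj: "inj_on (transport (\<lambda>s. poly P (c s))) K"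
      using KF inj_on_subset unfolding bij_betw_def by blast
    show "card (Bl x) = m" unfolding Bl_eq[OF c] m_def by (rule card_image[OF inj])
    show "Bl x \<subseteq> fib (poly P x)" unfolding Bl_eq[OF c] using KF bij by (auto simp: bij_betw_def)
    show "x \<in> Bl x" unfolding Bl_eq[OF c] using x0(2) pc(5) c(3,4) by (intro image_eqI[of _ _ x0]) simp_all
  qed
  have BlK: "Bl y = K" if y: "y \<in> K" for y
  proof -
    have "y \<in> fib t1" using y KF by blast
    then have yr: "y \<in> regular" "poly P y = t1" using t1 by (auto simp: fib_def)
    obtain d where d: "path d" "path_image d \<subseteq> regular" "pathstart d = x0" "pathfinish d = y" using path_ex[OF yr(1)] by blast
    note pd = path_push[OF d(1,2)]
    have "transport (\<lambda>s. poly P (d s)) p \<in> K" if p: "p \<in> K" for p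
    proof -
      have "(transport (\<lambda>s. poly P (d s)) x0, transport (\<lambda>s. poly P (d s)) p) \<in> R"
        using pd d(3,4) Px0 yr(2) p by (intro inv) (simp_all add: K_def)
      then have "(y, transport (\<lambda>s. poly P (d s)) p) \<in> R" using pd(5) d(3,4) by simp
      moreover have "(x0, y) \<in> R" using y by (simp add: K_def)
      ultimately show ?thesis unfolding K_def by (blast intro: Rtrans)
    qed
    then have "Bl y \<subseteq> K" unfolding Bl_eq[OF d] by blast
    then show ?thesis using Bl_card[OF yr(1)] by (intro card_subset_eq[OF finK]) (simp_all add: m_def)
  qed
  \<comment> \<open>The image of a path from x0 to x has a second lift, from some y in
    \<open>K\<close> to z, and transport along both is the same because they have the same
    image.\<close>
  have Bl_const: "Bl z = Bl x" if x: "x \<in> regular" and z: "z \<in> Bl x" for x z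
  proof -
    obtain c where c: "path c" "path_image c \<subseteq> regular" "pathstart c = x0" "pathfinish c = x" using path_ex[OF x] by blast
    note pc = path_push[OF c(1,2)]
    obtain y where y: "y \<in> K" "z = transport (\<lambda>s. poly P (c s)) y" using z unfolding Bl_eq[OF c] by blast
    have "poly P y = pathstart (\<lambda>s. poly P (c s))" using y(1) KF pc(3) c(3) Px0 by (auto simp: fib_def)
    note L = lift_props[OF pc(1,2) this]
    let ?h = "lift (\<lambda>s. poly P (c s)) y"
    have "path_image ?h \<subseteq> regular" using L(3) c(2) unfolding path_image_def by auto
    moreover have "pathfinish ?h = z" using y(2) by (simp add: transport_def)
    ultimately have "Bl z = transport (\<lambda>s. poly P (?h s)) ` Bl y" using L(1,2) by (intro Bl_move) auto
    also have "transport (\<lambda>s. poly P (?h s)) = transport (\<lambda>s. poly P (c s))" using L(3) by (rule transport_cong)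
    also have "Bl y = K" by (rule BlK[OF y(1)])
    finally show ?thesis unfolding Bl_eq[OF c] .
  qed
  \<comment> \<open>Among the symmetric functions of a block this one vanishes on the block of x0
    and not at z1. The polynomial extending it is thus nonzero with at least m zeros, which makes
    its degree exactly m.\<close>
  define \<beta> where "\<beta> x = (\<Prod>y\<in>Bl x. x0 - y)" for x
  have hol\<beta>: "\<beta> holomorphic_on regular"
  proof (rule holomorphic_on_local)
    fix x assume x: "x \<in> regular"
    define t where "t = poly P x"
    have t: "t \<notin> V" using x by (simp add: t_def)
    obtain r br where b: "branches t r (fib t) (\<lambda>y. y) br"
      using branches_exist[OF t, of "fib t" "\<lambda>y. y"] by (auto simp: fib_def)
    have "open (poly P -` ball t r)" by (intro open_vimage cont) simp
    moreover have "x \<in> poly P -` ball t r" using b by (simp add: t_def branches_def)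
    ultimately obtain \<epsilon> where \<epsilon>: "\<epsilon> > 0" "ball x \<epsilon> \<subseteq> poly P -` ball t r" by (metis openE)
    have bV: "ball t r \<subseteq> - V" using b by (simp add: branches_def)
    have sub: "ball x \<epsilon> \<subseteq> regular" using \<epsilon>(2) bV by blast
    have \<beta>eq: "\<beta> x' = (\<Prod>y\<in>Bl x. x0 - br y (poly P x'))" if x': "x' \<in> ball x \<epsilon>" for x'
    proof -
      let ?e = "linepath x x'"
      have im: "path_image ?e \<subseteq> ball x \<epsilon>" using x' \<epsilon>(1) by (simp add: closed_segment_subset)
      then have e: "path ?e" "path_image ?e \<subseteq> regular" using sub by auto
      note pe = path_push[OF e]
      have "path_image (\<lambda>s. poly P (?e s)) \<subseteq> ball t r" using im \<epsilon>(2) unfolding path_image_def by blast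
      then have tr: "transport (\<lambda>s. poly P (?e s)) y = br y (poly P x')" if "y \<in> fib t" for y
        using transport_local[OF b that pe(1)] pe(3,4) by (simp add: t_def)
      have BF: "Bl x \<subseteq> fib t" unfolding t_def by (rule Bl_fib[OF x])
      have "bij_betw (transport (\<lambda>s. poly P (?e s))) (fib t) (fib (poly P x'))"
        using transport_bij[OF pe(1,2)] pe(3,4) by (simp add: t_def)
      then have inj: "inj_on (transport (\<lambda>s. poly P (?e s))) (Bl x)"
        using BF inj_on_subset unfolding bij_betw_def by blast
      have "Bl x' = transport (\<lambda>s. poly P (?e s)) ` Bl x" using e by (intro Bl_move) simp_all
      then have "\<beta> x' = (\<Prod>y\<in>Bl x. x0 - transport (\<lambda>s. poly P (?e s)) y)"
        unfolding \<beta>_def by (simp add: prod.reindex[OF inj])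
      also have "\<dots> = (\<Prod>y\<in>Bl x. x0 - br y (poly P x'))" using tr BF by (intro prod.cong) auto
      finally show ?thesis .
    qed
    have "(\<lambda>x'. \<Prod>y\<in>Bl x. x0 - br y (poly P x')) holomorphic_on ball x \<epsilon>"
    proof (intro holomorphic_on_prod holomorphic_on_diff holomorphic_on_const)
      fix y assume "y \<in> Bl x"
      then have "br y holomorphic_on ball t r" using b Bl_fib[OF x] by (auto simp: branches_def t_def)
      then show "(\<lambda>x'. br y (poly P x')) holomorphic_on ball x \<epsilon>"
        using holomorphic_on_compose_gen[OF hol, of "br y" "ball t r" "ball x \<epsilon>"] \<epsilon>(2) by (auto simp: o_def)
    qed
    then have "\<beta> holomorphic_on ball x \<epsilon>" by (rule holomorphic_transform) (rule \<beta>eq[symmetric])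
    moreover have "x \<in> ball x \<epsilon>" using \<epsilon>(1) by simp
    ultimately show "\<exists>A. open A \<and> x \<in> A \<and> \<beta> holomorphic_on A"
      using open_ball by metis
  qed
  obtain C where C: "C > 0" "\<And>x y. poly P x = poly P y \<Longrightarrow> norm y \<le> C * (1 + norm x)"
    using poly_same_value_norm_le[OF deg] by blast
  have bound: "norm (\<beta> x) \<le> (norm x0 + C) ^ m * (1 + norm x) ^ m" if x: "x \<in> regular" for x
  proof -
    have "norm (\<beta> x) \<le> ((norm x0 + C) * (1 + norm x)) ^ card (Bl x)"
      unfolding \<beta>_def
    proof (rule prod_norm_le_power)
      fix y assume "y \<in> Bl x"
      then have "norm y \<le> C * (1 + norm x)" using Bl_fib[OF x] C(2)[of x y] by (auto simp: fib_def)
      moreover have "norm x0 \<le> norm x0 * (1 + norm x)" by (simp add: algebra_simps)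
      ultimately show "norm (x0 - y) \<le> (norm x0 + C) * (1 + norm x)"
        using norm_triangle_ineq4[of x0 y] by (simp add: distrib_right)
    qed
    then show ?thesis using Bl_card[OF x] by (simp add: power_mult_distrib)
  qed
  obtain B where B: "degree B \<le> m" "\<And>x. x \<in> regular \<Longrightarrow> poly B x = \<beta> x"
    using holomorphic_poly_growth_imp_poly[OF finite_irregular, of \<beta> "(norm x0 + C) ^ m" m] hol\<beta> bound by auto
  have Bconst: "poly B z = poly B x" if "x \<in> regular" "z \<in> Bl x" for x z
  proof -
    have "z \<in> regular" using Bl_fib[OF that(1)] that by (auto simp: fib_def)
    then show ?thesis using B(2) that(1) Bl_const[OF that] by (simp add: \<beta>_def)
  qed
  have B0: "poly B x0 = 0"
    unfolding B(2)[OF x0r] \<beta>_def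
    using Bl_self[OF x0r] finite_subset[OF Bl_fib[OF x0r] finite_fib] by (intro prod_zero) auto
  have z1r: "z1 \<in> regular" "poly P z1 = t1" using z1(1) t1 by (auto simp: fib_def)
  have "x0 \<notin> Bl z1"
  proof
    assume "x0 \<in> Bl z1"
    then have "Bl x0 = Bl z1" by (rule Bl_const[OF z1r(1)])
    then show False using BlK[OF x0(2)] Bl_self[OF z1r(1)] z1(2) by simp
  qed
  then have B1: "poly B z1 \<noteq> 0"
    unfolding B(2)[OF z1r(1)] \<beta>_def
    using finite_subset[OF Bl_fib[OF z1r(1)] finite_fib] by auto
  have "B \<noteq> 0" using B1 by auto
  have "card (Bl x0) \<le> degree B"
  proof -
    have "Bl x0 \<subseteq> {z. poly B z = 0}" using Bconst[OF x0r] B0 by auto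
    then have "card (Bl x0) \<le> card {z. poly B z = 0}" using poly_roots_finite[OF \<open>B \<noteq> 0\<close>] by (intro card_mono)
    also have "\<dots> \<le> degree B" by (rule card_poly_roots_bound[OF \<open>B \<noteq> 0\<close>])
    finally show ?thesis .
  qed
  then have dB: "degree B = m" using B(1) Bl_card[OF x0r] by simp
  have dB0: "degree B > 0" using dB m2 by simp
  have "infinite (poly B ` regular)"
  proof
    assume fin: "finite (poly B ` regular)"
    have "finite {z. poly B z = c}" for c
    proof -
      have "B - [:c:] \<noteq> 0" using dB0 by (metis degree_pCons_0 eq_iff_diff_eq_0 less_irrefl)
      then show ?thesis using poly_roots_finite[of "B - [:c:]"] by simp
    qed
    then have "finite (\<Union>c\<in>poly B ` regular. {z. poly B z = c})" using fin by blast
    moreover have "regular \<subseteq> (\<Union>c\<in>poly B ` regular. {z. poly B z = c})" by auto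
    ultimately have "finite regular" by (rule finite_subset[rotated])
    then have "finite (regular \<union> - regular)" using finite_irregular by (rule finite_UnI)
    then show False using infinite_UNIV_char_0 by (metis Compl_partition)
  qed
  then have "\<exists>A. P = A \<circ>\<^sub>p B"
  proof (rule poly_comp_if_constant_on_fibres[OF dB0])
    fix \<beta>' assume "\<beta>' \<in> poly B ` regular"
    then obtain x where x: "x \<in> regular" "\<beta>' = poly B x" by blast
    show "\<exists>S c. finite S \<and> card S = degree B \<and> (\<forall>z\<in>S. poly B z = \<beta>' \<and> poly P z = c)"
    proof (intro exI conjI ballI)
      show "finite (Bl x)" using finite_subset[OF Bl_fib[OF x(1)] finite_fib] .
      show "card (Bl x) = degree B" using Bl_card[OF x(1)] dB by simp
      fix z assume z: "z \<in> Bl x"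
      show "poly B z = \<beta>'" using Bconst[OF x(1) z] x(2) by simp
      show "poly P z = poly P x" using Bl_fib[OF x(1)] z by (auto simp: fib_def)
    qed
  qed
  then obtain A where A: "P = A \<circ>\<^sub>p B" by blast
  \<comment> \<open>The block is a proper part of the fibre, so deg A * m = deg P exceeds m and A is
    not linear.\<close>
  have "m < card (fib t1)" unfolding m_def using KF \<open>K \<noteq> fib t1\<close> by (intro psubset_card_mono[OF finite_fib]) auto
  then have "m < degree P" using card_fib[OF t1] by simp
  moreover have "degree P = degree A * m" using A dB degree_pcompose by metis
  ultimately have "degree A \<ge> 2"
  proof -
    have "degree A \<noteq> 0" "degree A \<noteq> 1" using \<open>m < degree P\<close> \<open>degree P = degree A * m\<close> by auto
    then show ?thesis by linarith
  qed
  then show ?thesis using A dB m2 by blast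
qed

end

subsection \<open>The Cauchy transform and the linear relation\<close>

text \<open>The difference of two logarithms of one function is continuous with values in the
  discrete set of periods, hence constant on a connected set.\<close>

lemma exp_eq_imp_integer_shift:
  fixes f g :: "'a :: topological_space \<Rightarrow> complex"
  assumes "connected S" "continuous_on S f" "continuous_on S g" "\<And>x. x \<in> S \<Longrightarrow> exp (f x) = exp (g x)"
  shows "\<exists>k::int. \<forall>x\<in>S. f x = g x + of_int k * (2 * of_real pi * \<i>)"
proof -
  have ex: "\<exists>k::int. f x = g x + of_int k * (2 * of_real pi * \<i>)" if x: "x \<in> S" for x
  proof -
    obtain n :: int where "f x = g x + complex_of_real (real_of_int (2 * n) * pi) * \<i>"
      using assms(4)[OF x] unfolding exp_eq by blast
    then show ?thesis by (intro exI[of _ n]) (simp add: algebra_simps)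
  qed
  then obtain k :: "'a \<Rightarrow> int" where k: "\<And>x. x \<in> S \<Longrightarrow> f x = g x + of_int (k x) * (2 * of_real pi * \<i>)" by metis
  have "(\<lambda>x. f x - g x) constant_on S"
  proof (rule continuous_discrete_range_constant[OF assms(1)])
    show "continuous_on S (\<lambda>x. f x - g x)" using assms by (intro continuous_intros)
    fix x assume x: "x \<in> S"
    show "\<exists>e>0. \<forall>y. y \<in> S \<and> f y - g y \<noteq> f x - g x \<longrightarrow> e \<le> norm (f y - g y - (f x - g x))"
    proof (intro exI[of _ "2 * pi"] conjI allI impI)
      fix y assume y: "y \<in> S \<and> f y - g y \<noteq> f x - g x"
      have eq: "f y - g y - (f x - g x) = of_int (k y - k x) * (2 * of_real pi * \<i>)"
        using k[OF x] k[of y] y by (simp add: algebra_simps)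
      then have "k y - k x \<noteq> 0" using y by auto
      then have "1 \<le> \<bar>real_of_int (k y - k x)\<bar>" by linarith
      then have "1 * (2 * pi) \<le> \<bar>real_of_int (k y - k x)\<bar> * (2 * pi)" by (intro mult_right_mono) auto
      then show "2 * pi \<le> norm (f y - g y - (f x - g x))" unfolding eq norm_mult norm_of_int by simp
    qed simp
  qed
  then obtain c where c: "\<And>x. x \<in> S \<Longrightarrow> f x - g x = c" unfolding constant_on_def by blast
  show ?thesis
  proof (cases "S = {}")
    case False
    then obtain x0 where x0: "x0 \<in> S" by blast
    have "f x = g x + of_int (k x0) * (2 * of_real pi * \<i>)" if "x \<in> S" for x
      using c[OF that] c[OF x0] k[OF x0] by (simp add: algebra_simps)
    then show ?thesis by blast
  qed simp
qed

text \<open>The half-plane lies over a punctured disc at 0 and the strip over a sector, both free of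
  \<open>V\<close>. The strip stays between the heights - pi and pi, so that \<open>Ln\<close>
  inverts exp on it.\<close>

lemma exp_avoids_finite_set:
  assumes "finite (V :: complex set)"
  obtains \<rho> u v where "\<rho> > 0" "- pi < u" "u < v" "v < pi"
    "\<And>\<zeta>. Re \<zeta> < ln \<rho> \<or> (u < Im \<zeta> \<and> Im \<zeta> < v) \<Longrightarrow> exp \<zeta> \<notin> V"
proof -
  obtain \<rho> where \<rho>: "\<rho> > 0" "\<And>c. c \<in> V \<Longrightarrow> c \<noteq> 0 \<Longrightarrow> \<rho> \<le> dist 0 c"
    using finite_set_avoid[OF assms, of 0] by blast
  define A where "A = (\<lambda>c. Im (Ln c)) ` V"
  have "finite A" using assms by (simp add: A_def)
  then have "open ({- pi<..<pi} - A)" by (intro open_Diff) (auto simp: finite_imp_closed)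
  moreover have "infinite ({- pi<..<pi} - A)"
    using \<open>finite A\<close> infinite_Ioo[of "- pi" pi] by (simp add: Diff_infinite_finite)
  then obtain w where w: "w \<in> {- pi<..<pi} - A" by (metis all_not_in_conv infinite_imp_nonempty)
  ultimately obtain e where e: "e > 0" "ball w e \<subseteq> {- pi<..<pi} - A" by (metis openE)
  define u v where "u = w - e / 2" and "v = w + e / 2"
  have "u \<in> ball w e" "v \<in> ball w e" using e(1) by (auto simp: u_def v_def dist_real_def)
  then have "u \<in> {- pi<..<pi}" "v \<in> {- pi<..<pi}" using e(2) by blast+
  then have uv: "- pi < u" "v < pi" "u < v" using e(1) by (auto simp: u_def v_def)
  show ?thesis
  proof (rule that[OF \<rho>(1) uv(1) uv(3) uv(2)])
    fix \<zeta> assume or: "Re \<zeta> < ln \<rho> \<or> (u < Im \<zeta> \<and> Im \<zeta> < v)"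
    show "exp \<zeta> \<notin> V"
    proof
      assume V: "exp \<zeta> \<in> V"
      from or show False
      proof
        assume "Re \<zeta> < ln \<rho>"
        then have "exp (Re \<zeta>) < \<rho>" using \<rho>(1) by (metis exp_less_mono exp_ln)
        then show False using \<rho>(2)[OF V] by (simp add: dist_norm)
      next
        assume im: "u < Im \<zeta> \<and> Im \<zeta> < v"
        then have "Ln (exp \<zeta>) = \<zeta>" using uv by (intro Ln_exp) auto
        then have "Im \<zeta> \<in> A" unfolding A_def using V by (metis imageI)
        moreover have "Im \<zeta> \<in> ball w e" using im e(1) by (auto simp: u_def v_def dist_real_def)
        ultimately show False using e(2) by blast
      qed
    qed
  qed
qed

text \<open>Finite geometric expansion of 1 / (P - t) in powers of P / t with exact remainder: the
  first N terms integrate to 0, and the remainder is bounded by a multiple of 2^(-N).\<close>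

lemma cauchy_transform_eq_0_if_moments_eq_0:
  fixes P R :: "complex poly"
  assumes mom: "\<And>i. contour_integral (linepath a b) (\<lambda>z. poly P z ^ i * poly R z) = 0"
    and t: "t \<noteq> 0" "\<And>z. z \<in> closed_segment a b \<Longrightarrow> 2 * norm (poly P z) \<le> norm t"
  shows "contour_integral (linepath a b) (\<lambda>z. poly R z / (poly P z - t)) = 0"
proof -
  let ?S = "closed_segment a b" and ?L = "linepath a b"
  have nz: "poly P z - t \<noteq> 0" if "z \<in> ?S" for z
    using t(2)[OF that] t(1) by (metis add_le_same_cancel1 eq_iff_diff_eq_0 mult_2 norm_le_zero_iff)
  have cont: "continuous_on ?S (\<lambda>z. poly R z / (poly P z - t))"
    using nz by (intro continuous_intros) auto
  have "compact ((\<lambda>z. poly R z / (poly P z - t)) ` ?S)"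
    by (intro compact_continuous_image cont) auto
  then have "bounded ((\<lambda>z. poly R z / (poly P z - t)) ` ?S)" by (rule compact_imp_bounded)
  then obtain M where M: "\<And>z. z \<in> ?S \<Longrightarrow> norm (poly R z / (poly P z - t)) \<le> M"
    unfolding bounded_iff by blast
  have M0: "M \<ge> 0" using M[of a] by (metis ends_in_segment(1) norm_ge_zero order_trans)
  let ?I = "contour_integral ?L (\<lambda>z. poly R z / (poly P z - t))"
  have bound: "norm ?I \<le> M * norm (b - a) * (1 / 2) ^ N" for N
  proof -
    define f where "f z = (poly P z / t) ^ N * (poly R z / (poly P z - t))" for z
    have cf: "continuous_on ?S f" unfolding f_def using nz t(1) by (intro continuous_intros) auto
    have int_f: "f contour_integrable_on ?L" by (rule contour_integrable_continuous_linepath[OF cf])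
    have int_i: "(\<lambda>z. 1 / t ^ Suc i * (poly P z ^ i * poly R z)) contour_integrable_on ?L" for i
      by (intro contour_integrable_continuous_linepath continuous_intros)
    have "?I = contour_integral ?L (\<lambda>z. f z - (\<Sum>i<N. 1 / t ^ Suc i * (poly P z ^ i * poly R z)))"
    proof (rule contour_integral_cong[OF refl])
      fix z assume "z \<in> path_image ?L"
      then have z: "poly P z - t \<noteq> 0" using nz by simp
      define w where "w = poly P z / t"
      have Pw: "poly P z = w * t" using t(1) by (simp add: w_def)
      have w1: "w - 1 \<noteq> 0" using z t(1) unfolding Pw by (metis diff_self eq_iff_diff_eq_0 mult_1)
      define G where "G = (\<Sum>i<N. w ^ i)"
      have geo: "w ^ N = (w - 1) * G + 1" by (simp add: power_diff_1_eq[symmetric] G_def)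
      have sum_eq: "(\<Sum>i<N. 1 / t ^ Suc i * (poly P z ^ i * poly R z)) = poly R z / t * G"
        using t(1) unfolding G_def sum_distrib_left Pw by (intro sum.cong refl) (simp add: power_mult_distrib)
      have den: "poly P z - t = t * (w - 1)" unfolding Pw by (simp add: algebra_simps)
      show "poly R z / (poly P z - t) = f z - (\<Sum>i<N. 1 / t ^ Suc i * (poly P z ^ i * poly R z))"
        unfolding f_def w_def[symmetric] sum_eq den geo using w1 t(1) by (simp add: field_simps)
    qed
    also have "\<dots> = contour_integral ?L f - (\<Sum>i<N. contour_integral ?L (\<lambda>z. 1 / t ^ Suc i * (poly P z ^ i * poly R z)))"
      using int_f int_i by (subst contour_integral_diff) (auto simp: contour_integral_sum contour_integrable_sum)
    also have "(\<Sum>i<N. contour_integral ?L (\<lambda>z. 1 / t ^ Suc i * (poly P z ^ i * poly R z))) = 0"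
    proof (rule sum.neutral, intro ballI)
      fix i
      have "contour_integral ?L (\<lambda>z. 1 / t ^ Suc i * (poly P z ^ i * poly R z))
          = 1 / t ^ Suc i * contour_integral ?L (\<lambda>z. poly P z ^ i * poly R z)"
        by (intro contour_integral_lmul contour_integrable_continuous_linepath continuous_intros)
      then show "contour_integral ?L (\<lambda>z. 1 / t ^ Suc i * (poly P z ^ i * poly R z)) = 0" using mom by simp
    qed
    finally have eq: "?I = contour_integral ?L f" by simp
    have "norm (contour_integral ?L f) \<le> ((1 / 2) ^ N * M) * norm (b - a)"
    proof (rule contour_integral_bound_linepath[OF int_f])
      show "0 \<le> (1 / 2) ^ N * M" using M0 by simp
      fix z assume z: "z \<in> ?S"
      have "norm (poly P z / t) \<le> 1 / 2" using t(2)[OF z] t(1) by (simp add: norm_divide field_simps)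
      then have "norm (poly P z / t) ^ N \<le> (1 / 2) ^ N" by (intro power_mono) auto
      then show "norm (f z) \<le> (1 / 2) ^ N * M"
        unfolding f_def norm_mult norm_power using M[OF z] M0 by (intro mult_mono) auto
    qed
    then show ?thesis unfolding eq by (simp add: mult_ac)
  qed
  have "(\<lambda>N. M * norm (b - a) * (1 / 2) ^ N) \<longlonglongrightarrow> M * norm (b - a) * 0"
    by (intro tendsto_mult tendsto_const LIMSEQ_realpow_zero) auto
  then have "norm ?I \<le> M * norm (b - a) * 0"
    using bound by (intro LIMSEQ_le_const) auto
  then show ?thesis by simp
qed

text \<open>The primitive in \<open>z\<close>, vanishing at 0, of the difference quotient of
  \<open>Q\<close> at \<open>x\<close> and \<open>z\<close>, written out as a polynomial in both
  variables.\<close>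

definition quot_int :: "complex poly \<Rightarrow> complex \<Rightarrow> complex \<Rightarrow> complex" where
  "quot_int Q x z = (\<Sum>k\<le>degree Q. \<Sum>i<k. coeff Q k * x ^ (k - Suc i) * (z ^ Suc i / of_nat (Suc i)))"

lemma quot_int_holomorphic: "(\<lambda>x. quot_int Q x z) holomorphic_on S"
  unfolding quot_int_def by (intro holomorphic_intros)

lemma DERIV_quot_int:
  assumes "z \<noteq> x"
  shows "(quot_int Q x has_field_derivative (poly Q z - poly Q x) / (z - x)) (at z)"
proof -
  have p: "((\<lambda>z. z ^ Suc i / of_nat (Suc i)) has_field_derivative z ^ i) (at z)" for i
  proof -
    have "((\<lambda>z. z ^ Suc i) has_field_derivative of_nat (Suc i) * z ^ i) (at z)"
      using DERIV_power[OF DERIV_ident, of "Suc i" z UNIV] by simp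
    then have "((\<lambda>z. z ^ Suc i / of_nat (Suc i)) has_field_derivative (of_nat (Suc i) * z ^ i) / of_nat (Suc i)) (at z)"
      by (rule DERIV_cdivide)
    then show ?thesis by (simp del: of_nat_Suc)
  qed
  have d: "(quot_int Q x has_field_derivative (\<Sum>k\<le>degree Q. \<Sum>i<k. coeff Q k * x ^ (k - Suc i) * z ^ i)) (at z)"
    unfolding quot_int_def[abs_def] by (intro DERIV_sum DERIV_cmult p)
  have "(\<Sum>k\<le>degree Q. \<Sum>i<k. coeff Q k * x ^ (k - Suc i) * z ^ i) * (z - x)
     = (\<Sum>k\<le>degree Q. coeff Q k * ((z - x) * (\<Sum>i<k. x ^ (k - Suc i) * z ^ i)))"
    by (simp add: sum_distrib_right sum_distrib_left mult_ac)
  also have "\<dots> = (\<Sum>k\<le>degree Q. coeff Q k * (z ^ k - x ^ k))"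
    by (simp only: power_diff_sumr2)
  also have "\<dots> = poly Q z - poly Q x" by (simp add: poly_altdef right_diff_distrib sum_subtractf)
  finally have "(\<Sum>k\<le>degree Q. \<Sum>i<k. coeff Q k * x ^ (k - Suc i) * z ^ i) = (poly Q z - poly Q x) / (z - x)"
    using assms by (simp add: field_simps)
  then show ?thesis using d by simp
qed

context poly_covering
begin

lemma log_derivative_fib:
  assumes "t \<notin> V" "poly P z \<noteq> t"
  shows "poly (pderiv P) z / (poly P z - t) = (\<Sum>x\<in>fib t. 1 / (z - x))"
proof -
  let ?p = "P - [:t:]"
  have "rsquarefree ?p" unfolding rsquarefree_roots
    using crit assms(1) by (auto simp: pderiv_diff pderiv_pCons)
  then have "smult (lead_coeff ?p) (\<Prod>z|poly ?p z = 0. [:- z, 1:]) = ?p"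
    by (rule complex_poly_decompose_rsquarefree)
  moreover have "{z. poly ?p z = 0} = fib t" by (simp add: fib_def)
  ultimately obtain l where l: "?p = smult l (\<Prod>x\<in>fib t. [:- x, 1:])" by metis
  have val: "poly P z - t = l * (\<Prod>x\<in>fib t. z - x)"
  proof -
    have "poly P z - t = poly ?p z" by simp
    then show ?thesis unfolding l by (simp add: poly_prod)
  qed
  have nz: "z - x \<noteq> 0" if "x \<in> fib t" for x using that assms(2) by (auto simp: fib_def)
  have "pderiv P = pderiv ?p" by (simp add: pderiv_diff pderiv_pCons)
  then have "poly (pderiv P) z = l * (\<Sum>x\<in>fib t. \<Prod>y\<in>fib t - {x}. z - y)"
    unfolding l by (simp add: pderiv_smult pderiv_prod poly_sum poly_prod pderiv_pCons)
  also have "\<dots> = (\<Sum>x\<in>fib t. (poly P z - t) / (z - x))"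
    unfolding sum_distrib_left
  proof (rule sum.cong[OF refl])
    fix x assume x: "x \<in> fib t"
    have "(\<Prod>x\<in>fib t. z - x) = (z - x) * (\<Prod>y\<in>fib t - {x}. z - y)"
      by (rule prod.remove[OF finite_fib x])
    then show "l * (\<Prod>y\<in>fib t - {x}. z - y) = (poly P z - t) / (z - x)"
      unfolding val using nz[OF x] by simp
  qed
  finally show ?thesis using assms(2) by (simp add: sum_divide_distrib)
qed

text \<open>In each partial fraction Q(z) / (z - x) the numerator is split into Q(z) - Q(x), which
  cancels the pole, and the constant Q(x). As x lies farther out than a and b, 1 - z / x has
  positive real part on the segment, and the principal logarithm is a primitive there.\<close>

lemma cauchy_transform_eq_log_sum:
  assumes t: "t \<notin> V" and far: "\<And>x. x \<in> fib t \<Longrightarrow> norm x > norm a \<and> norm x > norm b"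
  shows "contour_integral (linepath a b) (\<lambda>z. poly (Q * pderiv P) z / (poly P z - t)) =
    (\<Sum>x\<in>fib t. quot_int Q x b - quot_int Q x a + poly Q x * (Ln (1 - b / x) - Ln (1 - a / x)))"
proof -
  define F where "F z = (\<Sum>x\<in>fib t. quot_int Q x z + poly Q x * Ln (1 - z / x))" for z
  have "(F has_field_derivative poly (Q * pderiv P) z / (poly P z - t)) (at z within closed_segment a b)"
    if z: "z \<in> closed_segment a b" for z
  proof -
    have nz: "norm z < norm x" if "x \<in> fib t" for x
    proof -
      have "closed_segment a b \<subseteq> ball 0 (norm x)"
        using far[OF that] by (intro closed_segment_subset) auto
      then show ?thesis using z by auto
    qed
    have Pz: "poly P z \<noteq> t" using nz[of z] by (auto simp: fib_def)
    have "(F has_field_derivative (\<Sum>x\<in>fib t. (poly Q z - poly Q x) / (z - x) + poly Q x * (1 / (z - x)))) (at z)"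
      unfolding F_def[abs_def]
    proof (intro DERIV_sum DERIV_add DERIV_cmult)
      fix x assume x: "x \<in> fib t"
      have xz: "z \<noteq> x" "x \<noteq> 0" using nz[OF x] by auto
      show "(quot_int Q x has_field_derivative (poly Q z - poly Q x) / (z - x)) (at z)"
        by (rule DERIV_quot_int[OF xz(1)])
      have "norm (z / x) < 1" using nz[OF x] xz by (simp add: norm_divide)
      then have "Re (z / x) < 1" using complex_Re_le_cmod[of "z / x"] by linarith
      then have "1 - z / x \<notin> \<real>\<^sub>\<le>\<^sub>0" by (auto simp: complex_nonpos_Reals_iff)
      then show "((\<lambda>z. Ln (1 - z / x)) has_field_derivative 1 / (z - x)) (at z)"
        using xz by (auto intro!: derivative_eq_intros simp: field_simps)
    qed
    also have "(\<Sum>x\<in>fib t. (poly Q z - poly Q x) / (z - x) + poly Q x * (1 / (z - x)))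
        = poly Q z * (\<Sum>x\<in>fib t. 1 / (z - x))"
      unfolding sum_distrib_left by (intro sum.cong refl) (simp add: diff_divide_distrib)
    also have "\<dots> = poly (Q * pderiv P) z / (poly P z - t)"
      unfolding log_derivative_fib[OF t Pz, symmetric] by simp
    finally show ?thesis by (rule has_field_derivative_at_within)
  qed
  then have "((\<lambda>z. poly (Q * pderiv P) z / (poly P z - t)) has_contour_integral
      (F (pathfinish (linepath a b)) - F (pathstart (linepath a b)))) (linepath a b)"
    by (intro contour_integral_primitive[of "closed_segment a b"]) auto
  then have "contour_integral (linepath a b) (\<lambda>z. poly (Q * pderiv P) z / (poly P z - t)) = F b - F a"
    by (simp add: contour_integral_unique)
  also have "\<dots> = (\<Sum>x\<in>fib t. quot_int Q x b - quot_int Q x a + poly Q x * (Ln (1 - b / x) - Ln (1 - a / x)))"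
    unfolding F_def by (simp add: sum_subtractf[symmetric] algebra_simps)
  finally show ?thesis .
qed


section \<open>Continuation in the coordinate \<zeta> with t = exp \<zeta>\<close>

lemma continuous_lift_holomorphic:
  assumes S: "open S" and g: "continuous_on S g" and f: "f holomorphic_on S"
    and Pg: "\<And>s. s \<in> S \<Longrightarrow> poly P (g s) = f s" and V: "\<And>s. s \<in> S \<Longrightarrow> f s \<notin> V"
  shows "g holomorphic_on S"
proof (rule holomorphic_on_local)
  fix s assume s: "s \<in> S"
  have "poly P (g s) \<notin> V" using Pg[OF s] V[OF s] by simp
  then obtain r h where h: "0 < r" "h holomorphic_on (poly P ` ball (g s) r)"
    "\<And>z. z \<in> ball (g s) r \<Longrightarrow> h (poly P z) = z"
    using poly_local_inverse[of "g s" 1] by (metis zero_less_one)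
  define N where "N = S \<inter> g -` ball (g s) r"
  have "open N" unfolding N_def by (rule continuous_open_preimage[OF g S open_ball])
  moreover have "s \<in> N" using s h(1) by (simp add: N_def)
  moreover have "g holomorphic_on N"
  proof -
    have "(h \<circ> f) holomorphic_on N"
    proof (rule holomorphic_on_compose_gen[OF _ h(2)])
      show "f holomorphic_on N" using f by (rule holomorphic_on_subset) (simp add: N_def)
      show "f ` N \<subseteq> poly P ` ball (g s) r" using Pg by (force simp: N_def)
    qed
    then show ?thesis
    proof (rule holomorphic_transform)
      fix x assume x: "x \<in> N"
      then have "(h \<circ> f) x = h (poly P (g x))" using Pg by (simp add: N_def)
      then show "(h \<circ> f) x = g x" using h(3) x by (simp add: N_def)
    qed
  qed
  ultimately show "\<exists>A. open A \<and> s \<in> A \<and> g holomorphic_on A" by blast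
qed

abbreviation "lhp (c::real) \<equiv> {\<zeta>. Re \<zeta> < c}"

text \<open>The translates of a lift by multiples of the period take values in a finite fibre at one
  point, so two of them coincide there and hence everywhere. The product of the resulting periods
  serves all lifts at once.\<close>

lemma exp_lift_periodic:
  assumes F: "finite F" and V: "\<And>\<zeta>. \<zeta> \<in> lhp c \<Longrightarrow> exp \<zeta> \<notin> V"
    and z: "\<And>y. y \<in> F \<Longrightarrow> continuous_on (lhp c) (z y)" "\<And>y \<zeta>. y \<in> F \<Longrightarrow> \<zeta> \<in> lhp c \<Longrightarrow> poly P (z y \<zeta>) = exp \<zeta>"
  shows "\<exists>N>0. \<forall>y\<in>F. \<forall>\<zeta>\<in>lhp c. z y (\<zeta> + of_nat N * (2 * of_real pi * \<i>)) = z y \<zeta>"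
proof -
  let ?\<tau> = "2 * of_real pi * \<i>"
  have sh: "\<zeta> + of_nat i * ?\<tau> \<in> lhp c \<longleftrightarrow> \<zeta> \<in> lhp c" "\<zeta> - of_nat i * ?\<tau> \<in> lhp c \<longleftrightarrow> \<zeta> \<in> lhp c" for \<zeta> and i :: nat
    by auto
  have ex: "exp (\<zeta> + of_nat i * ?\<tau>) = exp \<zeta>" for \<zeta> and i :: nat
    by (simp add: exp_add exp_of_nat_mult exp_two_pi_i)
  have con: "connected (lhp c)" by (intro convex_connected convex_halfspace_Re_lt)
  have per: "\<exists>N>0. \<forall>\<zeta>\<in>lhp c. z y (\<zeta> + of_nat N * ?\<tau>) = z y \<zeta>" if y: "y \<in> F" for y
  proof -
    define \<zeta>0 where "\<zeta>0 = complex_of_real (c - 1)"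
    have \<zeta>0: "\<zeta>0 \<in> lhp c" by (simp add: \<zeta>0_def)
    have "range (\<lambda>i::nat. z y (\<zeta>0 + of_nat i * ?\<tau>)) \<subseteq> fib (exp \<zeta>0)"
      using z(2)[OF y] sh(1)[of \<zeta>0] \<zeta>0 ex[of \<zeta>0] by (auto simp: fib_def)
    then have "finite (range (\<lambda>i::nat. z y (\<zeta>0 + of_nat i * ?\<tau>)))" using finite_fib finite_subset by blast
    then have "\<not> inj (\<lambda>i::nat. z y (\<zeta>0 + of_nat i * ?\<tau>))" using finite_imageD infinite_UNIV_nat by blast
    then obtain i j where ij: "i < j" "z y (\<zeta>0 + of_nat i * ?\<tau>) = z y (\<zeta>0 + of_nat j * ?\<tau>)"
      unfolding inj_def by (metis linorder_neqE_nat)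
    have cs: "continuous_on (lhp c) (\<lambda>\<zeta>. z y (\<zeta> + of_nat i * ?\<tau>))" for i :: nat
      by (rule continuous_on_compose2[OF z(1)[OF y]]) (auto intro!: continuous_intros)
    have Pl: "poly P (z y (\<xi> + of_nat l * ?\<tau>)) = exp \<xi>" if "\<xi> \<in> lhp c" for \<xi> and l :: nat
      using z(2)[OF y, of "\<xi> + of_nat l * ?\<tau>"] sh(1)[of \<xi> l] ex[of \<xi> l] that by metis
    have eq: "z y (\<zeta> + of_nat i * ?\<tau>) = z y (\<zeta> + of_nat j * ?\<tau>)" if \<zeta>: "\<zeta> \<in> lhp c" for \<zeta>
    proof (rule continuous_lift_unique[OF con cs cs, where f = exp and a = \<zeta>0])
      show "exp ` lhp c \<subseteq> - V" using V by blast
    qed (use \<zeta>0 \<zeta> ij Pl in simp_all)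
    have "z y (\<zeta> + of_nat (j - i) * ?\<tau>) = z y \<zeta>" if \<zeta>: "\<zeta> \<in> lhp c" for \<zeta>
    proof -
      have "z y (\<zeta> - of_nat i * ?\<tau> + of_nat i * ?\<tau>) = z y (\<zeta> - of_nat i * ?\<tau> + of_nat j * ?\<tau>)"
        by (rule eq) (use sh \<zeta> in blast)
      moreover have "\<zeta> - of_nat i * ?\<tau> + of_nat j * ?\<tau> = \<zeta> + of_nat (j - i) * ?\<tau>"
        using ij(1) by (simp add: of_nat_diff algebra_simps)
      ultimately show ?thesis by simp
    qed
    then show ?thesis using ij(1) by (intro exI[of _ "j - i"]) auto
  qed
  then obtain N where N: "\<And>y. y \<in> F \<Longrightarrow> N y > (0::nat)"
    "\<And>y \<zeta>. y \<in> F \<Longrightarrow> \<zeta> \<in> lhp c \<Longrightarrow> z y (\<zeta> + of_nat (N y) * ?\<tau>) = z y \<zeta>" by metis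
  have mult: "z y (\<zeta> + of_nat (l * N y) * ?\<tau>) = z y \<zeta>" if y: "y \<in> F" and \<zeta>: "\<zeta> \<in> lhp c" for y \<zeta> l
  proof (induction l)
    case (Suc l)
    have "\<zeta> + of_nat (Suc l * N y) * ?\<tau> = (\<zeta> + of_nat (l * N y) * ?\<tau>) + of_nat (N y) * ?\<tau>"
      by (simp add: algebra_simps)
    then show ?case using N(2)[OF y, of "\<zeta> + of_nat (l * N y) * ?\<tau>"] sh(1) \<zeta> Suc by metis
  qed simp
  have "z y (\<zeta> + of_nat (prod N F) * ?\<tau>) = z y \<zeta>" if "y \<in> F" "\<zeta> \<in> lhp c" for y \<zeta>
  proof -
    have "prod N F = prod N (F - {y}) * N y" using F that(1) by (subst prod.remove[of F y]) (auto simp: mult.commute)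
    then show ?thesis using mult[OF that, of "prod N (F - {y})"] by (simp only:)
  qed
  moreover have "prod N F > 0" using N(1) by (simp add: prod_pos)
  ultimately show ?thesis by (intro exI[of _ "prod N F"]) blast
qed

text \<open>A branch z with z tending to a satisfies (z - a)^d g(z) = exp \<zeta> with g(a) nonzero, so that
  d L + \<zeta> is a single-valued function of z.\<close>

lemma winding_negative:
  fixes k :: "'i \<Rightarrow> int"
  assumes ab: "a \<noteq> b" and Pa: "poly P a = 0" and N: "N > 0"
    and z: "\<And>y. y \<in> F \<Longrightarrow> continuous_on (lhp c) (z y)" "\<And>y \<zeta>. y \<in> F \<Longrightarrow> \<zeta> \<in> lhp c \<Longrightarrow> poly P (z y \<zeta>) = exp \<zeta>"
    and cover: "\<And>\<zeta> x. \<zeta> \<in> lhp c \<Longrightarrow> poly P x = exp \<zeta> \<Longrightarrow> \<exists>y\<in>F. x = z y \<zeta>"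
    and per: "\<And>y \<zeta>. y \<in> F \<Longrightarrow> \<zeta> \<in> lhp c \<Longrightarrow> z y (\<zeta> + of_nat N * (2 * of_real pi * \<i>)) = z y \<zeta>"
    and L: "\<And>y. y \<in> F \<Longrightarrow> continuous_on (lhp c) (L y)"
      "\<And>y \<zeta>. y \<in> F \<Longrightarrow> \<zeta> \<in> lhp c \<Longrightarrow> exp (L y \<zeta>) = (z y \<zeta> - b) / (z y \<zeta> - a)"
      "\<And>y \<zeta>. y \<in> F \<Longrightarrow> \<zeta> \<in> lhp c \<Longrightarrow> L y (\<zeta> + of_nat N * (2 * of_real pi * \<i>)) = L y \<zeta> + of_int (k y) * (2 * of_real pi * \<i>)"
  shows "\<exists>y\<in>F. k y < 0"
proof -
  let ?\<tau> = "2 * of_real pi * \<i>"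
  have P0: "P \<noteq> 0" using deg by auto
  define d where "d = order a P"
  have d: "d > 0" using P0 Pa by (simp add: d_def order_root)
  obtain g where g: "P = [:- a, 1:] ^ d * g" "\<not> [:- a, 1:] dvd g"
    using order_decomp[OF P0] unfolding d_def by blast
  have ga: "poly g a \<noteq> 0" using g(2) by (simp add: poly_eq_0_iff_dvd)
  have Pg: "poly P x = (x - a) ^ d * poly g x" for x unfolding g(1) by (simp add: poly_power)
  \<comment> \<open>At x = z y \<zeta> the exponential of d L + \<zeta> is ((x - b) / (x - a))^d
    P(x) = H(x), and H has no zero at a.\<close>
  define H where "H x = (x - b) ^ d * poly g x" for x
  have Ha: "H a \<noteq> 0" using ga ab by (simp add: H_def)
  have contH: "continuous_on UNIV H" unfolding H_def by (intro continuous_intros)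
  then obtain \<delta> where \<delta>: "\<delta> > 0" "\<And>x. dist x a < \<delta> \<Longrightarrow> dist (H x) (H a) < norm (H a)"
    using Ha unfolding continuous_on_iff by (metis UNIV_I zero_less_norm_iff)
  define \<epsilon> where "\<epsilon> = \<delta> / 2"
  have \<epsilon>: "\<epsilon> > 0" "\<epsilon> < \<delta>" using \<delta> by (auto simp: \<epsilon>_def)
  have Psph: "poly P x \<noteq> 0" if "x \<in> sphere a \<epsilon>" for x
  proof -
    have "dist x a < \<delta>" using that \<epsilon> by (simp add: dist_commute)
    then have "H x \<noteq> 0" using \<delta>(2)[of x] by auto
    then have "poly g x \<noteq> 0" by (auto simp: H_def)
    moreover have "x \<noteq> a" using that \<epsilon> by auto
    ultimately show ?thesis by (simp add: Pg)
  qed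
  have "compact (sphere a \<epsilon>)" "sphere a \<epsilon> \<noteq> {}" using \<epsilon> by auto
  from continuous_attains_inf[OF this continuous_on_norm[OF cont]]
  obtain x0 where x0: "x0 \<in> sphere a \<epsilon>" "\<And>x. x \<in> sphere a \<epsilon> \<Longrightarrow> norm (poly P x0) \<le> norm (poly P x)"
    by blast
  define r0 where "r0 = norm (poly P x0)"
  have r0: "r0 > 0" using Psph[OF x0(1)] by (simp add: r0_def)
  have "\<not> poly P constant_on UNIV"
  proof
    assume "poly P constant_on UNIV"
    then have "fib (poly P a) = UNIV" by (auto simp: fib_def constant_on_def)
    then show False using finite_fib[of "poly P a"] infinite_UNIV_char_0 by metis
  qed
  then have "open (poly P ` ball a \<epsilon>)"
    by (intro open_mapping_thm[OF hol[of UNIV]]) auto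
  moreover have "0 \<in> poly P ` ball a \<epsilon>" using Pa \<epsilon>(1) by (metis centre_in_ball imageI)
  ultimately obtain r1 where r1: "r1 > 0" "ball 0 r1 \<subseteq> poly P ` ball a \<epsilon>" by (metis openE)
  \<comment> \<open>To the left of ln r0 the value exp \<zeta> is smaller than P on the circle of
    radius \<epsilon>, so a branch that is inside the circle once can never cross it.\<close>
  define c' where "c' = min c (ln r0)"
  have small: "norm (exp \<zeta>) < r0" "\<zeta> \<in> lhp c" if "\<zeta> \<in> lhp c'" for \<zeta>
  proof -
    have "exp (Re \<zeta>) < exp (ln r0)" using that by (simp add: c'_def del: exp_ln)
    then show "norm (exp \<zeta>) < r0" using r0 by simp
    show "\<zeta> \<in> lhp c" using that by (simp add: c'_def)
  qed
  \<comment> \<open>Far enough to the left for exp \<zeta>0 to be a value of P inside the disc; this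
    supplies a branch near a.\<close>
  define \<zeta>0 where "\<zeta>0 = complex_of_real (min c' (ln r1) - 1)"
  have \<zeta>0: "\<zeta>0 \<in> lhp c'" by (simp add: \<zeta>0_def)
  have "exp (Re \<zeta>0) < exp (ln r1)" by (simp add: \<zeta>0_def del: exp_ln)
  then have "exp \<zeta>0 \<in> ball 0 r1" using r1 by simp
  then obtain x where x: "x \<in> ball a \<epsilon>" "poly P x = exp \<zeta>0" using r1(2) by (metis imageE subsetD)
  then obtain y where y: "y \<in> F" "x = z y \<zeta>0" using cover small(2)[OF \<zeta>0] by blast
  have con: "connected (lhp c')" by (intro convex_connected convex_halfspace_Re_lt)
  have sub: "lhp c' \<subseteq> lhp c" using small(2) by blast
  have contz: "continuous_on (lhp c') (z y)" using z(1)[OF y(1)] sub by (rule continuous_on_subset)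
  have near: "z y \<zeta> \<in> ball a \<epsilon>" if \<zeta>: "\<zeta> \<in> lhp c'" for \<zeta>
  proof (rule ccontr)
    assume "z y \<zeta> \<notin> ball a \<epsilon>"
    then have "z y ` lhp c' - ball a \<epsilon> \<noteq> {}" using \<zeta> by blast
    moreover have "z y ` lhp c' \<inter> ball a \<epsilon> \<noteq> {}" using x(1) y(2) \<zeta>0 by blast
    moreover have "connected (z y ` lhp c')" using contz con by (rule connected_continuous_image)
    ultimately have "z y ` lhp c' \<inter> frontier (ball a \<epsilon>) \<noteq> {}" by (intro connected_Int_frontier)
    then have "z y ` lhp c' \<inter> sphere a \<epsilon> \<noteq> {}" unfolding frontier_ball[OF \<epsilon>(1)] .
    then obtain \<xi> where \<xi>: "\<xi> \<in> lhp c'" "z y \<xi> \<in> sphere a \<epsilon>" by blast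
    have "r0 \<le> norm (exp \<xi>)" using x0(2)[OF \<xi>(2)] z(2)[OF y(1) small(2)[OF \<xi>(1)]] by (simp add: r0_def)
    then show False using small(1)[OF \<xi>(1)] by simp
  qed
  define M where "M \<zeta> = of_nat d * L y \<zeta> + \<zeta>" for \<zeta>
  \<comment> \<open>Dividing by H a brings the argument within distance 1 of 1 and so off the cut of
    \<open>Ln\<close>.\<close>
  define \<Lambda> where "\<Lambda> \<zeta> = Ln (H (z y \<zeta>) / H a) + Ln (H a)" for \<zeta>
  have nonpos: "H (z y \<zeta>) / H a \<notin> \<real>\<^sub>\<le>\<^sub>0" "H (z y \<zeta>) \<noteq> 0" if "\<zeta> \<in> lhp c'" for \<zeta>
  proof -
    have "dist (z y \<zeta>) a < \<delta>" using near[OF that] \<epsilon> by (simp add: dist_commute)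
    then have lt: "norm (H (z y \<zeta>) - H a) < norm (H a)" using \<delta>(2) by (simp add: dist_norm)
    have "H (z y \<zeta>) / H a - 1 = (H (z y \<zeta>) - H a) / H a" using Ha by (simp add: field_simps)
    then have "norm (H (z y \<zeta>) / H a - 1) < 1" using lt Ha by (simp add: norm_divide)
    then have "Re (1 - H (z y \<zeta>) / H a) < 1"
      using complex_Re_le_cmod[of "1 - H (z y \<zeta>) / H a"] by (simp add: norm_minus_commute)
    then show "H (z y \<zeta>) / H a \<notin> \<real>\<^sub>\<le>\<^sub>0" by (auto simp: complex_nonpos_Reals_iff)
    show "H (z y \<zeta>) \<noteq> 0" using lt by auto
  qed
  have "\<exists>l::int. \<forall>\<zeta>\<in>lhp c'. M \<zeta> = \<Lambda> \<zeta> + of_int l * ?\<tau>"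
  proof (rule exp_eq_imp_integer_shift[OF con])
    show "continuous_on (lhp c') M" unfolding M_def
      using L(1)[OF y(1)] sub by (intro continuous_intros) (rule continuous_on_subset)
    have "continuous_on (lhp c') (\<lambda>\<zeta>. H (z y \<zeta>))"
      using continuous_on_compose2[OF contH contz] by simp
    then show "continuous_on (lhp c') \<Lambda>" unfolding \<Lambda>_def
      using nonpos(1) Ha by (intro continuous_intros) auto
    fix \<zeta> assume \<zeta>: "\<zeta> \<in> lhp c'"
    have Pz: "(z y \<zeta> - a) ^ d * poly g (z y \<zeta>) = exp \<zeta>"
      using z(2)[OF y(1) small(2)[OF \<zeta>]] Pg by simp
    then have za: "z y \<zeta> - a \<noteq> 0" using d by (metis exp_not_eq_zero mult_zero_left zero_power)
    have "exp (M \<zeta>) = exp (L y \<zeta>) ^ d * exp \<zeta>" by (simp add: M_def exp_add exp_of_nat_mult)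
    also have "\<dots> = ((z y \<zeta> - b) / (z y \<zeta> - a)) ^ d * ((z y \<zeta> - a) ^ d * poly g (z y \<zeta>))"
      unfolding Pz L(2)[OF y(1) small(2)[OF \<zeta>]] ..
    also have "\<dots> = H (z y \<zeta>)" using za by (simp add: H_def power_divide)
    also have "\<dots> = exp (\<Lambda> \<zeta>)" using Ha nonpos(2)[OF \<zeta>] by (simp add: \<Lambda>_def exp_add)
    finally show "exp (M \<zeta>) = exp (\<Lambda> \<zeta>)" .
  qed
  then obtain l :: int where l: "\<And>\<zeta>. \<zeta> \<in> lhp c' \<Longrightarrow> M \<zeta> = \<Lambda> \<zeta> + of_int l * ?\<tau>" by blast
  have sh: "\<zeta>0 + of_nat N * ?\<tau> \<in> lhp c'" using \<zeta>0 by simp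
  \<comment> \<open>\<Lambda> depends only on the value of the branch, which returns after
    \<open>N\<close> periods, while the definition of M makes it grow by d k + N periods. Hence d k
    + N = 0.\<close>
  have "M (\<zeta>0 + of_nat N * ?\<tau>) = M \<zeta>0"
    unfolding l[OF sh] l[OF \<zeta>0] \<Lambda>_def per[OF y(1) small(2)[OF \<zeta>0]] ..
  then have "of_nat d * (of_int (k y) * ?\<tau>) + of_nat N * ?\<tau> = 0"
    unfolding M_def L(3)[OF y(1) small(2)[OF \<zeta>0]] by (simp add: algebra_simps)
  then have "(of_nat d * of_int (k y) + of_nat N) * ?\<tau> = 0" by (simp add: algebra_simps)
  then have "of_nat d * of_int (k y) + of_nat N = (0::complex)" by simp
  then have "of_int (int d * k y + int N) = (0::complex)" by simp
  then have "int d * k y + int N = 0" by (simp only: of_int_eq_0_iff)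
  then have "int d * k y < 0" using N by linarith
  then have "k y < 0" using d by (simp add: mult_less_0_iff)
  then show ?thesis using y(1) by blast
qed

end

lemma starlike_Un_convex:
  assumes "convex A" "convex B" "x \<in> A" "x \<in> B"
  shows "starlike (A \<union> B)"
  unfolding starlike_def
proof (intro bexI[of _ x] ballI)
  fix y assume "y \<in> A \<union> B"
  then show "closed_segment x y \<subseteq> A \<union> B"
    using closed_segment_subset[OF assms(3) _ assms(1)] closed_segment_subset[OF assms(4) _ assms(2)] by blast
qed (use assms in auto)

context poly_covering
begin

text \<open>Around a the logarithms change by a negative multiple, around b by a positive multiple of
  the period, while the sum that represents the Cauchy transform stays zero.\<close>

theorem exists_integer_relation:
  assumes V0: "0 \<in> V" and ab: "a \<noteq> b" and Pa: "poly P a = 0" and Pb: "poly P b = 0"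
    and mom: "\<And>i. contour_integral (linepath a b) (\<lambda>z. poly P z ^ i * poly (Q * pderiv P) z) = 0"
  shows "\<exists>t. norm t > \<rho> \<and> t \<notin> V \<and> (\<exists>k :: complex \<Rightarrow> int. germ_rel Q t (fib t) (\<lambda>y. y) (\<lambda>y. of_int (k y)) \<and>
           (\<exists>y\<in>fib t. k y < 0) \<and> (\<exists>y\<in>fib t. k y > 0))"
proof -
  obtain \<rho>0 u v where uv: "\<rho>0 > 0" "- pi < u" "u < v" "v < pi"
    and avoid: "\<And>\<zeta>. Re \<zeta> < ln \<rho>0 \<or> (u < Im \<zeta> \<and> Im \<zeta> < v) \<Longrightarrow> exp \<zeta> \<notin> V"
    using exp_avoids_finite_set[OF finV] by blast
  define c0 where "c0 = ln \<rho>0"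
  define St where "St = {\<zeta>. u < Im \<zeta> \<and> Im \<zeta> < v}"
  define Y where "Y = lhp c0 \<union> St"
  have StI: "St = {\<zeta>. u < Im \<zeta>} \<inter> {\<zeta>. Im \<zeta> < v}" by (auto simp: St_def)
  have convSt: "convex St" unfolding StI
    by (intro convex_Int convex_halfspace_Im_lt convex_halfspace_Im_gt)
  have convL: "convex (lhp c0)" by (rule convex_halfspace_Re_lt)
  have openSt: "open St" unfolding StI by (intro open_Int open_halfspace_Im_lt open_halfspace_Im_gt)
  have openY: "open Y" unfolding Y_def using openSt by (intro open_Un open_halfspace_Re_lt)
  define w where "w = (u + v) / 2"
  have w: "u < w" "w < v" using uv(3) by (auto simp: w_def)
  have "starlike Y" unfolding Y_def
    by (rule starlike_Un_convex[OF convL convSt, of "Complex (c0 - 1) w"]) (use w in \<open>auto simp: St_def\<close>)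
  then have scY: "simply_connected Y" by (rule starlike_imp_simply_connected)
  then have conY: "connected Y" by (rule simply_connected_imp_connected)
  have lpcY: "locally path_connected Y" by (rule open_imp_locally_path_connected[OF openY])
  have expV: "exp \<zeta> \<notin> V" if "\<zeta> \<in> Y" for \<zeta> using that avoid by (auto simp: Y_def St_def c0_def)
  have LY: "lhp c0 \<subseteq> Y" by (simp add: Y_def)

  define \<mu> where "\<mu> = max (norm a) (norm b)"
  have "compact (poly P ` cball 0 \<mu>)" by (intro compact_continuous_image cont) simp
  then have "bounded (poly P ` cball 0 \<mu>)" by (rule compact_imp_bounded)
  then obtain R2 where "\<forall>x\<in>poly P ` cball 0 \<mu>. norm x \<le> R2" unfolding bounded_iff by blast
  then have R2: "norm (poly P x) \<le> R2" if "norm x \<le> \<mu>" for x using that by simp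
  have R20: "R2 \<ge> 0" using R2[of a] norm_ge_zero order_trans unfolding \<mu>_def by (metis max.cobounded1)
  \<comment> \<open>Twice R2 is what the geometric expansion needs, exceeding R2 keeps fibres
    outside the disc of radius \<mu> containing a and b, and exceeding \<rho> is part of the
    claim.\<close>
  define Rf where "Rf = 2 * R2 + 1 + \<bar>\<rho>\<bar>"
  have Rf: "Rf > 0" "Rf \<ge> 2 * R2" "Rf > R2" "Rf > \<rho>" using R20 by (auto simp: Rf_def)
  define D where "D = {\<zeta>. Re \<zeta> > ln Rf} \<inter> St"
  have DY: "D \<subseteq> Y" by (auto simp: D_def Y_def)
  have openD: "open D" unfolding D_def using openSt by (intro open_Int open_halfspace_Re_gt)
  have "convex D" unfolding D_def using convSt by (intro convex_Int convex_halfspace_Re_gt)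
  then have conD: "connected D" by (rule convex_connected)
  define \<zeta>1 where "\<zeta>1 = Complex (ln Rf + 1) w"
  have \<zeta>1D: "\<zeta>1 \<in> D" using w by (simp add: \<zeta>1_def D_def St_def)
  then have \<zeta>1Y: "\<zeta>1 \<in> Y" using DY by blast
  have bigD: "norm (exp \<zeta>) > Rf" if "\<zeta> \<in> D" for \<zeta>
  proof -
    have "exp (ln Rf) < exp (Re \<zeta>)" using that by (simp add: D_def del: exp_ln)
    then show ?thesis using Rf(1) by simp
  qed
  have farD: "norm x > \<mu>" if "\<zeta> \<in> D" "poly P x = exp \<zeta>" for x \<zeta>
    using bigD[OF that(1)] R2[of x] that(2) Rf(3) by (metis less_le_trans not_le order_less_asym)
  define t1 where "t1 = exp \<zeta>1"
  have t1: "t1 \<notin> V" "norm t1 > \<rho>" using expV[OF \<zeta>1Y] bigD[OF \<zeta>1D] Rf(4) by (auto simp: t1_def)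
  define F where "F = fib t1"
  have finF: "finite F" by (simp add: F_def finite_fib)

  have "\<exists>g. continuous_on Y g \<and> g \<zeta>1 = y \<and> (\<forall>\<zeta>\<in>Y. poly P (g \<zeta>) = exp \<zeta>)" if y: "y \<in> F" for y
  proof -
    have Py: "poly P y = t1" using y by (simp add: F_def fib_def)
    have yr: "y \<in> regular" using Py t1 by simp
    have ce: "continuous_on Y exp" by (intro continuous_intros)
    have im: "exp \<in> Y \<rightarrow> - V" using expV by auto
    have eq: "exp \<zeta>1 = poly P y" using Py by (simp add: t1_def)
    show ?thesis
      by (rule covering_space_lift_strong[OF covering yr \<zeta>1Y scY lpcY ce im eq]) blast
  qed
  then obtain z where zc: "\<And>y. y \<in> F \<Longrightarrow> continuous_on Y (z y)" and z1: "\<And>y. y \<in> F \<Longrightarrow> z y \<zeta>1 = y"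
    and Pz: "\<And>y \<zeta>. y \<in> F \<Longrightarrow> \<zeta> \<in> Y \<Longrightarrow> poly P (z y \<zeta>) = exp \<zeta>" by metis
  have zh: "z y holomorphic_on Y" if y: "y \<in> F" for y
    by (rule continuous_lift_holomorphic[OF openY zc[OF y] holomorphic_on_exp Pz[OF y] expV])
  have zinj: "inj_on (\<lambda>y. z y \<zeta>) F" if \<zeta>: "\<zeta> \<in> Y" for \<zeta>
  proof (rule inj_onI)
    fix y y' assume y: "y \<in> F" "y' \<in> F" "z y \<zeta> = z y' \<zeta>"
    have "z y \<zeta>1 = z y' \<zeta>1"
      by (rule continuous_lift_unique[OF conY zc[OF y(1)] zc[OF y(2)] Pz[OF y(1)] Pz[OF y(2)] _ \<zeta> y(3) \<zeta>1Y])
        (use expV in auto)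
    then show "y = y'" using z1 y by simp
  qed
  have zim: "(\<lambda>y. z y \<zeta>) ` F = fib (exp \<zeta>)" if \<zeta>: "\<zeta> \<in> Y" for \<zeta>
  proof (rule card_subset_eq[OF finite_fib])
    show "(\<lambda>y. z y \<zeta>) ` F \<subseteq> fib (exp \<zeta>)" using Pz \<zeta> by (auto simp: fib_def)
    show "card ((\<lambda>y. z y \<zeta>) ` F) = card (fib (exp \<zeta>))"
      using card_image[OF zinj[OF \<zeta>]] card_fib[OF t1(1)] card_fib[OF expV[OF \<zeta>]] by (simp add: F_def)
  qed
  have zna: "z y \<zeta> - a \<noteq> 0" "z y \<zeta> - b \<noteq> 0" if "y \<in> F" "\<zeta> \<in> Y" for y \<zeta>
    using Pz[OF that] Pa Pb by auto

  have "\<exists>L. L holomorphic_on Y \<and> (\<forall>\<zeta>\<in>Y. exp (L \<zeta>) = (z y \<zeta> - b) / (z y \<zeta> - a))" if y: "y \<in> F" for y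
  proof -
    have "(\<lambda>\<zeta>. (z y \<zeta> - b) / (z y \<zeta> - a)) holomorphic_on Y"
      using zh[OF y] zna[OF y] by (intro holomorphic_intros) auto
    from simply_connected_imp_holomorphic_log[OF this scY lpcY] zna[OF y]
    obtain L where "L holomorphic_on Y" "\<And>\<zeta>. \<zeta> \<in> Y \<Longrightarrow> (z y \<zeta> - b) / (z y \<zeta> - a) = exp (L \<zeta>)" by auto
    then show ?thesis by (intro exI[of _ L]) simp
  qed
  then obtain L where Lh: "\<And>y. y \<in> F \<Longrightarrow> L y holomorphic_on Y"
    and Le: "\<And>y \<zeta>. y \<in> F \<Longrightarrow> \<zeta> \<in> Y \<Longrightarrow> exp (L y \<zeta>) = (z y \<zeta> - b) / (z y \<zeta> - a)" by metis
  have Lc: "continuous_on Y (L y)" if "y \<in> F" for y using Lh[OF that] by (rule holomorphic_on_imp_continuous_on)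
  \<comment> \<open>The principal logarithms from the formula for large t; on \<open>D\<close> they
    differ from the logarithms L on \<open>Y\<close> by constant multiples of the period.\<close>
  define lg where "lg x = Ln (1 - b / x) - Ln (1 - a / x)" for x
  have "\<exists>m::int. \<forall>\<zeta>\<in>D. L y \<zeta> = lg (z y \<zeta>) + of_int m * (2 * of_real pi * \<i>)" if y: "y \<in> F" for y
  proof (rule exp_eq_imp_integer_shift[OF conD])
    show "continuous_on D (L y)" using Lc[OF y] DY by (rule continuous_on_subset)
    have far: "norm (z y \<zeta>) > \<mu>" if "\<zeta> \<in> D" for \<zeta> using farD[OF that] Pz[OF y] DY that by blast
    have nz: "z y \<zeta> \<noteq> 0" if "\<zeta> \<in> D" for \<zeta>
      using far[OF that] unfolding \<mu>_def by (metis max.strict_boundedE norm_not_less_zero norm_zero)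
    have ok: "1 - e / z y \<zeta> \<notin> \<real>\<^sub>\<le>\<^sub>0" if "\<zeta> \<in> D" "norm e \<le> \<mu>" for \<zeta> e
    proof -
      have "norm (e / z y \<zeta>) < 1" using far[OF that(1)] nz[OF that(1)] that(2) by (simp add: norm_divide)
      then have "Re (e / z y \<zeta>) < 1" using complex_Re_le_cmod[of "e / z y \<zeta>"] by linarith
      then show ?thesis by (auto simp: complex_nonpos_Reals_iff)
    qed
    have ab\<mu>: "norm a \<le> \<mu>" "norm b \<le> \<mu>" by (auto simp: \<mu>_def)
    have zD: "continuous_on D (z y)" using zc[OF y] DY by (rule continuous_on_subset)
    show "continuous_on D (\<lambda>\<zeta>. lg (z y \<zeta>))" unfolding lg_def
      using zD nz ok ab\<mu> by (intro continuous_intros) auto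
    fix \<zeta> assume \<zeta>: "\<zeta> \<in> D"
    have ne: "1 - a / z y \<zeta> \<noteq> 0" "1 - b / z y \<zeta> \<noteq> 0"
      using ok[OF \<zeta> ab\<mu>(1)] ok[OF \<zeta> ab\<mu>(2)] by (metis nonpos_Reals_zero_I)+
    have "exp (lg (z y \<zeta>)) = (1 - b / z y \<zeta>) / (1 - a / z y \<zeta>)" using ne by (simp add: lg_def exp_diff)
    also have "1 - b / z y \<zeta> = (z y \<zeta> - b) / z y \<zeta>" using nz[OF \<zeta>] by (simp add: diff_divide_distrib)
    also have "1 - a / z y \<zeta> = (z y \<zeta> - a) / z y \<zeta>" using nz[OF \<zeta>] by (simp add: diff_divide_distrib)
    also have "(z y \<zeta> - b) / z y \<zeta> / ((z y \<zeta> - a) / z y \<zeta>) = (z y \<zeta> - b) / (z y \<zeta> - a)"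
      using nz[OF \<zeta>] by simp
    also have "\<dots> = exp (L y \<zeta>)" using Le[OF y] \<zeta> DY by (metis subsetD)
    finally show "exp (L y \<zeta>) = exp (lg (z y \<zeta>))" by simp
  qed
  then obtain m :: "complex \<Rightarrow> int" where
    m: "\<And>y \<zeta>. y \<in> F \<Longrightarrow> \<zeta> \<in> D \<Longrightarrow> L y \<zeta> = lg (z y \<zeta>) + of_int (m y) * (2 * of_real pi * \<i>)" by metis

  define T where "T x = quot_int Q x b - quot_int Q x a" for x
  \<comment> \<open>With the periods m subtracted, G is the Cauchy transform on \<open>D\<close> and
    remains holomorphic on all of \<open>Y\<close>.\<close>
  define G where "G \<zeta> = (\<Sum>y\<in>F. T (z y \<zeta>) + poly Q (z y \<zeta>) * (L y \<zeta> - of_int (m y) * (2 * of_real pi * \<i>)))" for \<zeta>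
  have Th: "(\<lambda>\<zeta>. T (z y \<zeta>)) holomorphic_on Y" if y: "y \<in> F" for y
  proof -
    have "T holomorphic_on UNIV" unfolding T_def by (intro holomorphic_intros quot_int_holomorphic)
    from holomorphic_on_compose_gen[OF zh[OF y] this] show ?thesis by (simp add: o_def)
  qed
  have Qh: "(\<lambda>\<zeta>. poly Q (z y \<zeta>)) holomorphic_on Y" if y: "y \<in> F" for y
    using zh[OF y] by (rule poly_holomorphic_on)
  have Gh: "G holomorphic_on Y" unfolding G_def
    by (intro holomorphic_intros Th Qh Lh)
  have GD: "G \<zeta> = 0" if \<zeta>: "\<zeta> \<in> D" for \<zeta>
  proof -
    have \<zeta>Y: "\<zeta> \<in> Y" using \<zeta> DY by blast
    have "G \<zeta> = (\<Sum>y\<in>F. T (z y \<zeta>) + poly Q (z y \<zeta>) * lg (z y \<zeta>))"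
      unfolding G_def using m \<zeta> by (intro sum.cong) auto
    also have "\<dots> = (\<Sum>x\<in>fib (exp \<zeta>). T x + poly Q x * lg x)"
      unfolding zim[OF \<zeta>Y, symmetric] by (simp add: sum.reindex[OF zinj[OF \<zeta>Y]])
    also have "\<dots> = contour_integral (linepath a b) (\<lambda>z. poly (Q * pderiv P) z / (poly P z - exp \<zeta>))"
      unfolding T_def lg_def
    proof (rule cauchy_transform_eq_log_sum[OF expV[OF \<zeta>Y], symmetric])
      fix x assume "x \<in> fib (exp \<zeta>)"
      then have "norm x > \<mu>" using farD[OF \<zeta>] by (simp add: fib_def)
      then show "norm x > norm a \<and> norm x > norm b" by (simp add: \<mu>_def)
    qed
    also have "\<dots> = 0"
    proof (rule cauchy_transform_eq_0_if_moments_eq_0[OF mom])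
      fix x assume x: "x \<in> closed_segment a b"
      have "closed_segment a b \<subseteq> cball 0 \<mu>" by (intro closed_segment_subset) (auto simp: \<mu>_def)
      then have "norm (poly P x) \<le> R2" using x by (intro R2) auto
      then show "2 * norm (poly P x) \<le> norm (exp \<zeta>)" using bigD[OF \<zeta>] Rf(2) by linarith
    qed simp
    finally show ?thesis .
  qed
  have G0: "G \<zeta> = 0" if "\<zeta> \<in> Y" for \<zeta>
    by (rule analytic_continuation_open[OF openD openY _ conY DY Gh holomorphic_on_const GD that]) (use \<zeta>1D in auto)

  have zL: "continuous_on (lhp c0) (z y)" "\<And>\<zeta>. \<zeta> \<in> lhp c0 \<Longrightarrow> poly P (z y \<zeta>) = exp \<zeta>" if "y \<in> F" for y
    using continuous_on_subset[OF zc[OF that] LY] Pz[OF that] LY by blast+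
  have LV: "exp \<zeta> \<notin> V" if "\<zeta> \<in> lhp c0" for \<zeta> using that LY expV by blast
  have "\<exists>N>0. \<forall>y\<in>F. \<forall>\<zeta>\<in>lhp c0. z y (\<zeta> + of_nat N * (2 * of_real pi * \<i>)) = z y \<zeta>"
    by (rule exp_lift_periodic[OF finF LV zL])
  then obtain N where N: "N > 0"
    and per': "\<forall>y\<in>F. \<forall>\<zeta>\<in>lhp c0. z y (\<zeta> + of_nat N * (2 * of_real pi * \<i>)) = z y \<zeta>"
    by (elim exE conjE)
  have per: "z y (\<zeta> + of_nat N * (2 * of_real pi * \<i>)) = z y \<zeta>" if "y \<in> F" "\<zeta> \<in> lhp c0" for y \<zeta>
    using per'[rule_format, OF that] .
  have sh: "\<zeta> + of_nat N * (2 * of_real pi * \<i>) \<in> lhp c0" if "\<zeta> \<in> lhp c0" for \<zeta> using that by simp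
  have conL: "connected (lhp c0)" using convL by (rule convex_connected)
  have "\<exists>k::int. \<forall>\<zeta>\<in>lhp c0. L y (\<zeta> + of_nat N * (2 * of_real pi * \<i>)) = L y \<zeta> + of_int k * (2 * of_real pi * \<i>)"
    if y: "y \<in> F" for y
  proof (rule exp_eq_imp_integer_shift[OF conL])
    show cL: "continuous_on (lhp c0) (L y)" using Lc[OF y] LY by (rule continuous_on_subset)
    show "continuous_on (lhp c0) (\<lambda>\<zeta>. L y (\<zeta> + of_nat N * (2 * of_real pi * \<i>)))"
      by (rule continuous_on_compose2[OF cL]) (use sh in \<open>auto intro!: continuous_intros\<close>)
    fix \<zeta> assume \<zeta>: "\<zeta> \<in> lhp c0"
    have "\<zeta> \<in> Y" "\<zeta> + of_nat N * (2 * of_real pi * \<i>) \<in> Y" using \<zeta> sh[OF \<zeta>] LY by blast+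
    then show "exp (L y (\<zeta> + of_nat N * (2 * of_real pi * \<i>))) = exp (L y \<zeta>)"
      using Le[OF y] per[OF y \<zeta>] by simp
  qed
  then obtain k :: "complex \<Rightarrow> int" where
    k: "\<And>y \<zeta>. y \<in> F \<Longrightarrow> \<zeta> \<in> lhp c0 \<Longrightarrow> L y (\<zeta> + of_nat N * (2 * of_real pi * \<i>)) = L y \<zeta> + of_int (k y) * (2 * of_real pi * \<i>)"
    by metis
  \<comment> \<open>Up to the factor 2 pi i this is the change of G under translation by
    \<open>N\<close> periods: the branches return, so only the logarithms contribute.\<close>
  define S where "S \<zeta> = (\<Sum>y\<in>F. of_int (k y) * poly Q (z y \<zeta>))" for \<zeta>
  have Sh: "S holomorphic_on Y" unfolding S_def by (intro holomorphic_intros Qh)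
  have SL: "S \<zeta> = 0" if \<zeta>: "\<zeta> \<in> lhp c0" for \<zeta>
  proof -
    have "\<zeta> \<in> Y" "\<zeta> + of_nat N * (2 * of_real pi * \<i>) \<in> Y" using \<zeta> sh[OF \<zeta>] LY by blast+
    then have "0 = G (\<zeta> + of_nat N * (2 * of_real pi * \<i>)) - G \<zeta>" using G0 by simp
    also have "\<dots> = (\<Sum>y\<in>F. of_int (k y) * poly Q (z y \<zeta>) * (2 * of_real pi * \<i>))"
      unfolding G_def sum_subtractf[symmetric]
    proof (rule sum.cong[OF refl])
      fix y assume y: "y \<in> F"
      show "T (z y (\<zeta> + of_nat N * (2 * of_real pi * \<i>))) + poly Q (z y (\<zeta> + of_nat N * (2 * of_real pi * \<i>))) *
            (L y (\<zeta> + of_nat N * (2 * of_real pi * \<i>)) - of_int (m y) * (2 * of_real pi * \<i>)) -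
          (T (z y \<zeta>) + poly Q (z y \<zeta>) * (L y \<zeta> - of_int (m y) * (2 * of_real pi * \<i>))) =
          of_int (k y) * poly Q (z y \<zeta>) * (2 * of_real pi * \<i>)"
        unfolding per[OF y \<zeta>] k[OF y \<zeta>] by (simp add: algebra_simps)
    qed
    also have "\<dots> = S \<zeta> * (2 * of_real pi * \<i>)" unfolding S_def by (rule sum_distrib_right[symmetric])
    finally show ?thesis by simp
  qed
  have S0: "S \<zeta> = 0" if "\<zeta> \<in> Y" for \<zeta>
  proof (rule analytic_continuation_open[OF open_halfspace_Re_lt openY _ conY LY Sh holomorphic_on_const SL that])
    have "complex_of_real (c0 - 1) \<in> lhp c0" by simp
    then show "lhp c0 \<noteq> {}" by blast
  qed

  have cov: "\<exists>y\<in>F. x = z y \<zeta>" if "\<zeta> \<in> lhp c0" "poly P x = exp \<zeta>" for x \<zeta>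
  proof -
    have "x \<in> (\<lambda>y. z y \<zeta>) ` F" using zim[of \<zeta>] that LY by (auto simp: fib_def)
    then show ?thesis by blast
  qed
  have LcL: "continuous_on (lhp c0) (L y)" if "y \<in> F" for y using Lc[OF that] LY by (rule continuous_on_subset)
  have LeL: "exp (L y \<zeta>) = (z y \<zeta> - b) / (z y \<zeta> - a)" if "y \<in> F" "\<zeta> \<in> lhp c0" for y \<zeta>
    using Le that LY by blast
  have neg: "\<exists>y\<in>F. k y < 0"
    by (rule winding_negative[OF ab Pa N zL cov per LcL LeL k])
  \<comment> \<open>Exchanging a and b inverts the quotient, so - L takes the place of L.\<close>
  have "\<exists>y\<in>F. - k y < 0"
  proof (rule winding_negative[OF ab[symmetric] Pb N zL cov per, where L = "\<lambda>y \<zeta>. - L y \<zeta>"])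
    show "continuous_on (lhp c0) (\<lambda>\<zeta>. - L y \<zeta>)" if "y \<in> F" for y
      using LcL[OF that] by (intro continuous_intros)
    show "exp (- L y \<zeta>) = (z y \<zeta> - a) / (z y \<zeta> - b)" if "y \<in> F" "\<zeta> \<in> lhp c0" for y \<zeta>
      using LeL[OF that] by (simp add: exp_minus)
    show "- L y (\<zeta> + of_nat N * (2 * of_real pi * \<i>)) = - L y \<zeta> + of_int (- k y) * (2 * of_real pi * \<i>)"
      if "y \<in> F" "\<zeta> \<in> lhp c0" for y \<zeta>
      using k[OF that] by simp
  qed
  then have pos: "\<exists>y\<in>F. k y > 0" by simp

  have Ln1: "Ln t1 = \<zeta>1" unfolding t1_def using w uv by (intro Ln_exp) (auto simp: \<zeta>1_def)
  have t1n: "t1 \<notin> \<real>\<^sub>\<le>\<^sub>0"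
  proof
    assume "t1 \<in> \<real>\<^sub>\<le>\<^sub>0"
    moreover have "t1 \<noteq> 0" by (simp add: t1_def)
    ultimately have "Im (Ln t1) = pi" by (subst Im_Ln_eq_pi) (auto simp: complex_nonpos_Reals_iff complex_eq_iff)
    then show False using w uv by (simp add: Ln1 \<zeta>1_def)
  qed
  \<comment> \<open>The relation is known in the coordinate \<zeta>; near t1, which is off the cut,
    \<open>Ln\<close> turns it into a relation in t.\<close>
  define U where "U = (- \<real>\<^sub>\<le>\<^sub>0) \<inter> Ln -` Y"
  have "open U" unfolding U_def
    by (intro continuous_open_preimage openY) (auto intro!: continuous_intros simp: closed_def[symmetric] closed_nonpos_Reals_complex)
  moreover have "t1 \<in> U" using t1n Ln1 \<zeta>1Y by (simp add: U_def)
  ultimately obtain r where r: "r > 0" "ball t1 r \<subseteq> U" by (metis openE)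
  have LnY: "Ln t \<in> Y" "exp (Ln t) = t" if "t \<in> ball t1 r" for t
  proof -
    have "t \<in> U" using that r(2) by blast
    then show "Ln t \<in> Y" by (simp add: U_def)
    have "t \<noteq> 0" using \<open>t \<in> U\<close> by (auto simp: U_def)
    then show "exp (Ln t) = t" by simp
  qed
  have "germ_rel Q t1 F (\<lambda>y. y) (\<lambda>y. of_int (k y))"
  proof (rule germ_relI[where br = "\<lambda>y t. z y (Ln t)"])
    show "branches t1 r F (\<lambda>y. y) (\<lambda>y t. z y (Ln t))"
      unfolding branches_def
    proof (intro conjI ballI)
      show "r > 0" by (rule r)
      show "ball t1 r \<subseteq> - V" using LnY expV by (metis ComplI subsetI)
      fix y assume y: "y \<in> F"
      have "Ln holomorphic_on ball t1 r" using r(2) by (intro holomorphic_intros) (auto simp: U_def)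
      moreover have "Ln ` ball t1 r \<subseteq> Y" using LnY(1) by blast
      ultimately show "(\<lambda>t. z y (Ln t)) holomorphic_on ball t1 r"
        using holomorphic_on_compose_gen[OF _ zh[OF y]] unfolding o_def by blast
      show "z y (Ln t1) = y" using z1[OF y] Ln1 by simp
      show "poly P (z y (Ln t)) = t" if "t \<in> ball t1 r" for t
        using Pz[OF y LnY(1)[OF that]] LnY(2)[OF that] by simp
    qed
    show "(\<Sum>y\<in>F. of_int (k y) * poly Q (z y (Ln t))) = 0" if "t \<in> ball t1 r" for t
      using S0[OF LnY(1)[OF that]] by (simp add: S_def)
  qed
  then show ?thesis using t1 neg pos unfolding F_def by blast
qed


section \<open>Branches near infinity\<close>

text \<open>With u = 1/z the equation P(z) = w^n reads 1/w = u / h(u), where h is an n-th root of the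
  reversed polynomial near 0.\<close>

lemma roots_near_infinity:
  obtains R z where "R > 0" "continuous_on {w. norm w > R} z" "inj_on z {w. norm w > R}"
    "\<And>w. norm w > R \<Longrightarrow> poly P (z w) = w ^ degree P"
proof -
  define n where "n = degree P"
  have n: "n > 0" using deg by (simp add: n_def)
  define p where "p = reflect_poly P"
  have p0: "poly p 0 \<noteq> 0" using deg by (auto simp: p_def)
  have prefl: "poly p u = u ^ n * poly P (1 / u)" if "u \<noteq> 0" for u
    using that unfolding p_def n_def by (simp add: poly_reflect_poly_nz inverse_eq_divide)
  have "open {u. poly p u \<noteq> 0}"
    by (intro open_Collect_neq continuous_intros)
  moreover have "0 \<in> {u. poly p u \<noteq> 0}" using p0 by simp
  ultimately obtain r where r: "r > 0" "ball 0 r \<subseteq> {u. poly p u \<noteq> 0}" by (rule openE)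
  have pb: "poly p u \<noteq> 0" if "u \<in> ball 0 r" for u using r(2) that by blast
  have hp: "poly p holomorphic_on ball 0 r" using poly_holomorphic_on[OF holomorphic_on_ident, of p] by simp
  have sc: "simply_connected (ball (0::complex) r)" "locally path_connected (ball (0::complex) r)"
    by (auto intro: convex_imp_simply_connected convex_imp_locally_path_connected)
  from simply_connected_imp_holomorphic_log[OF hp sc pb]
  obtain l where l: "l holomorphic_on ball 0 r" "\<And>u. u \<in> ball 0 r \<Longrightarrow> poly p u = exp (l u)" by metis
  define \<phi> where "\<phi> u = u * exp (- l u / of_nat n)" for u
  have h\<phi>: "\<phi> holomorphic_on ball 0 r" unfolding \<phi>_def using l(1) n by (intro holomorphic_intros) auto
  have \<phi>n: "\<phi> u ^ n = u ^ n / poly p u" if "u \<in> ball 0 r" for u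
  proof -
    have "exp (- l u / of_nat n) ^ n = exp (- l u)" using n by (simp add: exp_of_nat_mult[symmetric])
    then show ?thesis using l(2)[OF that] by (simp add: \<phi>_def power_mult_distrib exp_minus field_simps)
  qed
  have "deriv \<phi> 0 = exp (- l 0 / of_nat n)"
  proof (rule DERIV_imp_deriv)
    have "l field_differentiable (at 0)" using l(1) r(1) by (intro holomorphic_on_imp_differentiable_at[of l "ball 0 r"]) auto
    then obtain l' where "(l has_field_derivative l') (at 0)" by (auto simp: field_differentiable_def)
    then show "(\<phi> has_field_derivative exp (- l 0 / of_nat n)) (at 0)"
      unfolding \<phi>_def using n by (auto intro!: derivative_eq_intros)
  qed
  then have "deriv \<phi> 0 \<noteq> 0" by simp
  then obtain r1 where r1: "r1 > 0" "ball (0::complex) r1 \<subseteq> ball 0 r" "open (\<phi> ` ball 0 r1)" "inj_on \<phi> (ball 0 r1)"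
    using has_complex_derivative_locally_invertible[OF h\<phi>, of 0] r(1) by auto
  have h\<phi>1: "\<phi> holomorphic_on ball 0 r1" using h\<phi> r1(2) by (rule holomorphic_on_subset)
  obtain \<iota> where \<iota>: "\<iota> holomorphic_on \<phi> ` ball 0 r1" "\<And>u. u \<in> ball 0 r1 \<Longrightarrow> \<iota> (\<phi> u) = u"
    using holomorphic_has_inverse[OF h\<phi>1 open_ball r1(4)] by metis
  have "\<phi> 0 = 0" by (simp add: \<phi>_def)
  then have "0 \<in> \<phi> ` ball 0 r1" using r1(1) by (metis centre_in_ball imageI)
  then obtain \<delta> where \<delta>: "\<delta> > 0" "ball 0 \<delta> \<subseteq> \<phi> ` ball 0 r1" using r1(3) by (metis openE)
  define z where "z w = 1 / \<iota> (1 / w)" for w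
  have key: "\<phi> (\<iota> (1 / w)) = 1 / w" "\<iota> (1 / w) \<noteq> 0" "\<iota> (1 / w) \<in> ball 0 r" "1 / w \<in> \<phi> ` ball 0 r1" "w \<noteq> 0"
    if w: "norm w > 1 / \<delta>" for w
  proof -
    show w0: "w \<noteq> 0" using w \<delta>(1) by (auto simp: not_less)
    have "1 / norm w < \<delta>" using w \<delta>(1) w0 by (simp add: field_simps)
    then show im: "1 / w \<in> \<phi> ` ball 0 r1" using \<delta>(2) by (auto simp: norm_divide subset_iff)
    then obtain u where u: "u \<in> ball 0 r1" "1 / w = \<phi> u" by blast
    have eq: "\<iota> (1 / w) = u" unfolding u(2) by (rule \<iota>(2)[OF u(1)])
    show "\<phi> (\<iota> (1 / w)) = 1 / w" using eq u(2) by simp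
    show "\<iota> (1 / w) \<in> ball 0 r" unfolding eq using u(1) r1(2) by blast
    show "\<iota> (1 / w) \<noteq> 0" unfolding eq using u(2) w0 \<open>\<phi> 0 = 0\<close> by (metis divide_eq_0_iff zero_neq_one)
  qed
  show ?thesis
  proof (rule that[of "1 / \<delta>" z])
    show "1 / \<delta> > 0" using \<delta>(1) by simp
    have "continuous_on {w. norm w > 1 / \<delta>} (\<lambda>w. \<iota> (1 / w))"
    proof (rule continuous_on_compose2[OF holomorphic_on_imp_continuous_on[OF \<iota>(1)]])
      show "continuous_on {w. norm w > 1 / \<delta>} (\<lambda>w. 1 / w :: complex)"
        using key(5) by (intro continuous_intros) auto
    qed (use key(4) in auto)
    then show "continuous_on {w. norm w > 1 / \<delta>} z" unfolding z_def
      using key(2) by (intro continuous_intros) auto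
    show "inj_on z {w. norm w > 1 / \<delta>}"
    proof (rule inj_onI)
      fix w w' assume ww: "w \<in> {w. norm w > 1 / \<delta>}" "w' \<in> {w. norm w > 1 / \<delta>}" "z w = z w'"
      then have "\<iota> (1 / w) = \<iota> (1 / w')" by (simp add: z_def)
      then have eq: "\<phi> (\<iota> (1 / w)) = \<phi> (\<iota> (1 / w'))" by (rule arg_cong)
      have "norm w > 1 / \<delta>" "norm w' > 1 / \<delta>" using ww(1,2) unfolding mem_Collect_eq .
      then have "1 / w = 1 / w'" using key(1)[of w] key(1)[of w'] eq by metis
      then show "w = w'" by (metis divide_cancel_left zero_neq_one)
    qed
    fix w :: complex assume w: "norm w > 1 / \<delta>"
    let ?u = "\<iota> (1 / w)"
    have "(1 / w) ^ n = ?u ^ n / poly p ?u" using \<phi>n[OF key(3)[OF w]] key(1)[OF w] by simp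
    also have "\<dots> = 1 / poly P (1 / ?u)" using key(2)[OF w] prefl by simp
    finally have "poly P (1 / ?u) = w ^ n" using key(5)[OF w] by (simp add: power_divide field_simps)
    then show "poly P (z w) = w ^ degree P" by (simp add: z_def n_def)
  qed
qed

text \<open>The points of the fibre are the values of the parametrisation at the n-th roots of t.
  One turn of t on its circle multiplies a root by exp (2 pi i / n), which leads to the next
  point.\<close>

lemma fib_cyclic:
  obtains \<rho> where "\<And>t. norm t > \<rho> \<Longrightarrow> t \<notin> V \<and> (\<exists>x :: int \<Rightarrow> complex. range x = fib t \<and>
     (\<forall>i j. x i = x j \<longleftrightarrow> [i = j] (mod int (degree P))) \<and>
     (\<exists>\<gamma>. path \<gamma> \<and> path_image \<gamma> \<subseteq> - V \<and> pathstart \<gamma> = t \<and> pathfinish \<gamma> = t \<and> (\<forall>i. transport \<gamma> (x i) = x (i + 1))))"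
proof -
  define n where "n = degree P"
  have n: "n > 0" using deg by (simp add: n_def)
  obtain R z where R: "R > 0" and zc: "continuous_on {w. norm w > R} z" and zi: "inj_on z {w. norm w > R}"
    and Pz: "\<And>w. norm w > R \<Longrightarrow> poly P (z w) = w ^ n"
    using roots_near_infinity unfolding n_def by metis
  obtain B where B: "\<And>c. c \<in> V \<Longrightarrow> norm c \<le> B" using finite_imp_bounded[OF finV] by (auto simp: bounded_iff)
  have main: "t \<notin> V \<and> (\<exists>x :: int \<Rightarrow> complex. range x = fib t \<and>
     (\<forall>i j. x i = x j \<longleftrightarrow> [i = j] (mod int n)) \<and>
     (\<exists>\<gamma>. path \<gamma> \<and> path_image \<gamma> \<subseteq> - V \<and> pathstart \<gamma> = t \<and> pathfinish \<gamma> = t \<and> (\<forall>i. transport \<gamma> (x i) = x (i + 1))))"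
    if t: "norm t > max B (R ^ n)" for t
  proof -
    have tV: "t \<notin> V" using B t by force
    have t0: "t \<noteq> 0" using t R by (metis less_max_iff_disj max.strict_boundedE norm_zero not_less zero_le_power less_imp_le)
    define w where "w = exp (Ln t / of_nat n)"
    have wn: "w ^ n = t" using n t0 by (simp add: w_def exp_of_nat_mult[symmetric])
    have w0: "w \<noteq> 0" by (simp add: w_def)
    have "norm w ^ n > R ^ n" using t wn by (metis max.strict_boundedE norm_power)
    then have wR: "norm w > R" by (rule power_less_imp_less_base) simp
    define e where "e s = exp (2 * of_real pi * \<i> * of_real s / of_nat n)" for s :: real
    have ne: "norm (e s) = 1" for s by (simp add: e_def)
    have en: "e s ^ n = exp (2 * of_real pi * \<i> * of_real s)" for s
      using n by (simp add: e_def exp_of_nat_mult[symmetric])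
    have far: "norm (w * e s) > R" for s using wR by (simp add: norm_mult ne)
    have e_int: "exp (2 * of_real pi * \<i> * of_real (real_of_int i)) = 1" for i
      using exp_integer_2pi[of "of_int i"] by (simp add: mult_ac)
    define x where "x i = z (w * e (real_of_int i))" for i
    have x_eq: "x i = x j \<longleftrightarrow> [i = j] (mod int n)" for i j
    proof -
      have "x i = x j \<longleftrightarrow> w * e (real_of_int i) = w * e (real_of_int j)"
        unfolding x_def by (rule inj_on_eq_iff[OF zi]) (use far in auto)
      also have "\<dots> \<longleftrightarrow> e (real_of_int i) = e (real_of_int j)" using w0 by simp
      also have "\<dots> \<longleftrightarrow> (\<exists>m::int. 2 * of_real pi * \<i> * of_real (real_of_int i) / of_nat n
          = 2 * of_real pi * \<i> * of_real (real_of_int j) / of_nat n + of_real (real_of_int (2 * m) * pi) * \<i>)"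
        unfolding e_def exp_eq by simp
      also have "\<dots> \<longleftrightarrow> (\<exists>m::int. i = j + int n * m)"
      proof (intro iff_exI)
        fix m :: int
        have "2 * of_real pi * \<i> * of_real (real_of_int i) / of_nat n
          = 2 * of_real pi * \<i> * of_real (real_of_int j) / of_nat n + of_real (real_of_int (2 * m) * pi) * \<i>
          \<longleftrightarrow> (2 * of_real pi * \<i>) * of_int i = (2 * of_real pi * \<i>) * (of_int j + of_nat n * of_int m :: complex)"
          using n by (simp add: field_simps)
        also have "\<dots> \<longleftrightarrow> of_int i = (of_int (j + int n * m) :: complex)" by simp
        also have "\<dots> \<longleftrightarrow> i = j + int n * m" by (rule of_int_eq_iff)
        finally show "2 * of_real pi * \<i> * of_real (real_of_int i) / of_nat n
          = 2 * of_real pi * \<i> * of_real (real_of_int j) / of_nat n + of_real (real_of_int (2 * m) * pi) * \<i>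
          \<longleftrightarrow> i = j + int n * m" .
      qed
      also have "\<dots> \<longleftrightarrow> [i = j] (mod int n)"
        unfolding cong_iff_dvd_diff dvd_def by (intro iff_exI) auto
      finally show ?thesis .
    qed
    have xF: "x i \<in> fib t" for i
      using Pz[OF far] e_int by (simp add: x_def fib_def power_mult_distrib wn en)
    have "range x = fib t"
    proof (rule card_subset_eq[OF finite_fib])
      show "range x \<subseteq> fib t" using xF by blast
      have "inj_on x {0..<int n}" by (auto simp: inj_on_def x_eq cong_def)
      then have "card (x ` {0..<int n}) = n" by (simp add: card_image)
      moreover have "card (x ` {0..<int n}) \<le> card (range x)"
        using finite_subset[OF \<open>range x \<subseteq> fib t\<close> finite_fib] by (intro card_mono) auto
      moreover have "card (range x) \<le> card (fib t)" by (rule card_mono[OF finite_fib \<open>range x \<subseteq> fib t\<close>])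
      ultimately show "card (range x) = card (fib t)" using card_fib[OF tV] by (simp add: n_def)
    qed
    moreover have "\<exists>\<gamma>. path \<gamma> \<and> path_image \<gamma> \<subseteq> - V \<and> pathstart \<gamma> = t \<and> pathfinish \<gamma> = t \<and> (\<forall>i. transport \<gamma> (x i) = x (i + 1))"
    proof -
      define \<gamma> where "\<gamma> s = t * exp (2 * of_real pi * \<i> * of_real s)" for s
      have p: "path \<gamma>" unfolding path_def \<gamma>_def by (intro continuous_intros)
      have n\<gamma>: "norm (\<gamma> s) = norm t" for s by (simp add: \<gamma>_def norm_mult)
      have im: "path_image \<gamma> \<subseteq> - V"
      proof
        fix c assume "c \<in> path_image \<gamma>"
        then have "norm c = norm t" using n\<gamma> by (auto simp: path_image_def)
        then show "c \<in> - V" using B[of c] t by auto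
      qed
      have tr: "transport \<gamma> (x i) = x (i + 1)" for i
      proof -
        define h where "h s = z (w * e (real_of_int i + s))" for s
        have "continuous_on {0..1} (\<lambda>s. w * e (real_of_int i + s))"
          unfolding e_def using n by (intro continuous_intros) auto
        then have "path h" unfolding path_def h_def
          by (rule continuous_on_compose2[OF zc]) (use far in auto)
        moreover have "poly P (h s) = \<gamma> s" for s
          using Pz[OF far] e_int[of i]
          by (simp add: h_def \<gamma>_def power_mult_distrib wn en distrib_left exp_add)
        ultimately have "transport \<gamma> (pathstart h) = pathfinish h" by (intro transport_eq[OF p im])
        then show ?thesis by (simp add: h_def x_def pathstart_def pathfinish_def add.commute)
      qed
      show ?thesis using p im tr e_int[of 1] by (intro exI[of _ \<gamma>]) (simp add: \<gamma>_def pathstart_def pathfinish_def)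
    qed
    ultimately show ?thesis using x_eq tV by blast
  qed
  show ?thesis using that[of "max B (R ^ n)"] main unfolding n_def by blast
qed


section \<open>From one integer relation to the composition\<close>

theorem comp_if_moments_vanish:
  assumes n2: "degree P \<ge> 2" and V0: "0 \<in> V" and ab: "a \<noteq> b" and Pa: "poly P a = 0" and Pb: "poly P b = 0"
    and mom: "\<And>i. contour_integral (linepath a b) (\<lambda>z. poly P z ^ i * poly (Q * pderiv P) z) = 0"
    and indec: "\<nexists>A B. degree A \<ge> 2 \<and> degree B \<ge> 2 \<and> P = A \<circ>\<^sub>p B"
  shows "\<exists>A. Q = A \<circ>\<^sub>p P"
proof -
  define n where "n = degree P"
  obtain \<rho> where cyc: "\<And>t. norm t > \<rho> \<Longrightarrow> t \<notin> V \<and> (\<exists>x :: int \<Rightarrow> complex. range x = fib t \<and>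
     (\<forall>i j. x i = x j \<longleftrightarrow> [i = j] (mod int n)) \<and>
     (\<exists>\<gamma>. path \<gamma> \<and> path_image \<gamma> \<subseteq> - V \<and> pathstart \<gamma> = t \<and> pathfinish \<gamma> = t \<and> (\<forall>i. transport \<gamma> (x i) = x (i + 1))))"
    using fib_cyclic unfolding n_def by blast
  obtain t k where t\<rho>: "norm t > \<rho>" and rel: "germ_rel Q t (fib t) (\<lambda>y. y) (\<lambda>y. of_int (k y))"
    and neg: "\<exists>y\<in>fib t. k y < (0::int)" and pos: "\<exists>y\<in>fib t. k y > 0"
    using exists_integer_relation[OF V0 ab Pa Pb mom, of \<rho>] by blast
  have tV: "t \<notin> V" using cyc[OF t\<rho>] by blast
  obtain x :: "int \<Rightarrow> complex" and \<gamma>0 where xF: "range x = fib t" and x_eq: "\<And>i j. x i = x j \<longleftrightarrow> [i = j] (mod int n)"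
    and \<gamma>0: "path \<gamma>0" "path_image \<gamma>0 \<subseteq> - V" "pathstart \<gamma>0 = t" "pathfinish \<gamma>0 = t" "\<And>i. transport \<gamma>0 (x i) = x (i + 1)"
    using cyc[OF t\<rho>] by blast
  define Lp where "Lp = {\<gamma>. path \<gamma> \<and> path_image \<gamma> \<subseteq> - V \<and> pathstart \<gamma> = t \<and> pathfinish \<gamma> = t}"
  \<comment> \<open>Restricted to the fibre, since the values of \<open>transport\<close> elsewhere
    carry no meaning.\<close>
  define G where "G = (\<lambda>\<gamma>. restrict (transport \<gamma>) (fib t)) ` Lp"
  have tbij: "bij_betw (transport \<gamma>) (fib t) (fib t)" if "\<gamma> \<in> Lp" for \<gamma>
    using transport_bij[of \<gamma>] that by (simp add: Lp_def)
  have inF: "transport \<gamma> y \<in> fib t" if "\<gamma> \<in> Lp" "y \<in> fib t" for \<gamma> y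
    using bij_betwE[OF tbij[OF that(1)]] that(2) by blast
  interpret primitive_cyclic_group n x G
  proof
    show "n \<ge> 2" using n2 by (simp add: n_def)
    show "x i = x j \<longleftrightarrow> [i = j] (mod int n)" for i j by (rule x_eq)
    have "G \<subseteq> fib t \<rightarrow>\<^sub>E fib t" using inF by (auto simp: G_def)
    then show "finite G" using finite_PiE[OF finite_fib, of t "\<lambda>_. fib t"] finite_fib finite_subset by blast
    show "bij_betw g (range x) (range x)" if "g \<in> G" for g
    proof -
      obtain \<gamma> where \<gamma>: "\<gamma> \<in> Lp" "g = restrict (transport \<gamma>) (fib t)" using \<open>g \<in> G\<close> unfolding G_def by blast
      show ?thesis unfolding xF \<gamma>(2) using tbij[OF \<gamma>(1)] by (subst bij_betw_restrict_eq)
    qed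
    show "g \<in> extensional (range x)" if "g \<in> G" for g using that unfolding xF G_def by auto
    show "restrict (g \<circ> h) (range x) \<in> G" if gh: "g \<in> G" "h \<in> G" for g h
    proof -
      obtain \<gamma> where \<gamma>: "\<gamma> \<in> Lp" "g = restrict (transport \<gamma>) (fib t)" using gh(1) unfolding G_def by blast
      obtain \<delta> where \<delta>: "\<delta> \<in> Lp" "h = restrict (transport \<delta>) (fib t)" using gh(2) unfolding G_def by blast
      have J: "\<delta> +++ \<gamma> \<in> Lp" using \<gamma>(1) \<delta>(1) by (auto simp: Lp_def path_image_join)
      have "restrict (g \<circ> h) (range x) = restrict (transport (\<delta> +++ \<gamma>)) (fib t)"
        unfolding xF
      proof (rule restrict_ext)
        fix y assume y: "y \<in> fib t"
        have "transport (\<delta> +++ \<gamma>) y = transport \<gamma> (transport \<delta> y)"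
          using \<gamma>(1) \<delta>(1) y by (intro transport_join) (auto simp: Lp_def)
        then show "(g \<circ> h) y = transport (\<delta> +++ \<gamma>) y"
          unfolding \<gamma>(2) \<delta>(2) using y inF[OF \<delta>(1) y] by simp
      qed
      then show ?thesis using J unfolding G_def by blast
    qed
    show "\<exists>s\<in>G. \<forall>i. s (x i) = x (i + 1)"
    proof (rule bexI)
      show "restrict (transport \<gamma>0) (fib t) \<in> G" unfolding G_def using \<gamma>0 by (intro imageI) (simp add: Lp_def)
      show "\<forall>i. restrict (transport \<gamma>0) (fib t) (x i) = x (i + 1)" using \<gamma>0(5) xF by auto
    qed
    show "R = Id_on (range x) \<or> R = range x \<times> range x"
      if R: "equiv (range x) R" and inv: "\<And>g p q. g \<in> G \<Longrightarrow> (p, q) \<in> R \<Longrightarrow> (g p, g q) \<in> R" for R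
    proof (rule ccontr)
      assume nt: "\<not> ?thesis"
      have "\<exists>A B. degree A \<ge> 2 \<and> degree B \<ge> 2 \<and> P = A \<circ>\<^sub>p B"
      proof (rule decomposition_if_imprimitive[OF tV])
        show "equiv (fib t) R" using R unfolding xF .
        show "R \<noteq> Id_on (fib t)" "R \<noteq> fib t \<times> fib t" using nt unfolding xF by auto
        fix \<gamma> p q assume \<gamma>: "path \<gamma>" "path_image \<gamma> \<subseteq> - V" "pathstart \<gamma> = t" "pathfinish \<gamma> = t" and pq: "(p, q) \<in> R"
        have F: "p \<in> fib t" "q \<in> fib t" using R pq unfolding xF equiv_def refl_on_def by auto
        have "restrict (transport \<gamma>) (fib t) \<in> G" unfolding G_def using \<gamma> by (intro imageI) (simp add: Lp_def)
        from inv[OF this pq] show "(transport \<gamma> p, transport \<gamma> q) \<in> R" using F by simp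
      qed
      then show False using indec by blast
    qed
  qed
  define W where "W = {w. germ_rel Q t (fib t) (\<lambda>y. y) w}"
  obtain r br where b: "branches t r (fib t) (\<lambda>y. y) br"
    using branches_exist[OF tV, of "fib t" "\<lambda>y. y"] by (auto simp: fib_def)
  have r: "r > 0" and br: "\<And>y. y \<in> fib t \<Longrightarrow> br y t = y"
    and Pbr: "\<And>y s. y \<in> fib t \<Longrightarrow> s \<in> ball t r \<Longrightarrow> poly P (br y s) = s" using b by (auto simp: branches_def)
  have W_iff: "w \<in> W \<longleftrightarrow> (\<forall>s\<in>ball t r. (\<Sum>y\<in>fib t. w y * poly Q (br y s)) = 0)" for w
  proof -
    have "germ_rel Q t (fib t) (\<lambda>y. y) w \<longleftrightarrow> germ_rel Q t (fib t) (\<lambda>y. br y t) w"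
      using br by (intro germ_rel_cong_pt) simp
    also have "\<dots> \<longleftrightarrow> (\<forall>s\<in>ball t r. (\<Sum>y\<in>fib t. w y * poly Q (br y s)) = 0)"
      using r by (intro germ_rel_branches_iff[OF b]) simp
    finally show ?thesis by (simp add: W_def)
  qed
  obtain y0 y1 where y01: "y0 \<in> fib t" "y1 \<in> fib t" "k y0 < 0" "k y1 > 0" using neg pos by blast
  obtain i0 j0 where ij: "y0 = x i0" "y1 = x j0" using y01(1,2) unfolding xF[symmetric] by blast
  have diff: "(\<lambda>y. of_bool (y = x i) - of_bool (y = x j)) \<in> W" for i j
  proof (rule invariant_subspace_contains_differences)
    show "(\<lambda>_. 0) \<in> W" by (simp add: W_iff)
    show "(\<lambda>y. v y + w y) \<in> W" if "v \<in> W" "w \<in> W" for v w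
      using that by (simp add: W_iff distrib_right sum.distrib)
    show "(\<lambda>y. c * w y) \<in> W" if "w \<in> W" for c w
      using that by (simp add: W_iff mult.assoc sum_distrib_left[symmetric])
    show "v \<in> W" if "w \<in> W" "\<And>y. y \<in> range x \<Longrightarrow> v y = w y" for v w
      using that by (simp add: W_iff xF)
    show "(\<lambda>y. of_int (k y)) \<in> W" using rel by (simp add: W_def)
    show "k (x i0) \<noteq> k (x j0)" using y01 ij by simp
    show "(\<lambda>y. w (g y)) \<in> W" if g: "g \<in> G" and w: "w \<in> W" for g w
    proof -
      obtain \<gamma> where \<gamma>: "\<gamma> \<in> Lp" "g = restrict (transport \<gamma>) (fib t)" using g unfolding G_def by blast
      have p: "path \<gamma>" "path_image \<gamma> \<subseteq> - V" "pathstart \<gamma> = t" "pathfinish \<gamma> = t" using \<gamma>(1) by (auto simp: Lp_def)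
      \<comment> \<open>Renaming the summation index attaches the coefficients to transported
        points. Continuation backwards along the loop returns the points to their places and keeps
        the coefficients.\<close>
      have "germ_rel Q t (fib t) (\<lambda>y. transport \<gamma> y) (\<lambda>y. w (transport \<gamma> y))"
        using germ_rel_reindex[OF tbij[OF \<gamma>(1)], of Q t "\<lambda>y. y" w] w by (simp add: W_def)
      then have "germ_rel Q t (fib t) (\<lambda>y. y) (\<lambda>y. w (transport \<gamma> y))"
        using germ_rel_transport[OF p(1,2), of "fib t" "\<lambda>y. y" Q "\<lambda>y. w (transport \<gamma> y)"] p(3,4) by simp
      then have "(\<lambda>y. w (transport \<gamma> y)) \<in> W" by (simp add: W_def)
      then show ?thesis unfolding W_iff \<gamma>(2) by (simp cong: sum.cong)
    qed
  qed
  have Qeq: "poly Q (br y s) = poly Q (br y' s)" if y: "y \<in> fib t" "y' \<in> fib t" and s: "s \<in> ball t r" for y y' s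
  proof -
    obtain i j where ij: "y = x i" "y' = x j" using y unfolding xF[symmetric] by blast
    have "(\<Sum>z\<in>fib t. (of_bool (z = y) - of_bool (z = y')) * poly Q (br z s)) = 0"
      using diff[of i j] s unfolding ij W_iff by blast
    moreover have "(\<Sum>z\<in>fib t. (of_bool (z = y) - of_bool (z = y')) * poly Q (br z s))
        = (\<Sum>z\<in>fib t. if z = y then poly Q (br z s) else 0) - (\<Sum>z\<in>fib t. if z = y' then poly Q (br z s) else 0)"
      unfolding sum_subtractf[symmetric] by (intro sum.cong) auto
    ultimately show ?thesis using y finite_fib by simp
  qed
  have binj: "inj_on (\<lambda>y. br y s) (fib t)" if s: "s \<in> ball t r" for s
  proof (rule inj_onI)
    fix y y' assume y: "y \<in> fib t" "y' \<in> fib t" "br y s = br y' s"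
    have c: "continuous_on (ball t r) (br y)" if "y \<in> fib t" for y
      using b that by (auto simp: branches_def intro: holomorphic_on_imp_continuous_on)
    have V: "(\<lambda>s. s) ` ball t r \<subseteq> - V" using b by (simp add: branches_def)
    have tb: "t \<in> ball t r" using r by simp
    have "br y t = br y' t"
      by (rule continuous_lift_unique[OF connected_ball c[OF y(1)] c[OF y(2)] Pbr[OF y(1)] Pbr[OF y(2)] V s y(3) tb])
    then show "y = y'" using br y by simp
  qed
  have deg0: "degree P > 0" by (rule deg)
  have "infinite (ball t r)"
    using r by (metis finite_imp_not_open open_ball centre_in_ball empty_iff)
  then show ?thesis
  proof (rule poly_comp_if_constant_on_fibres[OF deg0])
    fix s assume s: "s \<in> ball t r"
    obtain y where y: "y \<in> fib t" using y01 by blast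
    show "\<exists>S c. finite S \<and> card S = degree P \<and> (\<forall>z\<in>S. poly P z = s \<and> poly Q z = c)"
    proof (intro exI conjI ballI)
      show "finite ((\<lambda>y. br y s) ` fib t)" using finite_fib by simp
      show "card ((\<lambda>y. br y s) ` fib t) = degree P" using card_image[OF binj[OF s]] card_fib[OF tV] by simp
      fix z assume "z \<in> (\<lambda>y. br y s) ` fib t"
      then obtain y' where y': "y' \<in> fib t" "z = br y' s" by blast
      show "poly P z = s" using Pbr[OF y'(1) s] y'(2) by simp
      show "poly Q z = poly Q (br y s)" using Qeq[OF y'(1) y s] y'(2) by simp
    qed
  qed
qed

end

subsection \<open>The polynomial moment problem\<close>

lemma poly_antiderivative: "\<exists>A. pderiv A = (p :: complex poly)"
proof -
  define A where "A = (\<Sum>i\<le>degree p. monom (coeff p i / of_nat (Suc i)) (Suc i))"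
  have "pderiv (sum f I) = (\<Sum>i\<in>I. pderiv (f i))" for f :: "nat \<Rightarrow> complex poly" and I
    by (induction I rule: infinite_finite_induct) (auto simp: pderiv_add)
  then have "pderiv A = (\<Sum>i\<le>degree p. monom (coeff p i) i)"
    unfolding A_def by (simp add: pderiv_monom del: of_nat_Suc)
  then show ?thesis using poly_as_sum_of_monoms[of p] by metis
qed

lemma contour_integral_poly:
  assumes "valid_path \<gamma>" "pderiv A = p"
  shows "contour_integral \<gamma> (poly p) = poly A (pathfinish \<gamma>) - poly A (pathstart \<gamma>)"
proof (rule contour_integral_unique, rule contour_integral_primitive[of UNIV])
  show "(poly A has_field_derivative poly p z) (at z within UNIV)" for z
    unfolding assms(2)[symmetric] by (rule poly_DERIV)
qed (use assms in auto)

text \<open>The condition exact p says that the integral of p from a to b vanishes, without reference to a path.\<close>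

lemma moments_shift:
  fixes P Q :: "complex poly" and a b c :: complex
  defines "exact \<equiv> \<lambda>p. \<exists>A. pderiv A = p \<and> poly A a = poly A b"
  assumes ex: "\<And>i. exact (P ^ i * pderiv Q)" and c: "poly P a = c" "poly P b = c"
  shows "exact ((P - [:c:]) ^ i * (Q * pderiv (P - [:c:])))"
proof -
  have add: "exact (p + q)" if pq: "exact p" "exact q" for p q
  proof -
    obtain A B where "pderiv A = p" "poly A a = poly A b" "pderiv B = q" "poly B a = poly B b"
      using pq unfolding exact_def by blast
    then show ?thesis unfolding exact_def by (intro exI[of _ "A + B"]) (simp add: pderiv_add)
  qed
  have smult: "exact (smult s p)" if p: "exact p" for s p
  proof -
    obtain A where "pderiv A = p" "poly A a = poly A b" using p unfolding exact_def by blast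
    then show ?thesis unfolding exact_def by (intro exI[of _ "smult s A"]) (simp add: pderiv_smult)
  qed
  let ?P = "P - [:c:]"
  \<comment> \<open>The exponent of P is kept general because each factor P - c that is expanded
    raises it by one in the first term.\<close>
  have shift: "exact (?P ^ j * (P ^ i * pderiv Q))" for i j
  proof (induction j arbitrary: i)
    case 0
    then show ?case using ex by simp
  next
    case (Suc j)
    have step: "?P ^ Suc j * (P ^ i * pderiv Q) = ?P ^ j * (P ^ Suc i * pderiv Q) + smult (- c) (?P ^ j * (P ^ i * pderiv Q))"
      by (simp add: algebra_simps)
    show ?case unfolding step by (rule add[OF Suc smult[OF Suc]])
  qed
  obtain A where A: "pderiv A = ?P ^ Suc i * pderiv Q" "poly A a = poly A b"
    using shift[of "Suc i" 0] unfolding exact_def by auto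
  \<comment> \<open>Integration by parts: the boundary term vanishes since P - c is 0 at both ends,
    and differentiation lowers the exponent i + 1 to i.\<close>
  define B where "B = ?P ^ Suc i * Q - A"
  have "pderiv B = smult (of_nat (Suc i)) (?P ^ i * (Q * pderiv ?P))"
    unfolding B_def pderiv_diff A(1) pderiv_mult pderiv_power_Suc
    by (simp add: algebra_simps del: of_nat_Suc power_Suc)
  moreover have "poly B a = poly B b" unfolding B_def using c A(2) by simp
  ultimately have "exact (smult (of_nat (Suc i)) (?P ^ i * (Q * pderiv ?P)))" unfolding exact_def by blast
  from smult[OF this, of "1 / of_nat (Suc i)"] show ?thesis by (simp del: of_nat_Suc power_Suc)
qed

theorem theorem1:
  fixes P q Q :: "complex poly" and a b :: complex and \<gamma> :: "real \<Rightarrow> complex"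
  assumes "degree P > 0"
    and "a \<noteq> b"
    and "poly P a = poly P b"
    and "valid_path \<gamma>" and "pathstart \<gamma> = a" and "pathfinish \<gamma> = b"
    and "\<And>i :: nat. contour_integral \<gamma> (\<lambda>z. poly P z ^ i * poly q z) = 0"
    and "indecomposable_poly P"
    and "pderiv Q = q"
  shows "\<exists>Qt :: complex poly. Q = Qt \<circ>\<^sub>p P"
proof -
  define c where "c = poly P a"
  define P0 where "P0 = P - [:c:]"
  \<comment> \<open>The point 0, around which the continuation winds, is removed along with the
    critical values.\<close>
  define V where "V = insert 0 (poly P0 ` {z. poly (pderiv P0) z = 0})"
  have P: "P = P0 + [:c:]" by (simp add: P0_def)
  have dP0: "degree P0 = degree P"
    unfolding P0_def using degree_add_eq_left[of "- [:c:]" P] assms(1)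
    by (simp only: diff_conv_add_uminus degree_minus degree_pCons_0)
  have roots: "poly P0 a = 0" "poly P0 b = 0" using assms(3) by (simp_all add: P0_def c_def)
  have "pderiv P0 \<noteq> 0" using dP0 assms(1) by (simp add: pderiv_eq_0_iff)
  then interpret poly_covering P0 V
    using dP0 assms(1) by unfold_locales (auto simp: V_def poly_roots_finite)
  \<comment> \<open>Two distinct points in one fibre exclude degree 1.\<close>
  have "card {a, b} \<le> card (fib 0)" using roots by (intro card_mono[OF finite_fib]) (auto simp: fib_def)
  moreover have "card (fib 0) \<le> degree P0" unfolding fib_def using dP0 assms(1) by (intro card_poly_roots_bound) auto
  ultimately have n2: "degree P0 \<ge> 2" using assms(2) by simp
  \<comment> \<open>An antiderivative with equal values at a and b expresses the moment condition
    free of \<open>\<gamma>\<close>, so that the later integrals may run along the segment.\<close>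
  have "\<exists>A. pderiv A = P ^ i * pderiv Q \<and> poly A a = poly A b" for i
  proof -
    obtain A where A: "pderiv A = P ^ i * pderiv Q" using poly_antiderivative by blast
    have "poly A b - poly A a = contour_integral \<gamma> (poly (P ^ i * pderiv Q))"
      using contour_integral_poly[OF assms(4) A] assms(5,6) by simp
    also have "\<dots> = 0" using assms(7)[of i] unfolding assms(9) by (simp add: poly_mult[abs_def] poly_power[abs_def])
    finally show ?thesis using A by auto
  qed
  then have "\<exists>A. pderiv A = P0 ^ i * (Q * pderiv P0) \<and> poly A a = poly A b" for i
    unfolding P0_def by (rule moments_shift) (simp_all add: c_def assms(3))
  then have mom: "contour_integral (linepath a b) (\<lambda>z. poly P0 z ^ i * poly (Q * pderiv P0) z) = 0" for i
  proof -
    obtain A where A: "pderiv A = P0 ^ i * (Q * pderiv P0)" "poly A a = poly A b"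
      using \<open>\<And>i. \<exists>A. pderiv A = P0 ^ i * (Q * pderiv P0) \<and> poly A a = poly A b\<close> by blast
    have "(\<lambda>z. poly P0 z ^ i * poly (Q * pderiv P0) z) = poly (P0 ^ i * (Q * pderiv P0))" by (auto simp: poly_power)
    then show ?thesis using contour_integral_poly[OF valid_path_linepath A(1), of a b] A(2) by simp
  qed
  have indec: "\<nexists>A B. degree A \<ge> 2 \<and> degree B \<ge> 2 \<and> P0 = A \<circ>\<^sub>p B"
  proof
    assume "\<exists>A B. degree A \<ge> 2 \<and> degree B \<ge> 2 \<and> P0 = A \<circ>\<^sub>p B"
    then obtain A B where AB: "degree A \<ge> 2" "degree B \<ge> 2" "P0 = A \<circ>\<^sub>p B" by blast
    have "P = (A + [:c:]) \<circ>\<^sub>p B" unfolding P AB(3) by (simp add: pcompose_add)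
    moreover have "degree (A + [:c:]) = degree A" using AB(1) by (intro degree_add_eq_left) simp
    ultimately show False using assms(8) AB(1,2) unfolding indecomposable_poly_def by metis
  qed
  obtain A where A: "Q = A \<circ>\<^sub>p P0"
    using comp_if_moments_vanish[OF n2 _ assms(2) roots mom indec] by (auto simp: V_def)
  have "P0 = [:- c, 1:] \<circ>\<^sub>p P" by (simp add: P0_def pcompose_pCons)
  then have "Q = (A \<circ>\<^sub>p [:- c, 1:]) \<circ>\<^sub>p P" using A by (simp add: pcompose_assoc)
  then show ?thesis by blast
qed

end
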